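(* Let $Z\in\mathbf{LPS}$ be a local po-space. Let $\mathbf{Etale}(Z)$ be the category of di-étale bundles over $Z$, i.e. the category of bundles over $Z$ which are local dihomeomorphisms, and let $\mathcal O(Z)$ be the category of open subobjects of $Z$. There is an equivalence of categories $$\Gamma:\mathbf{Etale}(Z)\leftrightarrows\mathbf{Shv}(\mathcal O(Z)):\Lambda .$$
   Context: **Local po-spaces.** $\mathbf{Spaces}$ is the category whose objects are subspaces of $\mathbb{R}^n$ for some $n$ and whose morphisms are continuous maps. A po-space is an object $U$ of $\mathbf{Spaces}$ with a partial order $\le$ that is a closed subset of $U\times U$. For $M\in\mathbf{Spaces}$, an order-atlas on $M$ is an open cover $U=\{U_i\}_{i\in I}$ of $M$ in which each $U_i$ is a po-space with order $\le_i$, such that $\le_i$ and $\le_j$ agree on $U_i\cap U_j$ for all $i,j$. An order-atlas $U'$ is a refinement of $U$ if for all $U_i\in U$ and $x\in U_i$ there is $U'_j\in U'$ with $x\in U'_j\subseteq U_i$ and, for all $a,b\in U'_j$, $a\le_{U'_j}b$ iff $a\le_{U_i}b$. Two order-atlases are equivalent if they have a common refinement (this is an equivalence relation). Objects of $\mathbf{LPS}$ (local po-spaces) are pairs $(M,\mathcal U)$ with $M\in\mathbf{Spaces}$ and $\mathcal U$ an equivalence class of order-atlases on $M$. A morphism (dimap) $f:(M,\mathcal U)\to(N,\mathcal V)$ is a continuous map $f:M\to N$ such that for every $V=\{V_j\}\in\mathcal V$ there is $U=\{U_i\}\in\mathcal U$ such that for all $i,j$ and all $x,y\in U_i\cap f^{-1}(V_j)$,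 $x\le_{U_i}y$ implies $f(x)\le_{V_j}f(y)$. A subspace $L\subseteq M$ of a local po-space $(M,\mathcal U)$ inherits a local po-space structure: the class of the order-atlas $\{L\cap U_i\}$ with the restricted orders, for any $\{U_i\}\in\mathcal U$. **Bundles and sheaves.** A bundle over $Z$ is a morphism $p:W\to Z$ in $\mathbf{LPS}$. It is a di-étale bundle (local dihomeomorphism) if for every $y\in W$ there is an open set $V\subseteq W$ with $y\in V$ such that $p(V)$ is open in $Z$ and $p|_V:V\to p(V)$ is an isomorphism in $\mathbf{LPS}$. A morphism from $p:W\to Z$ to $p':W'\to Z$ in $\mathbf{Etale}(Z)$ is a dimap $\theta:W\to W'$ with $p'\theta=p$. $\mathcal O(Z)$ has as objects the open subobjects of $Z$ (open subspaces with inherited structure) and as morphisms the inclusions; $\mathbf{Shv}(\mathcal O(Z))$ is the category of sheaves of sets on $\mathcal O(Z)$ for the open cover topology. **The functors.** $\Gamma$ sends $p:W\to Z$ to its sheaf of cross-sections $U\mapsto\{s:U\to W\text{ in }\mathbf{LPS}\mid p\circ s=\mathrm{Id}_U\}$, with restriction maps given by precomposition with inclusions. $\Lambda$ sends a sheaf $P$ to $p:W\to Z$, where $W=\{\operatorname{germ}_x s\mid x\in U,\ U\text{ open in }Z,\ s\in P(U)\}$ (germs in the stalks $\operatorname{colim}_{x\in U}P(U)$), $p(\operatorname{germ}_xs)=x$; the topology on $W$ has as basis the sets $\dot s(U)=\{\operatorname{germ}_xs\mid x\in U\}$ for $U$ open in $Z$ and $s\in P(U)$; and the local order on $W$ is the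 equivalence class of the order-atlas consisting of the sets $\dot s(V)$ for $V$ an open subset of a member $U_i$ of a chosen order-atlas $\{(U_i,\le_i)\}$ of $Z$ and $s\in P(V)$, ordered by $\operatorname{germ}_xs\le\operatorname{germ}_ys$ iff $x\le_iy$.
   Formalization: Germ spaces need not embed in R^n (Z a point, an uncountable set), so the claim is proved in two forms: all sheaves (in a large enough universe), with bundles on arbitrary topological spaces; and bundles in LPS, with only those sheaves whose germ space embeds in some R^n. *)

theory Defs
  imports "HOL-Analysis.Analysis"
begin

section \<open>Categories, functors, equivalences\<close>

text \<open>
  Hom-sets need not be disjoint, so composition takes the three objects as arguments:
  \<open>Cmp C X Y Z g f\<close> is the composite of \<open>f \<in> Hom C X Y\<close> and \<open>g \<in> Hom C Y Z\<close>.
\<close>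

record ('o, 'm) cat =
  Ob :: "'o set"
  Hom :: "'o \<Rightarrow> 'o \<Rightarrow> 'm set"
  Idn :: "'o \<Rightarrow> 'm"
  Cmp :: "'o \<Rightarrow> 'o \<Rightarrow> 'o \<Rightarrow> 'm \<Rightarrow> 'm \<Rightarrow> 'm"

definition is_category :: "('o, 'm) cat \<Rightarrow> bool" where
  "is_category C \<longleftrightarrow>
     (\<forall>X\<in>Ob C. Idn C X \<in> Hom C X X) \<and>
     (\<forall>X\<in>Ob C. \<forall>Y\<in>Ob C. \<forall>Z\<in>Ob C. \<forall>f\<in>Hom C X Y. \<forall>g\<in>Hom C Y Z.
        Cmp C X Y Z g f \<in> Hom C X Z) \<and>
     (\<forall>X\<in>Ob C. \<forall>Y\<in>Ob C. \<forall>f\<in>Hom C X Y.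
        Cmp C X X Y f (Idn C X) = f \<and> Cmp C X Y Y (Idn C Y) f = f) \<and>
     (\<forall>X\<in>Ob C. \<forall>Y\<in>Ob C. \<forall>Z\<in>Ob C. \<forall>V\<in>Ob C.
        \<forall>f\<in>Hom C X Y. \<forall>g\<in>Hom C Y Z. \<forall>h\<in>Hom C Z V.
        Cmp C X Z V h (Cmp C X Y Z g f) = Cmp C X Y V (Cmp C Y Z V h g) f)"

definition op_cat :: "('o, 'm) cat \<Rightarrow> ('o, 'm) cat" where
  "op_cat C = \<lparr>Ob = Ob C, Hom = (\<lambda>X Y. Hom C Y X), Idn = Idn C,
     Cmp = (\<lambda>X Y Z g f. Cmp C Z Y X f g)\<rparr>"

definition full_subcat :: "('o, 'm) cat \<Rightarrow> 'o set \<Rightarrow> ('o, 'm) cat" where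
  "full_subcat C S = \<lparr>Ob = Ob C \<inter> S, Hom = Hom C, Idn = Idn C, Cmp = Cmp C\<rparr>"

definition set_cat :: "('s set, 's \<Rightarrow> 's) cat" where
  "set_cat = \<lparr>Ob = UNIV, Hom = (\<lambda>A B. A \<rightarrow>\<^sub>E B), Idn = (\<lambda>A. \<lambda>x\<in>A. x),
     Cmp = (\<lambda>A B C g f. compose A g f)\<rparr>"

record ('o, 'm, 'p, 'n) func =
  fob :: "'o \<Rightarrow> 'p"
  fmor :: "'o \<Rightarrow> 'o \<Rightarrow> 'm \<Rightarrow> 'n"

definition is_functor :: "('o, 'm) cat \<Rightarrow> ('p, 'n) cat \<Rightarrow> ('o, 'm, 'p, 'n) func \<Rightarrow> bool" where
  "is_functor C D F \<longleftrightarrow>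
     (\<forall>X\<in>Ob C. fob F X \<in> Ob D \<and> fmor F X X (Idn C X) = Idn D (fob F X)) \<and>
     (\<forall>X\<in>Ob C. \<forall>Y\<in>Ob C. \<forall>f\<in>Hom C X Y. fmor F X Y f \<in> Hom D (fob F X) (fob F Y)) \<and>
     (\<forall>X\<in>Ob C. \<forall>Y\<in>Ob C. \<forall>Z\<in>Ob C. \<forall>f\<in>Hom C X Y. \<forall>g\<in>Hom C Y Z.
        fmor F X Z (Cmp C X Y Z g f) =
        Cmp D (fob F X) (fob F Y) (fob F Z) (fmor F Y Z g) (fmor F X Y f))"

definition id_func :: "('o, 'm, 'o, 'm) func" where
  "id_func = \<lparr>fob = (\<lambda>X. X), fmor = (\<lambda>X Y f. f)\<rparr>"

definition comp_func ::
  "('p, 'n, 'q, 'k) func \<Rightarrow> ('o, 'm, 'p, 'n) func \<Rightarrow> ('o, 'm, 'q, 'k) func" where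
  "comp_func G F = \<lparr>fob = (\<lambda>X. fob G (fob F X)),
     fmor = (\<lambda>X Y f. fmor G (fob F X) (fob F Y) (fmor F X Y f))\<rparr>"

definition is_nat_trans ::
  "('o, 'm) cat \<Rightarrow> ('p, 'n) cat \<Rightarrow> ('o, 'm, 'p, 'n) func \<Rightarrow> ('o, 'm, 'p, 'n) func \<Rightarrow>
   ('o \<Rightarrow> 'n) \<Rightarrow> bool" where
  "is_nat_trans C D F G \<eta> \<longleftrightarrow>
     (\<forall>X\<in>Ob C. \<eta> X \<in> Hom D (fob F X) (fob G X)) \<and>
     (\<forall>X\<in>Ob C. \<forall>Y\<in>Ob C. \<forall>f\<in>Hom C X Y.
        Cmp D (fob F X) (fob F Y) (fob G Y) (\<eta> Y) (fmor F X Y f) =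
        Cmp D (fob F X) (fob G X) (fob G Y) (fmor G X Y f) (\<eta> X))"

definition is_isomorphism :: "('o, 'm) cat \<Rightarrow> 'o \<Rightarrow> 'o \<Rightarrow> 'm \<Rightarrow> bool" where
  "is_isomorphism C X Y f \<longleftrightarrow> f \<in> Hom C X Y \<and>
     (\<exists>g\<in>Hom C Y X. Cmp C X Y X g f = Idn C X \<and> Cmp C Y X Y f g = Idn C Y)"

definition is_nat_iso ::
  "('o, 'm) cat \<Rightarrow> ('p, 'n) cat \<Rightarrow> ('o, 'm, 'p, 'n) func \<Rightarrow> ('o, 'm, 'p, 'n) func \<Rightarrow>
   ('o \<Rightarrow> 'n) \<Rightarrow> bool" where
  "is_nat_iso C D F G \<eta> \<longleftrightarrow> is_nat_trans C D F G \<eta> \<and>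
     (\<forall>X\<in>Ob C. is_isomorphism D (fob F X) (fob G X) (\<eta> X))"

definition is_cat_equivalence ::
  "('o, 'm) cat \<Rightarrow> ('p, 'n) cat \<Rightarrow> ('o, 'm, 'p, 'n) func \<Rightarrow> ('p, 'n, 'o, 'm) func \<Rightarrow> bool" where
  "is_cat_equivalence C D F G \<longleftrightarrow>
     is_category C \<and> is_category D \<and> is_functor C D F \<and> is_functor D C G \<and>
     (\<exists>\<eta>. is_nat_iso C C id_func (comp_func G F) \<eta>) \<and>
     (\<exists>\<epsilon>. is_nat_iso D D (comp_func F G) id_func \<epsilon>)"

definition func_cat ::
  "('o, 'm) cat \<Rightarrow> ('p, 'n) cat \<Rightarrow> (('o, 'm, 'p, 'n) func, 'o \<Rightarrow> 'n) cat" where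
  "func_cat C D = \<lparr>Ob = {F. is_functor C D F},
     Hom = (\<lambda>F G. {\<eta> \<in> extensional (Ob C). is_nat_trans C D F G \<eta>}),
     Idn = (\<lambda>F. \<lambda>X\<in>Ob C. Idn D (fob F X)),
     Cmp = (\<lambda>F G H \<theta> \<eta>. \<lambda>X\<in>Ob C. Cmp D (fob F X) (fob G X) (fob H X) (\<theta> X) (\<eta> X))\<rparr>"


section \<open>Local po-spaces\<close>

text \<open>
  A chart is an open set together with its order; an order-atlas is a set of charts.
  A local po-space is a topology together with an equivalence class of order-atlases.
\<close>

type_synonym 'a atlas = "('a set \<times> 'a rel) set"
type_synonym 'a lps = "'a topology \<times> 'a atlas set"

definition Spaces :: "(nat \<Rightarrow> real) topology set" where
  "Spaces = {subtopology (Euclidean_space n) S | n S. S \<subseteq> topspace (Euclidean_space n)}"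

definition po_space :: "'a topology \<Rightarrow> 'a rel \<Rightarrow> bool" where
  "po_space T r \<longleftrightarrow> partial_order_on (topspace T) r \<and> closedin (prod_topology T T) r"

definition order_atlas :: "'a topology \<Rightarrow> 'a atlas \<Rightarrow> bool" where
  "order_atlas M A \<longleftrightarrow>
     (\<forall>(U, r)\<in>A. openin M U \<and> po_space (subtopology M U) r) \<and>
     (\<Union>(U, r)\<in>A. U) = topspace M \<and>
     (\<forall>(U, r)\<in>A. \<forall>(V, s)\<in>A. \<forall>x\<in>U \<inter> V. \<forall>y\<in>U \<inter> V. (x, y) \<in> r \<longleftrightarrow> (x, y) \<in> s)"

definition is_refinement :: "'a atlas \<Rightarrow> 'a atlas \<Rightarrow> bool" where
  "is_refinement A' A \<longleftrightarrow>
     (\<forall>(U, r)\<in>A. \<forall>x\<in>U. \<exists>(U', r')\<in>A'. x \<in> U' \<and> U' \<subseteq> U \<and>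
        (\<forall>a\<in>U'. \<forall>b\<in>U'. (a, b) \<in> r' \<longleftrightarrow> (a, b) \<in> r))"

definition atlas_rel :: "'a topology \<Rightarrow> 'a atlas rel" where
  "atlas_rel M = {(A, B). order_atlas M A \<and> order_atlas M B \<and>
     (\<exists>C. order_atlas M C \<and> is_refinement C A \<and> is_refinement C B)}"

text \<open>
  \<open>LPS K\<close>: the local po-spaces whose underlying space belongs to the class \<open>K\<close>.
  The category \<open>\<^bold>L\<^bold>P\<^bold>S\<close> is the case \<open>K = Spaces\<close>;
  \<open>K = UNIV\<close> allows every topological space.
\<close>

definition LPS :: "'a topology set \<Rightarrow> 'a lps set" where
  "LPS K = {(M, \<U>). M \<in> K \<and> \<U> \<in> {A. order_atlas M A} // atlas_rel M}"

definition dimap :: "'a lps \<Rightarrow> 'b lps \<Rightarrow> ('a \<Rightarrow> 'b) \<Rightarrow> bool" where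
  "dimap X Y f \<longleftrightarrow> continuous_map (fst X) (fst Y) f \<and>
     (\<forall>B\<in>snd Y. \<exists>A\<in>snd X. \<forall>(U, r)\<in>A. \<forall>(V, s)\<in>B.
        \<forall>x\<in>U \<inter> f -` V. \<forall>y\<in>U \<inter> f -` V. (x, y) \<in> r \<longrightarrow> (f x, f y) \<in> s)"

definition lps_hom :: "'a lps \<Rightarrow> 'b lps \<Rightarrow> ('a \<Rightarrow> 'b) set" where
  "lps_hom X Y = {f \<in> extensional (topspace (fst X)). dimap X Y f}"

definition lps_iso :: "'a lps \<Rightarrow> 'b lps \<Rightarrow> ('a \<Rightarrow> 'b) \<Rightarrow> bool" where
  "lps_iso X Y f \<longleftrightarrow> f \<in> lps_hom X Y \<and>
     (\<exists>g\<in>lps_hom Y X. (\<forall>x\<in>topspace (fst X). g (f x) = x) \<and> (\<forall>y\<in>topspace (fst Y). f (g y) = y))"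

definition restrict_atlas :: "'a set \<Rightarrow> 'a atlas \<Rightarrow> 'a atlas" where
  "restrict_atlas L A = (\<lambda>(U, r). (L \<inter> U, r \<inter> (L \<inter> U) \<times> (L \<inter> U))) ` A"

definition sub_lps :: "'a lps \<Rightarrow> 'a set \<Rightarrow> 'a lps" where
  "sub_lps X L = (subtopology (fst X) L,
     atlas_rel (subtopology (fst X) L) `` (restrict_atlas L ` snd X))"


section \<open>Di-etale bundles and sheaves\<close>

type_synonym ('a, 'w) bundle_over = "'w lps \<times> ('w \<Rightarrow> 'a)"

definition local_dihomeo :: "'w lps \<Rightarrow> 'a lps \<Rightarrow> ('w \<Rightarrow> 'a) \<Rightarrow> bool" where
  "local_dihomeo W Z p \<longleftrightarrow>
     (\<forall>y\<in>topspace (fst W). \<exists>V. openin (fst W) V \<and> y \<in> V \<and> openin (fst Z) (p ` V) \<and>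
        lps_iso (sub_lps W V) (sub_lps Z (p ` V)) (restrict p V))"

text \<open>\<open>Etale K Z\<close>: the di-etale bundles over \<open>Z\<close> whose total space lies in \<open>LPS K\<close>.\<close>

definition Etale :: "'w topology set \<Rightarrow> 'a lps \<Rightarrow> (('a, 'w) bundle_over, 'w \<Rightarrow> 'w) cat" where
  "Etale K Z = \<lparr>
     Ob = {(W, p). W \<in> LPS K \<and> p \<in> lps_hom W Z \<and> local_dihomeo W Z p},
     Hom = (\<lambda>(W, p) (W', p'). {\<theta> \<in> lps_hom W W'. \<forall>w\<in>topspace (fst W). p' (\<theta> w) = p w}),
     Idn = (\<lambda>(W, p). \<lambda>w\<in>topspace (fst W). w),
     Cmp = (\<lambda>(W, p) _ _ g f. compose (topspace (fst W)) g f)\<rparr>"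

text \<open>
  An open subobject of \<open>Z\<close> is determined by its underlying open set \<open>U\<close>; the local
  po-space it stands for is \<open>sub_lps Z U\<close>.
\<close>

definition Opens :: "'a lps \<Rightarrow> ('a set, 'a \<Rightarrow> 'a) cat" where
  "Opens Z = \<lparr>Ob = {U. openin (fst Z) U},
     Hom = (\<lambda>U V. {i. U \<subseteq> V \<and> i = (\<lambda>x\<in>U. x)}),
     Idn = (\<lambda>U. \<lambda>x\<in>U. x),
     Cmp = (\<lambda>U V W g f. compose U g f)\<rparr>"

type_synonym ('a, 's) presheaf = "('a set, 'a \<Rightarrow> 'a, 's set, 's \<Rightarrow> 's) func"

definition restr :: "('a, 's) presheaf \<Rightarrow> 'a set \<Rightarrow> 'a set \<Rightarrow> 's \<Rightarrow> 's" where
  "restr P U V = fmor P U V (\<lambda>x\<in>V. x)"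

definition sheaf_condition :: "'a lps \<Rightarrow> ('a, 's) presheaf \<Rightarrow> bool" where
  "sheaf_condition Z P \<longleftrightarrow>
     (\<forall>\<V> s. (\<forall>V\<in>\<V>. openin (fst Z) V) \<and> (\<forall>V\<in>\<V>. s V \<in> fob P V) \<and>
        (\<forall>V\<in>\<V>. \<forall>V'\<in>\<V>. restr P V (V \<inter> V') (s V) = restr P V' (V \<inter> V') (s V'))
      \<longrightarrow> (\<exists>!t. t \<in> fob P (\<Union>\<V>) \<and> (\<forall>V\<in>\<V>. restr P (\<Union>\<V>) V t = s V)))"

definition Shv :: "'a lps \<Rightarrow> (('a, 's) presheaf, 'a set \<Rightarrow> 's \<Rightarrow> 's) cat" where
  "Shv Z = full_subcat (func_cat (op_cat (Opens Z)) set_cat) {P. sheaf_condition Z P}"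


section \<open>Cross-sections\<close>

definition sections :: "'a lps \<Rightarrow> ('a, 'w) bundle_over \<Rightarrow> 'a set \<Rightarrow> ('a \<Rightarrow> 'w) set" where
  "sections Z = (\<lambda>(W, p) U. {s \<in> lps_hom (sub_lps Z U) W. \<forall>x\<in>U. p (s x) = x})"

definition \<Gamma> ::
  "'a lps \<Rightarrow> (('a, 'w) bundle_over, 'w \<Rightarrow> 'w, ('a, 'a \<Rightarrow> 'w) presheaf, 'a set \<Rightarrow> ('a \<Rightarrow> 'w) \<Rightarrow> 'a \<Rightarrow> 'w) func" where
  "\<Gamma> Z = \<lparr>
     fob = (\<lambda>E. \<lparr>fob = sections Z E,
                 fmor = (\<lambda>U V i. \<lambda>s\<in>sections Z E U. compose V s i)\<rparr>),
     fmor = (\<lambda>E E' \<theta>. \<lambda>U\<in>{U. openin (fst Z) U}. \<lambda>s\<in>sections Z E U. compose U \<theta> s)\<rparr>"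


section \<open>Germs\<close>

text \<open>The base point is kept as the first component, so that germs at distinct points are distinct.\<close>

type_synonym ('a, 's) germ = "'a \<times> ('a set \<times> 's) set"

definition germ :: "'a lps \<Rightarrow> ('a, 's) presheaf \<Rightarrow> 'a \<Rightarrow> 'a set \<Rightarrow> 's \<Rightarrow> ('a, 's) germ" where
  "germ Z P x U s = (x, {(V, t). openin (fst Z) V \<and> x \<in> V \<and> t \<in> fob P V \<and>
     (\<exists>N. openin (fst Z) N \<and> x \<in> N \<and> N \<subseteq> U \<inter> V \<and> restr P U N s = restr P V N t)})"

text \<open>\<open>dot_sec Z P s U\<close> is the basic open set of all germs of \<open>s\<close> at points of \<open>U\<close>.\<close>

definition dot_sec :: "'a lps \<Rightarrow> ('a, 's) presheaf \<Rightarrow> 's \<Rightarrow> 'a set \<Rightarrow> ('a, 's) germ set" where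
  "dot_sec Z P s U = (\<lambda>x. germ Z P x U s) ` U"

definition germ_top :: "'a lps \<Rightarrow> ('a, 's) presheaf \<Rightarrow> ('a, 's) germ topology" where
  "germ_top Z P = topology_generated_by {dot_sec Z P s U | s U. openin (fst Z) U \<and> s \<in> fob P U}"

definition germ_atlas :: "'a lps \<Rightarrow> ('a, 's) presheaf \<Rightarrow> 'a atlas \<Rightarrow> ('a, 's) germ atlas" where
  "germ_atlas Z P A =
     {(dot_sec Z P s V, {(germ Z P x V s, germ Z P y V s) | x y. x \<in> V \<and> y \<in> V \<and> (x, y) \<in> r})
      | s V U r. (U, r) \<in> A \<and> openin (fst Z) V \<and> V \<subseteq> U \<and> s \<in> fob P V}"

definition germ_lps :: "'a lps \<Rightarrow> ('a, 's) presheaf \<Rightarrow> ('a, 's) germ lps" where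
  "germ_lps Z P = (germ_top Z P,
     atlas_rel (germ_top Z P) `` {germ_atlas Z P (SOME A. A \<in> snd Z)})"

text \<open>
  A morphism \<open>\<eta> : P \<rightarrow> Q\<close> sends the germ of \<open>s \<in> P(U)\<close> to the germ of \<open>\<eta> U s\<close>. The union
  below runs over all representatives of the given germ, which all yield the same class.
\<close>

definition germ_map ::
  "'a lps \<Rightarrow> ('a, 's) presheaf \<Rightarrow> ('a set \<Rightarrow> 's \<Rightarrow> 's) \<Rightarrow> ('a, 's) germ \<Rightarrow> ('a, 's) germ" where
  "germ_map Z Q \<eta> = (\<lambda>(x, g). (x, \<Union>(U, s)\<in>g. snd (germ Z Q x U (\<eta> U s))))"


section \<open>The bundle of germs as an object of the category of bundles\<close>

text \<open>
  The germ space of \<open>P\<close> consists of sets of sections and hence does not live on the carrier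
  type of the class \<open>K\<close> of admissible total spaces. It is therefore relabelled along a chosen
  homeomorphism \<open>c\<close> onto a member of \<open>K\<close>, everything else being transported along \<open>c\<close>.
  For \<open>K = Spaces\<close> this is a choice of an embedding into some Euclidean space;
  for \<open>K = UNIV\<close> it is merely a choice of names for the germs.
\<close>

definition relabelling ::
  "'w topology set \<Rightarrow> 'a lps \<Rightarrow> ('a, 's) presheaf \<Rightarrow> 'w topology \<times> (('a, 's) germ \<Rightarrow> 'w)" where
  "relabelling K Z P = (SOME (M, c). M \<in> K \<and> homeomorphic_map (germ_top Z P) M c)"

definition unlabel :: "'w topology set \<Rightarrow> 'a lps \<Rightarrow> ('a, 's) presheaf \<Rightarrow> 'w \<Rightarrow> ('a, 's) germ" where
  "unlabel K Z P = inv_into (topspace (germ_top Z P)) (snd (relabelling K Z P))"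

definition transport_lps :: "'b topology \<Rightarrow> ('a \<Rightarrow> 'b) \<Rightarrow> 'a lps \<Rightarrow> 'b lps" where
  "transport_lps M c X = (M, (\<lambda>A. (\<lambda>(U, r). (c ` U, map_prod c c ` r)) ` A) ` snd X)"

definition germ_bundle :: "'w topology set \<Rightarrow> 'a lps \<Rightarrow> ('a, 's) presheaf \<Rightarrow> ('a, 'w) bundle_over" where
  "germ_bundle K Z P = (let (M, c) = relabelling K Z P in
     (transport_lps M c (germ_lps Z P), \<lambda>w\<in>topspace M. fst (unlabel K Z P w)))"

definition \<Lambda> ::
  "'w topology set \<Rightarrow> 'a lps \<Rightarrow> (('a, 's) presheaf, 'a set \<Rightarrow> 's \<Rightarrow> 's, ('a, 'w) bundle_over, 'w \<Rightarrow> 'w) func" where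
  "\<Lambda> K Z = \<lparr>
     fob = germ_bundle K Z,
     fmor = (\<lambda>P Q \<eta>. \<lambda>w\<in>topspace (fst (relabelling K Z P)).
               snd (relabelling K Z Q) (germ_map Z Q \<eta> (unlabel K Z P w)))\<rparr>"

text \<open>
  \<open>Shv_in K Z\<close>: the full subcategory of those sheaves whose germ space is, up to
  homeomorphism, a space in \<open>K\<close>. Not every sheaf has a germ space embeddable in a Euclidean
  space: over a point, a sheaf is a set and its germ space is that set with the discrete topology.
\<close>

definition Shv_in ::
  "'w topology set \<Rightarrow> 'a lps \<Rightarrow> (('a, 's) presheaf, 'a set \<Rightarrow> 's \<Rightarrow> 's) cat" where
  "Shv_in K Z = full_subcat (Shv Z) {P. \<exists>M\<in>K. germ_top Z P homeomorphic_space M}"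


section \<open>Size\<close>

text \<open>
  The total spaces have their points in a type \<open>'w\<close>, so cross-sections have type \<open>'a \<Rightarrow> 'w\<close>,
  and \<open>\<Gamma>\<close> takes values in sheaves of subsets of \<open>'a \<Rightarrow> 'w\<close>. For \<open>\<Lambda>\<close> to lead back,
  the germs of such a sheaf must fit into \<open>'w\<close>. The following condition makes \<open>'w\<close>
  a universe of that kind: there is room for all pairs of a subset of \<open>'a\<close> and a
  function into \<open>'w\<close>. Such universes exist above any given type of elements.
\<close>

definition universe :: "'a itself \<Rightarrow> 'w itself \<Rightarrow> bool" where
  "universe a w \<longleftrightarrow> (\<exists>f :: 'a set \<times> ('a \<Rightarrow> 'w) \<Rightarrow> 'w. inj f)"

lemma universe_exists: "universe TYPE(nat \<Rightarrow> real) TYPE(((nat \<Rightarrow> real) set \<times> 'v) set)"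
proof -
  define tag :: "real \<Rightarrow> (nat \<Rightarrow> real) \<Rightarrow> nat \<Rightarrow> real"
    where "tag k x = (\<lambda>n. case n of 0 \<Rightarrow> k | Suc m \<Rightarrow> x m)" for k x
  have tag_eq [simp]: "tag k x = tag l y \<longleftrightarrow> k = l \<and> x = y" for k l x y
  proof
    assume eq: "tag k x = tag l y"
    have "k = l" using fun_cong[OF eq, of 0] by (simp add: tag_def)
    moreover have "x m = y m" for m using fun_cong[OF eq, of "Suc m"] by (simp add: tag_def)
    ultimately show "k = l \<and> x = y" by auto
  qed auto
  define a where "a A = insert (tag 0 (\<lambda>_. 0)) (tag 1 ` A)" for A :: "(nat \<Rightarrow> real) set"
  define b where "b x A = insert (tag 2 x) (tag 3 ` A)" for x and A :: "(nat \<Rightarrow> real) set"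
  have ab: "a A \<noteq> b x B" for A x B
  proof
    assume "a A = b x B"
    hence "tag 2 x \<in> a A" unfolding b_def by simp
    thus False unfolding a_def by auto
  qed
  have aa: "A = B" if eq: "a A = a B" for A B
  proof (rule set_eqI)
    fix z
    have "z \<in> A \<longleftrightarrow> tag 1 z \<in> a A" "z \<in> B \<longleftrightarrow> tag 1 z \<in> a B"
      unfolding a_def by auto
    thus "z \<in> A \<longleftrightarrow> z \<in> B" using eq by simp
  qed
  have bb: "x = y \<and> A = B" if eq: "b x A = b y B" for x y A B
  proof -
    have "tag 2 x \<in> b y B" using eq unfolding b_def by blast
    hence "x = y" unfolding b_def by auto
    moreover have "z \<in> A \<longleftrightarrow> z \<in> B" for z
    proof -
      have "z \<in> A \<longleftrightarrow> tag 3 z \<in> b x A" "z \<in> B \<longleftrightarrow> tag 3 z \<in> b y B"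
        unfolding b_def by auto
      thus ?thesis using eq by simp
    qed
    ultimately show ?thesis by blast
  qed
  define f :: "(nat \<Rightarrow> real) set \<times> ((nat \<Rightarrow> real) \<Rightarrow> ((nat \<Rightarrow> real) set \<times> 'v) set)
      \<Rightarrow> ((nat \<Rightarrow> real) set \<times> 'v) set"
    where "f = (\<lambda>(S, h). {(a S, v) | v. True} \<union> {(b x A, v) | x A v. (A, v) \<in> h x})"
  have "inj f"
  proof (rule injI)
    fix p q assume eq: "f p = f q"
    obtain S h T k where pq: "p = (S, h)" "q = (T, k)" by fastforce
    have "(a S, undefined) \<in> f p" unfolding pq f_def by auto
    hence "(a S, undefined) \<in> f q" using eq by simp
    hence "a S = a T" using ab unfolding pq f_def by auto
    hence "S = T" by (rule aa)
    moreover have "h x = k x" for x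
    proof (rule set_eqI)
      fix e :: "(nat \<Rightarrow> real) set \<times> 'v"
      have mem: "(b x (fst e), snd e) \<in> f (R, l) \<longleftrightarrow> e \<in> l x" for R l
      proof
        assume "(b x (fst e), snd e) \<in> f (R, l)"
        then consider "b x (fst e) = a R"
          | y A where "b x (fst e) = b y A" "(A, snd e) \<in> l y"
          unfolding f_def by auto
        thus "e \<in> l x"
        proof cases
          case 1
          thus ?thesis using ab[of R x "fst e"] by simp
        next
          case 2
          thus ?thesis using bb[of x "fst e" y A] by auto
        qed
      next
        assume "e \<in> l x"
        thus "(b x (fst e), snd e) \<in> f (R, l)" unfolding f_def by (cases e) auto
      qed
      show "e \<in> h x \<longleftrightarrow> e \<in> k x" using mem[of S h] mem[of T k] eq pq by simp
    qed
    ultimately show "p = q" using pq by auto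
  qed
  thus ?thesis unfolding universe_def by blast
qed

end

theory Submission
  imports Defs
begin

text \<open>
  The classical equivalence between etale spaces and sheaves rests on two observations: local
  sections of an etale bundle are open maps that cover the total space, and a bundle map is
  determined by what it does to sections. Both survive the passage to local po-spaces because
  everything in sight is local, including the order.

  To make the locality of the order usable, all chart orders of an atlas are merged into one
  relation (\<open>atlas_le\<close>). Since charts agree on overlaps, this relation restricts on each chart to
  the order of that chart, two atlases are equivalent iff their relations agree near each
  point (\<open>atlas_rel_iff\<close>), and a map is a dimap iff near each point it is continuous and monotone
  for the relations of any chosen atlases (\<open>dimap_iff\<close>). Hence being a dimap can be checked
  pointwise (\<open>dimap_at\<close>); dimaps compose, restrict and glue as germs of maps do.

  The other atlases that occur (restrictions to open subspaces, images under homeomorphisms,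
  the atlas on the space of germs) all arise from a given atlas by pulling it back
  along a map that is injective on the new charts (\<open>pullback_atlas\<close>). A pulled back atlas makes
  the map a dimap, and every continuous local section of the map a dimap as well. For the
  space of germs this says that the projection and the sections \<open>x \<mapsto> germ\<^sub>x s\<close> are dimaps, so the
  space of germs is an etale bundle.

  For an etale bundle, sections have open image (\<open>section_open_image\<close>) and two sections that meet
  agree near the common point (\<open>sections_agree_near\<close>). So a map over the base that sends some
  section through each point to a section is a dimap (\<open>bundle_map_by_sections\<close>), and the inverse of a
  bijective bundle map is again one (\<open>bundle_map_inverse\<close>). The unit sends \<open>w\<close> to the germ at
  \<open>p w\<close> of any section through \<open>w\<close>; it carries the section \<open>s\<close> to \<open>x \<mapsto> germ\<^sub>x s\<close> and is
  bijective (\<open>unit_bundle_iso\<close>). The inverse of the counit sends \<open>s \<in> P(U)\<close> to the section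
  \<open>x \<mapsto> germ\<^sub>x s\<close>; it is injective because the sections of a sheaf are determined by their germs, and
  surjective because a section of the space of germs is locally given by elements of \<open>P\<close>, which
  glue (\<open>label_section_bij\<close>).

  The argument is uniform in the class \<open>K\<close> of admissible total spaces, so both halves of the
  theorem are instances of \<open>Etale_equivalent_Shv_in\<close>. In the case of all topological spaces,
  the universe condition provides labels for the germs of an arbitrary sheaf
  (\<open>Shv_in_UNIV\<close>).
\<close>

section \<open>Order-atlases as local relations\<close>

definition atlas_le :: "'a atlas \<Rightarrow> 'a rel" where
  "atlas_le A = \<Union>(snd ` A)"

text \<open>
  The members of \<open>\<N>\<close> are the charts; for \<open>f = id\<close> this cuts an atlas down to smaller charts,
  for the inverse of a homeomorphism it transports the atlas, and for the projection from the space
  of germs it yields the germ atlas.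
\<close>

definition pullback_atlas :: "('b \<Rightarrow> 'a) \<Rightarrow> 'b set set \<Rightarrow> 'a atlas \<Rightarrow> 'b atlas" where
  "pullback_atlas f \<N> A = (\<lambda>N. (N, {(a, b). a \<in> N \<and> b \<in> N \<and> (f a, f b) \<in> atlas_le A})) ` \<N>"

lemma order_atlasD:
  assumes "order_atlas M A" "(U, r) \<in> A"
  shows "openin M U" "po_space (subtopology M U) r" "U \<subseteq> topspace M" "r \<subseteq> U \<times> U"
proof -
  show *: "openin M U" "po_space (subtopology M U) r"
    using assms unfolding order_atlas_def by auto
  show U: "U \<subseteq> topspace M" using * openin_subset by blast
  have "r \<subseteq> topspace (subtopology M U) \<times> topspace (subtopology M U)"
    using * closedin_subset unfolding po_space_def by (metis topspace_prod_topology)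
  thus "r \<subseteq> U \<times> U" using U by auto
qed

lemma order_atlas_cover:
  assumes "order_atlas M A" "x \<in> topspace M"
  obtains U r where "(U, r) \<in> A" "x \<in> U"
proof -
  have "x \<in> (\<Union>(U, r)\<in>A. U)" using assms unfolding order_atlas_def by auto
  thus ?thesis using that by auto
qed

text \<open>
  A pair related in some chart has both points in that chart, so the agreement of charts on
  overlaps forces every other chart that contains both points to relate them too.
\<close>

lemma atlas_le_chart:
  assumes "order_atlas M A" "(U, r) \<in> A" "x \<in> U" "y \<in> U"
  shows "(x, y) \<in> atlas_le A \<longleftrightarrow> (x, y) \<in> r"
proof
  assume "(x, y) \<in> atlas_le A"
  then obtain V s where V: "(V, s) \<in> A" "(x, y) \<in> s" unfolding atlas_le_def by auto
  hence "x \<in> V" "y \<in> V" using order_atlasD(4)[OF assms(1) V(1)] by auto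
  thus "(x, y) \<in> r" using assms V unfolding order_atlas_def by blast
next
  show "(x, y) \<in> r \<Longrightarrow> (x, y) \<in> atlas_le A" using assms(2) unfolding atlas_le_def by force
qed

text \<open>
  Injectivity is what preserves antisymmetry; closedness is inherited because the pulled back
  order is the preimage of a closed set under \<open>f \<times> f\<close>.
\<close>

lemma po_space_pullback:
  assumes po: "po_space S r" and f: "continuous_map T S f" and inj: "inj_on f (topspace T)"
  shows "po_space T {(a, b). a \<in> topspace T \<and> b \<in> topspace T \<and> (f a, f b) \<in> r}"
proof -
  have fS: "f a \<in> topspace S" if "a \<in> topspace T" for a
    using f that by (auto simp: continuous_map_def)
  have po': "partial_order_on (topspace S) r" and cl: "closedin (prod_topology S S) r"
    using po unfolding po_space_def by auto
  let ?R = "{(a, b). a \<in> topspace T \<and> b \<in> topspace T \<and> (f a, f b) \<in> r}"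
  have "refl_on (topspace T) ?R"
    using po' fS unfolding partial_order_on_def preorder_on_def refl_on_def by auto
  moreover have "trans ?R"
    using po' unfolding partial_order_on_def preorder_on_def trans_def by blast
  moreover have "antisym ?R"
    using po' inj unfolding partial_order_on_def antisym_def inj_on_def by blast
  ultimately have 1: "partial_order_on (topspace T) ?R"
    unfolding partial_order_on_def preorder_on_def by auto
  have "continuous_map (prod_topology T T) (prod_topology S S) (\<lambda>(a, b). (f a, f b))"
    using f by (simp add: continuous_map_prod_top)
  from closedin_continuous_map_preimage[OF this cl]
  have "closedin (prod_topology T T)
     {x \<in> topspace (prod_topology T T). (\<lambda>(a, b). (f a, f b)) x \<in> r}" .
  moreover have "{x \<in> topspace (prod_topology T T). (\<lambda>(a, b). (f a, f b)) x \<in> r} = ?R" by auto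
  ultimately show ?thesis using 1 unfolding po_space_def by simp
qed

lemma order_atlas_pullback:
  assumes A: "order_atlas M A" and f: "continuous_map M' M f"
    and op: "\<And>N. N \<in> \<N> \<Longrightarrow> openin M' N" and inj: "\<And>N. N \<in> \<N> \<Longrightarrow> inj_on f N"
    and sm: "\<And>N. N \<in> \<N> \<Longrightarrow> \<exists>U r. (U, r) \<in> A \<and> f ` N \<subseteq> U"
    and cov: "topspace M' \<subseteq> \<Union>\<N>"
  shows "order_atlas M' (pullback_atlas f \<N> A)"
proof -
  have po: "po_space (subtopology M' N) {(a, b). a \<in> N \<and> b \<in> N \<and> (f a, f b) \<in> atlas_le A}"
    if N: "N \<in> \<N>" for N
  proof -
    obtain U r where U: "(U, r) \<in> A" "f ` N \<subseteq> U" using sm N by blast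
    have top: "topspace (subtopology M' N) = N" using openin_subset[OF op[OF N]] by auto
    have cont: "continuous_map (subtopology M' N) (subtopology M U) f"
      using f U(2) top by (auto simp: continuous_map_in_subtopology continuous_map_from_subtopology)
    have "po_space (subtopology M' N) {(a, b). a \<in> N \<and> b \<in> N \<and> (f a, f b) \<in> r}"
      using po_space_pullback[OF order_atlasD(2)[OF A U(1)] cont, unfolded top, OF inj[OF N]] .
    moreover have "{(a, b). a \<in> N \<and> b \<in> N \<and> (f a, f b) \<in> r}
        = {(a, b). a \<in> N \<and> b \<in> N \<and> (f a, f b) \<in> atlas_le A}"
      using atlas_le_chart[OF A U(1)] U(2) by auto
    ultimately show ?thesis by simp
  qed
  have cov': "\<Union>\<N> = topspace M'" using cov op openin_subset by blast
  show ?thesis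
    unfolding order_atlas_def
  proof (intro conjI)
    show "\<forall>(U, r)\<in>pullback_atlas f \<N> A. openin M' U \<and> po_space (subtopology M' U) r"
      unfolding pullback_atlas_def using po op by simp
    show "(\<Union>(U, r)\<in>pullback_atlas f \<N> A. U) = topspace M'"
      unfolding pullback_atlas_def using cov' by simp
    show "\<forall>(U, r)\<in>pullback_atlas f \<N> A. \<forall>(V, s)\<in>pullback_atlas f \<N> A.
        \<forall>x\<in>U \<inter> V. \<forall>y\<in>U \<inter> V. ((x, y) \<in> r) = ((x, y) \<in> s)"
      unfolding pullback_atlas_def by simp
  qed
qed

lemma atlas_le_pullback:
  "(a, b) \<in> atlas_le (pullback_atlas f \<N> A) \<longleftrightarrow>
     (f a, f b) \<in> atlas_le A \<and> (\<exists>N\<in>\<N>. a \<in> N \<and> b \<in> N)"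
proof -
  have "(a, b) \<in> atlas_le (pullback_atlas f \<N> A) \<longleftrightarrow>
      (\<exists>N\<in>\<N>. (a, b) \<in> {(a, b). a \<in> N \<and> b \<in> N \<and> (f a, f b) \<in> atlas_le A})"
    unfolding atlas_le_def[of "pullback_atlas f \<N> A"]
    unfolding pullback_atlas_def by (simp only: image_image snd_conv UN_iff)
  thus ?thesis by blast
qed

text \<open>
  A common refinement only compares the orders on small neighbourhoods, and conversely the small
  open sets on which the two orders agree form a common refinement.
\<close>

lemma atlas_rel_iff:
  "(A, B) \<in> atlas_rel M \<longleftrightarrow> order_atlas M A \<and> order_atlas M B \<and>
     (\<forall>x\<in>topspace M. \<exists>N. openin M N \<and> x \<in> N \<and>
        (\<forall>a\<in>N. \<forall>b\<in>N. (a, b) \<in> atlas_le A \<longleftrightarrow> (a, b) \<in> atlas_le B))"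
    (is "?L \<longleftrightarrow> ?R")
proof
  assume ?L
  then obtain C where A: "order_atlas M A" and B: "order_atlas M B" and C: "order_atlas M C"
    and CA: "is_refinement C A" and CB: "is_refinement C B"
    unfolding atlas_rel_def by blast
  have "\<exists>N. openin M N \<and> x \<in> N \<and> (\<forall>a\<in>N. \<forall>b\<in>N. (a, b) \<in> atlas_le A \<longleftrightarrow> (a, b) \<in> atlas_le B)"
    if x: "x \<in> topspace M" for x
  proof -
    have near: "\<exists>N. openin M N \<and> x \<in> N \<and> (\<forall>a\<in>N. \<forall>b\<in>N. (a, b) \<in> atlas_le D \<longleftrightarrow> (a, b) \<in> atlas_le C)"
      if D: "order_atlas M D" and CD: "is_refinement C D" for D
    proof -
      obtain U r where U: "(U, r) \<in> D" "x \<in> U" using order_atlas_cover[OF D x] .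
      then obtain V s where V: "(V, s) \<in> C" "x \<in> V" "V \<subseteq> U"
        "\<forall>a\<in>V. \<forall>b\<in>V. (a, b) \<in> s \<longleftrightarrow> (a, b) \<in> r"
        using CD unfolding is_refinement_def by fast
      show ?thesis
        using V order_atlasD(1)[OF C V(1)]
        by (intro exI[of _ V]) (auto simp: atlas_le_chart[OF D U(1)] atlas_le_chart[OF C V(1)] subset_iff)
    qed
    obtain N1 N2 where "openin M N1" "x \<in> N1" "openin M N2" "x \<in> N2"
      "\<forall>a\<in>N1. \<forall>b\<in>N1. (a, b) \<in> atlas_le A \<longleftrightarrow> (a, b) \<in> atlas_le C"
      "\<forall>a\<in>N2. \<forall>b\<in>N2. (a, b) \<in> atlas_le B \<longleftrightarrow> (a, b) \<in> atlas_le C"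
      using near[OF A CA] near[OF B CB] by blast
    thus ?thesis by (intro exI[of _ "N1 \<inter> N2"]) auto
  qed
  thus ?R using A B by blast
next
  assume R: ?R
  hence A: "order_atlas M A" and B: "order_atlas M B" by auto
  \<comment> \<open>the charts of the common refinement\<close>
  define \<N> where "\<N> = {N. openin M N \<and> (\<exists>U r. (U, r) \<in> A \<and> N \<subseteq> U) \<and>
     (\<forall>a\<in>N. \<forall>b\<in>N. (a, b) \<in> atlas_le A \<longleftrightarrow> (a, b) \<in> atlas_le B)}"
  have small: "\<exists>N\<in>\<N>. x \<in> N \<and> N \<subseteq> V" if V: "openin M V" "x \<in> V" for V x
  proof -
    have x: "x \<in> topspace M" using V openin_subset by blast
    obtain U r where U: "(U, r) \<in> A" "x \<in> U" using order_atlas_cover[OF A x] .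
    obtain N where "openin M N" "x \<in> N"
      "\<forall>a\<in>N. \<forall>b\<in>N. (a, b) \<in> atlas_le A \<longleftrightarrow> (a, b) \<in> atlas_le B" using R x by blast
    thus ?thesis using U V order_atlasD(1)[OF A U(1)] unfolding \<N>_def
      by (intro bexI[of _ "N \<inter> U \<inter> V"]) auto
  qed
  let ?C = "pullback_atlas id \<N> A"
  have C: "order_atlas M ?C"
  proof (rule order_atlas_pullback[OF A])
    show "\<exists>U r. (U, r) \<in> A \<and> id ` N \<subseteq> U" if "N \<in> \<N>" for N
      using that unfolding \<N>_def by simp
    show "topspace M \<subseteq> \<Union>\<N>" using small[OF openin_topspace] by blast
  qed (simp_all add: \<N>_def)
  have mem: "(N, {(a, b). a \<in> N \<and> b \<in> N \<and> (a, b) \<in> atlas_le A}) \<in> ?C" if "N \<in> \<N>" for N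
    using that unfolding pullback_atlas_def by auto
  have "is_refinement ?C A"
    unfolding is_refinement_def
  proof (clarify)
    fix U r x assume U: "(U, r) \<in> A" "x \<in> U"
    obtain N where N: "N \<in> \<N>" "x \<in> N" "N \<subseteq> U"
      using small[OF order_atlasD(1)[OF A U(1)] U(2)] by blast
    show "\<exists>(U', r')\<in>?C. x \<in> U' \<and> U' \<subseteq> U \<and> (\<forall>a\<in>U'. \<forall>b\<in>U'. ((a, b) \<in> r') = ((a, b) \<in> r))"
      by (rule bexI[OF _ mem[OF N(1)]]) (use N atlas_le_chart[OF A U(1)] in auto)
  qed
  moreover have "is_refinement ?C B"
    unfolding is_refinement_def
  proof (clarify)
    fix U r x assume U: "(U, r) \<in> B" "x \<in> U"
    obtain N where N: "N \<in> \<N>" "x \<in> N" "N \<subseteq> U"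
      using small[OF order_atlasD(1)[OF B U(1)] U(2)] by blast
    have "\<forall>a\<in>N. \<forall>b\<in>N. (a, b) \<in> atlas_le A \<longleftrightarrow> (a, b) \<in> r"
      using N atlas_le_chart[OF B U(1)] unfolding \<N>_def by blast
    thus "\<exists>(U', r')\<in>?C. x \<in> U' \<and> U' \<subseteq> U \<and> (\<forall>a\<in>U'. \<forall>b\<in>U'. ((a, b) \<in> r') = ((a, b) \<in> r))"
      by (intro bexI[OF _ mem[OF N(1)]]) (use N in auto)
  qed
  ultimately show ?L unfolding atlas_rel_def using A B C by blast
qed

lemma atlas_relE:
  assumes "(A, B) \<in> atlas_rel M" "x \<in> topspace M"
  obtains N where "openin M N" "x \<in> N"
    "\<forall>a\<in>N. \<forall>b\<in>N. (a, b) \<in> atlas_le A \<longleftrightarrow> (a, b) \<in> atlas_le B"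
proof -
  have "\<exists>N. openin M N \<and> x \<in> N \<and> (\<forall>a\<in>N. \<forall>b\<in>N. (a, b) \<in> atlas_le A \<longleftrightarrow> (a, b) \<in> atlas_le B)"
    using assms unfolding atlas_rel_iff by simp
  thus ?thesis using that by (elim exE conjE)
qed

lemma equiv_atlas_rel: "equiv {A. order_atlas M A} (atlas_rel M)"
proof (rule equivI)
  show "atlas_rel M \<subseteq> {A. order_atlas M A} \<times> {A. order_atlas M A}"
    unfolding atlas_rel_def by auto
  show "refl_on {A. order_atlas M A} (atlas_rel M)"
    by (auto simp: refl_on_def atlas_rel_iff)
  show "sym (atlas_rel M)"
    unfolding sym_def atlas_rel_def by blast
  show "trans (atlas_rel M)"
  proof (rule transI)
    fix A B C assume AB: "(A, B) \<in> atlas_rel M" and BC: "(B, C) \<in> atlas_rel M"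
    have "\<exists>N. openin M N \<and> x \<in> N \<and> (\<forall>a\<in>N. \<forall>b\<in>N. (a, b) \<in> atlas_le A \<longleftrightarrow> (a, b) \<in> atlas_le C)"
      if x: "x \<in> topspace M" for x
    proof -
      obtain N1 where N1: "openin M N1" "x \<in> N1"
        "\<forall>a\<in>N1. \<forall>b\<in>N1. (a, b) \<in> atlas_le A \<longleftrightarrow> (a, b) \<in> atlas_le B"
        using atlas_relE[OF AB x] .
      obtain N2 where N2: "openin M N2" "x \<in> N2"
        "\<forall>a\<in>N2. \<forall>b\<in>N2. (a, b) \<in> atlas_le B \<longleftrightarrow> (a, b) \<in> atlas_le C"
        using atlas_relE[OF BC x] .
      show ?thesis by (intro exI[of _ "N1 \<inter> N2"]) (use N1 N2 in auto)
    qed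
    thus "(A, C) \<in> atlas_rel M" using AB BC unfolding atlas_rel_iff by blast
  qed
qed

section \<open>Dimaps are local\<close>

lemma LPS_mono: "X \<in> LPS K \<Longrightarrow> X \<in> LPS UNIV"
  unfolding LPS_def by auto

lemma LPS_I: "order_atlas M A \<Longrightarrow> (M, atlas_rel M `` {A}) \<in> LPS UNIV"
  unfolding LPS_def by (auto intro: quotientI)

lemma LPS_atlasD:
  assumes "X \<in> LPS UNIV" "A \<in> snd X"
  shows "order_atlas (fst X) A" "snd X = atlas_rel (fst X) `` {A}"
proof -
  have q: "snd X \<in> {A. order_atlas (fst X) A} // atlas_rel (fst X)"
    using assms(1) unfolding LPS_def by auto
  show "order_atlas (fst X) A"
    using in_quotient_imp_subset[OF equiv_atlas_rel q] assms(2) by auto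
  obtain B where B: "snd X = atlas_rel (fst X) `` {B}" using q by (rule quotientE)
  hence "(B, A) \<in> atlas_rel (fst X)" using assms(2) by simp
  from equiv_class_eq[OF equiv_atlas_rel this] show "snd X = atlas_rel (fst X) `` {A}"
    unfolding B .
qed

lemma LPS_atlas_rel:
  assumes "X \<in> LPS UNIV" "A \<in> snd X" "B \<in> snd X"
  shows "(A, B) \<in> atlas_rel (fst X)"
  using assms(3) unfolding LPS_atlasD(2)[OF assms(1,2)] by simp

lemma LPS_nonempty: "X \<in> LPS UNIV \<Longrightarrow> snd X \<noteq> {}"
  using in_quotient_imp_non_empty[OF equiv_atlas_rel] unfolding LPS_def by fastforce

text \<open>
  The same choice as in \<open>germ_lps\<close>, so that the germ atlas is built from the atlas that
  defines \<open>loc_le\<close>.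
\<close>

definition lps_atlas :: "'a lps \<Rightarrow> 'a atlas" where
  "lps_atlas X = (SOME A. A \<in> snd X)"

definition loc_le :: "'a lps \<Rightarrow> 'a rel" where
  "loc_le X = atlas_le (lps_atlas X)"

lemma lps_atlas: 
  assumes "X \<in> LPS UNIV"
  shows "lps_atlas X \<in> snd X" "order_atlas (fst X) (lps_atlas X)"
proof -
  show 1: "lps_atlas X \<in> snd X" using LPS_nonempty[OF assms] some_in_eq unfolding lps_atlas_def by blast
  show "order_atlas (fst X) (lps_atlas X)" using LPS_atlasD(1)[OF assms 1] .
qed

lemma loc_le_near:
  assumes "X \<in> LPS UNIV" "A \<in> snd X" "x \<in> topspace (fst X)"
  obtains N where "openin (fst X) N" "x \<in> N"
    "\<forall>a\<in>N. \<forall>b\<in>N. (a, b) \<in> atlas_le A \<longleftrightarrow> (a, b) \<in> loc_le X"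
  using atlas_relE[OF LPS_atlas_rel[OF assms(1,2) lps_atlas(1)[OF assms(1)]] assms(3)]
  unfolding loc_le_def .

text \<open>
  The germ at \<open>x\<close> of a dimap: continuity and monotonicity on some neighbourhood. Only the chosen
  relations \<open>loc_le\<close> enter; by \<open>loc_le_near\<close> any other atlas of the same structure
  has the same germs of orders.
\<close>

definition dimap_at :: "'a lps \<Rightarrow> 'b lps \<Rightarrow> ('a \<Rightarrow> 'b) \<Rightarrow> 'a \<Rightarrow> bool" where
  "dimap_at X Y f x \<longleftrightarrow> (\<exists>N. openin (fst X) N \<and> x \<in> N \<and>
     continuous_map (subtopology (fst X) N) (fst Y) f \<and>
     (\<forall>a\<in>N. \<forall>b\<in>N. (a, b) \<in> loc_le X \<longrightarrow> (f a, f b) \<in> loc_le Y))"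

lemma dimap_at_topspace:
  assumes "dimap_at X Y f x"
  shows "x \<in> topspace (fst X)" "f x \<in> topspace (fst Y)"
proof -
  obtain N where N: "openin (fst X) N" "x \<in> N" "continuous_map (subtopology (fst X) N) (fst Y) f"
    using assms unfolding dimap_at_def by blast
  show "x \<in> topspace (fst X)" using N openin_subset by blast
  thus "f x \<in> topspace (fst Y)" using N by (auto simp: continuous_map_def)
qed

lemma continuous_map_locally:
  assumes "\<And>x. x \<in> topspace X \<Longrightarrow> \<exists>N. openin X N \<and> x \<in> N \<and> continuous_map (subtopology X N) Y f"
  shows "continuous_map X Y f"
proof (rule pasting_lemma[where I = "{N. openin X N \<and> continuous_map (subtopology X N) Y f}"
      and T = "\<lambda>N. N" and f = "\<lambda>_. f"])
qed (use assms in auto)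

text \<open>
  The definition of a dimap asks for one atlas \<open>A\<close> of the source that serves all charts of a given
  atlas \<open>B\<close> of the target. It suffices to take as \<open>A\<close> the open sets on which \<open>f\<close> is
  monotone for the merged relation of \<open>B\<close>, since that relation agrees with each chart of \<open>B\<close>.
\<close>

lemma dimap_iff:
  assumes X: "X \<in> LPS UNIV" and Y: "Y \<in> LPS UNIV"
  shows "dimap X Y f \<longleftrightarrow> (\<forall>x\<in>topspace (fst X). dimap_at X Y f x)"
proof
  assume f: "dimap X Y f"
  hence cont: "continuous_map (fst X) (fst Y) f" unfolding dimap_def by blast
  obtain A where A: "A \<in> snd X" and mono: "\<forall>(U, r)\<in>A. \<forall>(V, s)\<in>lps_atlas Y.
      \<forall>x\<in>U \<inter> f -` V. \<forall>y\<in>U \<inter> f -` V. (x, y) \<in> r \<longrightarrow> (f x, f y) \<in> s"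
    using f lps_atlas(1)[OF Y] unfolding dimap_def by meson
  have oA: "order_atlas (fst X) A" by (rule LPS_atlasD(1)[OF X A])
  show "\<forall>x\<in>topspace (fst X). dimap_at X Y f x"
  proof
    fix x assume x: "x \<in> topspace (fst X)"
    hence fx: "f x \<in> topspace (fst Y)" using cont by (auto simp: continuous_map_def)
    obtain U r where U: "(U, r) \<in> A" "x \<in> U" using order_atlas_cover[OF oA x] .
    obtain V s where V: "(V, s) \<in> lps_atlas Y" "f x \<in> V"
      using order_atlas_cover[OF lps_atlas(2)[OF Y] fx] .
    obtain N where N: "openin (fst X) N" "x \<in> N"
      "\<forall>a\<in>N. \<forall>b\<in>N. (a, b) \<in> atlas_le A \<longleftrightarrow> (a, b) \<in> loc_le X"
      using loc_le_near[OF X A x] .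
    let ?N = "{a \<in> N \<inter> U. f a \<in> V}"
    have "openin (fst X) ?N"
      by (rule openin_continuous_map_preimage_gen[OF cont])
         (use N U V order_atlasD(1)[OF oA] order_atlasD(1)[OF lps_atlas(2)[OF Y]] in auto)
    moreover have "(f a, f b) \<in> loc_le Y" if "a \<in> ?N" "b \<in> ?N" "(a, b) \<in> loc_le X" for a b
    proof -
      have "(a, b) \<in> r" using that N(3) by (simp add: atlas_le_chart[OF oA U(1), symmetric])
      hence "(f a, f b) \<in> s" using bspec[OF bspec[OF mono U(1), simplified] V(1)] that by simp
      thus ?thesis using atlas_le_chart[OF lps_atlas(2)[OF Y] V(1)] that unfolding loc_le_def by simp
    qed
    ultimately show "dimap_at X Y f x"
      unfolding dimap_at_def using x N U V continuous_map_from_subtopology[OF cont]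
      by (intro exI[of _ ?N]) auto
  qed
next
  assume loc: "\<forall>x\<in>topspace (fst X). dimap_at X Y f x"
  have cont: "continuous_map (fst X) (fst Y) f"
    by (rule continuous_map_locally) (use loc in \<open>auto simp: dimap_at_def\<close>)
  have "\<exists>A\<in>snd X. \<forall>(U, r)\<in>A. \<forall>(V, s)\<in>B.
        \<forall>x\<in>U \<inter> f -` V. \<forall>y\<in>U \<inter> f -` V. (x, y) \<in> r \<longrightarrow> (f x, f y) \<in> s"
    if B: "B \<in> snd Y" for B
  proof -
    let ?A = "lps_atlas X"
    note oA = lps_atlas(2)[OF X] and oB = LPS_atlasD(1)[OF Y B]
    \<comment> \<open>the charts of the required atlas of the source\<close>
    define \<N> where "\<N> = {N. openin (fst X) N \<and> (\<exists>U r. (U, r) \<in> ?A \<and> N \<subseteq> U) \<and>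
      (\<forall>a\<in>N. \<forall>b\<in>N. (a, b) \<in> loc_le X \<longrightarrow> (f a, f b) \<in> atlas_le B)}"
    have cov: "\<exists>N\<in>\<N>. x \<in> N" if x: "x \<in> topspace (fst X)" for x
    proof -
      have fx: "f x \<in> topspace (fst Y)" using x cont by (auto simp: continuous_map_def)
      obtain U r where U: "(U, r) \<in> ?A" "x \<in> U" using order_atlas_cover[OF oA x] .
      obtain N1 where N1: "openin (fst Y) N1" "f x \<in> N1"
        "\<forall>a\<in>N1. \<forall>b\<in>N1. (a, b) \<in> atlas_le B \<longleftrightarrow> (a, b) \<in> loc_le Y"
        using loc_le_near[OF Y B fx] .
      obtain N where N: "openin (fst X) N" "x \<in> N"
         "\<forall>a\<in>N. \<forall>b\<in>N. (a, b) \<in> loc_le X \<longrightarrow> (f a, f b) \<in> loc_le Y"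
        using loc x unfolding dimap_at_def by blast
      let ?N = "{a \<in> N \<inter> U. f a \<in> N1}"
      have "openin (fst X) ?N"
        by (rule openin_continuous_map_preimage_gen[OF cont])
           (use N U N1 order_atlasD(1)[OF oA] in auto)
      hence "?N \<in> \<N>" unfolding \<N>_def using U N N1(3) by blast
      moreover have "x \<in> ?N" using N(2) U(2) N1(2) by simp
      ultimately show ?thesis by (rule bexI[rotated])
    qed
    let ?C = "pullback_atlas id \<N> ?A"
    have C: "order_atlas (fst X) ?C"
    proof (rule order_atlas_pullback[OF oA])
      show "\<exists>U r. (U, r) \<in> ?A \<and> id ` N \<subseteq> U" if "N \<in> \<N>" for N
      proof -
        have "\<exists>U r. (U, r) \<in> ?A \<and> N \<subseteq> U" using that unfolding \<N>_def by blast
        thus ?thesis by simp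
      qed
      show "topspace (fst X) \<subseteq> \<Union>\<N>" using cov by blast
      show "openin (fst X) N" if "N \<in> \<N>" for N using that unfolding \<N>_def by blast
    qed auto
    have "(?A, ?C) \<in> atlas_rel (fst X)"
      unfolding atlas_rel_iff
    proof (intro conjI ballI)
      fix x assume "x \<in> topspace (fst X)"
      then obtain N where N: "N \<in> \<N>" "x \<in> N" using cov by blast
      thus "\<exists>N. openin (fst X) N \<and> x \<in> N \<and>
          (\<forall>a\<in>N. \<forall>b\<in>N. ((a, b) \<in> atlas_le ?A) = ((a, b) \<in> atlas_le ?C))"
        by (intro exI[of _ N]) (auto simp: \<N>_def atlas_le_pullback)
    qed (use oA C in auto)
    hence "?C \<in> snd X" using LPS_atlasD(2)[OF X lps_atlas(1)[OF X]] by auto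
    moreover have "(f x, f y) \<in> s" if "(U, r) \<in> ?C" "(V, s) \<in> B" "x \<in> U \<inter> f -` V" "y \<in> U \<inter> f -` V"
      "(x, y) \<in> r" for U r V s x y
    proof -
      have "(f x, f y) \<in> atlas_le B"
        using that(1,3,4,5) by (auto simp: pullback_atlas_def \<N>_def loc_le_def)
      thus ?thesis using atlas_le_chart[OF oB that(2)] that(3,4) by auto
    qed
    ultimately show ?thesis by (intro bexI[of _ ?C]) auto
  qed
  with cont show "dimap X Y f" unfolding dimap_def by (intro conjI ballI)
qed

lemma dimap_at_mono:
  assumes "openin (fst X) N" "x \<in> N" "openin (fst X) N'" "x \<in> N'" 
    "continuous_map (subtopology (fst X) N) (fst Y) f"
    "\<And>a b. a \<in> N' \<Longrightarrow> b \<in> N' \<Longrightarrow> (a, b) \<in> loc_le X \<Longrightarrow> (f a, f b) \<in> loc_le Y"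
  shows "dimap_at X Y f x"
  unfolding dimap_at_def
  by (rule exI[of _ "N \<inter> N'"])
     (use assms in \<open>auto intro: continuous_map_from_subtopology_mono\<close>)

lemma dimap_at_cong:
  assumes "dimap_at X Y f x" "openin (fst X) O'" "x \<in> O'" "\<And>a. a \<in> O' \<Longrightarrow> f a = g a"
  shows "dimap_at X Y g x"
proof -
  obtain N where N: "openin (fst X) N" "x \<in> N" "continuous_map (subtopology (fst X) N) (fst Y) f"
    "\<forall>a\<in>N. \<forall>b\<in>N. (a, b) \<in> loc_le X \<longrightarrow> (f a, f b) \<in> loc_le Y"
    using assms(1) unfolding dimap_at_def by blast
  have "continuous_map (subtopology (fst X) (N \<inter> O')) (fst Y) g"
    by (rule continuous_map_eq[of _ _ f])
       (use N assms(4) in \<open>auto intro: continuous_map_from_subtopology_mono\<close>)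
  thus ?thesis unfolding dimap_at_def using N assms(2-4)
    by (intro exI[of _ "N \<inter> O'"]) (simp add: assms(4)[symmetric] openin_Int)
qed

lemma dimap_at_compose:
  assumes f: "dimap_at X Y f x" and g: "dimap_at Y W g (f x)"
  shows "dimap_at X W (\<lambda>a. g (f a)) x"
proof -
  obtain N where N: "openin (fst X) N" "x \<in> N" "continuous_map (subtopology (fst X) N) (fst Y) f"
    "\<forall>a\<in>N. \<forall>b\<in>N. (a, b) \<in> loc_le X \<longrightarrow> (f a, f b) \<in> loc_le Y"
    using f unfolding dimap_at_def by blast
  obtain N' where N': "openin (fst Y) N'" "f x \<in> N'" "continuous_map (subtopology (fst Y) N') (fst W) g"
    "\<forall>a\<in>N'. \<forall>b\<in>N'. (a, b) \<in> loc_le Y \<longrightarrow> (g a, g b) \<in> loc_le W"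
    using g unfolding dimap_at_def by blast
  let ?N = "{a \<in> N. f a \<in> N'}"
  have top: "topspace (subtopology (fst X) N) = N" using openin_subset[OF N(1)] by auto
  have "openin (subtopology (fst X) N) ?N"
    using openin_continuous_map_preimage[OF N(3) N'(1)] unfolding top .
  hence op: "openin (fst X) ?N" using openin_trans_full N(1) by blast
  have "continuous_map (subtopology (fst X) ?N) (subtopology (fst Y) N') f"
    using N(3) by (auto simp: continuous_map_in_subtopology intro: continuous_map_from_subtopology_mono)
  from continuous_map_compose[OF this N'(3)]
  have "continuous_map (subtopology (fst X) ?N) (fst W) (\<lambda>a. g (f a))" by (simp add: o_def)
  thus ?thesis unfolding dimap_at_def using op N N' by (intro exI[of _ ?N]) auto
qed

lemma dimap_at_id: "x \<in> topspace (fst X) \<Longrightarrow> dimap_at X X (\<lambda>a. a) x"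
  unfolding dimap_at_def by (intro exI[of _ "topspace (fst X)"]) auto

section \<open>Pulled back structures: open subobjects and transport\<close>

lemma dimap_at_pullback:
  assumes Z: "Z \<in> LPS UNIV" and A: "A \<in> snd Z" and G: "G \<in> LPS UNIV" 
    and PG: "pullback_atlas f \<N> A \<in> snd G" and f: "continuous_map (fst G) (fst Z) f"
    and x: "x \<in> topspace (fst G)"
  shows "dimap_at G Z f x"
proof -
  have fx: "f x \<in> topspace (fst Z)" using f x by (auto simp: continuous_map_def)
  obtain N where N: "openin (fst G) N" "x \<in> N"
      "\<forall>a\<in>N. \<forall>b\<in>N. (a, b) \<in> atlas_le (pullback_atlas f \<N> A) \<longleftrightarrow> (a, b) \<in> loc_le G"
    using loc_le_near[OF G PG x] .
  obtain N' where N': "openin (fst Z) N'" "f x \<in> N'"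
      "\<forall>a\<in>N'. \<forall>b\<in>N'. (a, b) \<in> atlas_le A \<longleftrightarrow> (a, b) \<in> loc_le Z"
    using loc_le_near[OF Z A fx] .
  have "openin (fst G) {a \<in> N. f a \<in> N'}" by (rule openin_continuous_map_preimage_gen[OF f N(1) N'(1)])
  thus ?thesis unfolding dimap_at_def
    using N N' continuous_map_from_subtopology[OF f]
    by (intro exI[of _ "{a \<in> N. f a \<in> N'}"]) (auto simp: atlas_le_pullback)
qed

text \<open>
  The order on the charts of \<open>G\<close> is by definition that of the images under \<open>f\<close>, so a continuous
  local section of \<open>f\<close>, once it stays inside one chart, preserves the order.
\<close>

lemma dimap_at_into_pullback:
  assumes Z: "Z \<in> LPS UNIV" and A: "A \<in> snd Z" and G: "G \<in> LPS UNIV" 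
    and PG: "pullback_atlas f \<N> A \<in> snd G"
    and O': "openin (fst Z) O'" "x \<in> O'"
    and s: "continuous_map (subtopology (fst Z) O') (fst G) s" and fs: "\<And>a. a \<in> O' \<Longrightarrow> f (s a) = a"
  shows "dimap_at Z G s x"
proof -
  have top: "topspace (subtopology (fst Z) O') = O'" using openin_subset[OF O'(1)] by auto
  have x: "x \<in> topspace (fst Z)" using O' openin_subset by blast
  have sx: "s x \<in> topspace (fst G)" using s O' x by (auto simp: continuous_map_def)
  obtain N where N: "openin (fst G) N" "s x \<in> N"
      "\<forall>a\<in>N. \<forall>b\<in>N. (a, b) \<in> atlas_le (pullback_atlas f \<N> A) \<longleftrightarrow> (a, b) \<in> loc_le G"
    using loc_le_near[OF G PG sx] .
  obtain N' where N': "openin (fst Z) N'" "x \<in> N'"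
      "\<forall>a\<in>N'. \<forall>b\<in>N'. (a, b) \<in> atlas_le A \<longleftrightarrow> (a, b) \<in> loc_le Z"
    using loc_le_near[OF Z A x] .
  obtain D where D: "D \<in> \<N>" "s x \<in> D" "openin (fst G) D"
    using order_atlas_cover[OF LPS_atlasD(1)[OF G PG] sx] order_atlasD(1)[OF LPS_atlasD(1)[OF G PG]]
    unfolding pullback_atlas_def by blast
  \<comment> \<open>here \<open>s\<close> stays inside the chart \<open>D\<close> and inside the region where its order is \<open>loc_le G\<close>\<close>
  let ?M = "{a \<in> O'. s a \<in> N \<inter> D}"
  have "openin (subtopology (fst Z) O') ?M"
    using openin_continuous_map_preimage[OF s openin_Int[OF N(1) D(3)]] unfolding top .
  hence op: "openin (fst Z) ?M" using openin_trans_full O'(1) by blast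
  show ?thesis
    by (rule dimap_at_mono[OF O' openin_Int[OF op N'(1)] _ s])
       (use N N' D O' fs in \<open>auto simp: atlas_le_pullback N(3)[rule_format, symmetric]\<close>)
qed

lemma restrict_atlas_pullback:
  assumes "order_atlas M A"
  shows "restrict_atlas U A = pullback_atlas id ((\<lambda>V. U \<inter> V) ` fst ` A) A"
proof -
  have "r \<inter> (U \<inter> V) \<times> (U \<inter> V) = {(a, b). a \<in> U \<inter> V \<and> b \<in> U \<inter> V \<and> (id a, id b) \<in> atlas_le A}"
    if "(V, r) \<in> A" for V r
    using atlas_le_chart[OF assms that] by auto
  thus ?thesis unfolding restrict_atlas_def pullback_atlas_def image_image
    by (intro image_cong) (auto split: prod.splits)
qed

text \<open>
  The structure of an open subobject is defined as the union of the classes of all restricted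
  atlases. These atlases are equivalent, so the union is a single class.
\<close>

lemma sub_lps:
  assumes X: "X \<in> LPS UNIV" and U: "openin (fst X) U" and A: "A \<in> snd X"
  shows "sub_lps X U \<in> LPS UNIV" "restrict_atlas U A \<in> snd (sub_lps X U)"
    "fst (sub_lps X U) = subtopology (fst X) U"
proof -
  let ?S = "subtopology (fst X) U"
  have oa: "order_atlas ?S (restrict_atlas U B)" if B: "B \<in> snd X" for B
  proof -
    note oB = LPS_atlasD(1)[OF X B]
    show ?thesis unfolding restrict_atlas_pullback[OF oB]
    proof (rule order_atlas_pullback[OF oB])
      show "continuous_map (subtopology (fst X) U) (fst X) id" 
        by (simp add: continuous_map_from_subtopology)
    next
      fix N assume "N \<in> (\<inter>) U ` fst ` B"
      then obtain V r where V: "(V, r) \<in> B" "N = U \<inter> V" by auto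
      show "openin ?S N" using order_atlasD(1)[OF oB V(1)] V(2) by (simp add: openin_subtopology_Int2)
      show "\<exists>V r. (V, r) \<in> B \<and> id ` N \<subseteq> V" using V by auto
    next
      show "topspace ?S \<subseteq> \<Union> ((\<inter>) U ` fst ` B)"
      proof
        fix x assume x: "x \<in> topspace ?S"
        then obtain V r where "(V, r) \<in> B" "x \<in> V" using order_atlas_cover[OF oB, of x] by auto
        thus "x \<in> \<Union> ((\<inter>) U ` fst ` B)" using x by force
      qed
    qed auto
  qed
  have rel: "(restrict_atlas U A, restrict_atlas U B) \<in> atlas_rel ?S" if B: "B \<in> snd X" for B
    unfolding atlas_rel_iff
  proof (intro conjI oa A B ballI)
    fix x assume x: "x \<in> topspace ?S"
    then obtain N where N: "openin (fst X) N" "x \<in> N"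
      "\<forall>a\<in>N. \<forall>b\<in>N. (a, b) \<in> atlas_le A \<longleftrightarrow> (a, b) \<in> atlas_le B"
      using LPS_atlas_rel[OF X A B] unfolding atlas_rel_iff by auto
    have le: "(a, b) \<in> atlas_le (restrict_atlas U C) \<longleftrightarrow> a \<in> U \<and> b \<in> U \<and> (a, b) \<in> atlas_le C"
      if "C \<in> snd X" for a b C
    proof -
      have "\<exists>V\<in>(\<inter>) U ` fst ` C. a \<in> V \<and> b \<in> V" if "a \<in> U" "b \<in> U" "(a, b) \<in> atlas_le C"
      proof -
        obtain V r where "(V, r) \<in> C" "(a, b) \<in> r" using \<open>(a, b) \<in> atlas_le C\<close> unfolding atlas_le_def by auto
        thus ?thesis using order_atlasD(4)[OF LPS_atlasD(1)[OF X \<open>C \<in> snd X\<close>]] that by force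
      qed
      thus ?thesis unfolding restrict_atlas_pullback[OF LPS_atlasD(1)[OF X that]] atlas_le_pullback
        by auto
    qed
    show "\<exists>N. openin ?S N \<and> x \<in> N \<and>
           (\<forall>a\<in>N. \<forall>b\<in>N. ((a, b) \<in> atlas_le (restrict_atlas U A)) = ((a, b) \<in> atlas_le (restrict_atlas U B)))"
      using N x unfolding le[OF A] le[OF B] 
      by (intro exI[of _ "N \<inter> U"]) (auto simp: openin_subtopology_Int)
  qed
  have eq: "snd (sub_lps X U) = atlas_rel ?S `` {restrict_atlas U A}"
  proof -
    have "atlas_rel ?S `` {restrict_atlas U B} = atlas_rel ?S `` {restrict_atlas U A}" if "B \<in> snd X" for B
      using equiv_class_eq[OF equiv_atlas_rel rel[OF that]] by simp
    moreover have "snd (sub_lps X U) = (\<Union>B\<in>snd X. atlas_rel ?S `` {restrict_atlas U B})"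
      unfolding sub_lps_def by (auto simp: Image_def)
    ultimately have "snd (sub_lps X U) = (\<Union>B\<in>snd X. atlas_rel ?S `` {restrict_atlas U A})"
      by simp
    thus ?thesis using A by blast
  qed
  show "fst (sub_lps X U) = ?S" unfolding sub_lps_def by simp
  show "restrict_atlas U A \<in> snd (sub_lps X U)" using rel[OF A] eq by auto
  show "sub_lps X U \<in> LPS UNIV"
    using LPS_I[OF oa[OF A]] eq unfolding sub_lps_def by simp
qed

text \<open>
  The identity is a local dimap in both directions between a space and an open subobject; hence the
  dimap condition at a point does not see the passage to open subobjects.
\<close>

lemma dimap_at_inclusion:
  assumes X: "X \<in> LPS UNIV" and U: "openin (fst X) U" "x \<in> U"
  shows "dimap_at (sub_lps X U) X (\<lambda>a. a) x" "dimap_at X (sub_lps X U) (\<lambda>a. a) x"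
proof -
  note A = lps_atlas[OF X]
  note S = sub_lps[OF X U(1) A(1)]
  note P = S(2)[unfolded restrict_atlas_pullback[OF A(2)]]
  have x: "x \<in> topspace (fst X)" using U openin_subset by blast
  show "dimap_at (sub_lps X U) X (\<lambda>a. a) x"
    using dimap_at_pullback[OF X A(1) S(1) P] x U(2) 
    by (auto simp: S(3) continuous_map_from_subtopology id_def)
  show "dimap_at X (sub_lps X U) (\<lambda>a. a) x"
    by (rule dimap_at_into_pullback[OF X A(1) S(1) P U])
       (auto simp: S(3) continuous_map_in_subtopology continuous_map_from_subtopology)
qed

lemma topspace_sub_lps: "openin (fst X) U \<Longrightarrow> topspace (fst (sub_lps X U)) = U"
  unfolding sub_lps_def using openin_subset by fastforce

lemma dimap_sub_iff:
  assumes X: "X \<in> LPS UNIV" and Y: "Y \<in> LPS UNIV" and U: "openin (fst X) U"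
  shows "dimap (sub_lps X U) Y f \<longleftrightarrow> (\<forall>x\<in>U. dimap_at X Y f x)"
proof -
  have "dimap_at (sub_lps X U) Y f x \<longleftrightarrow> dimap_at X Y f x" if "x \<in> U" for x
    using dimap_at_compose[OF dimap_at_inclusion(1)[OF X U that], of Y f]
      dimap_at_compose[OF dimap_at_inclusion(2)[OF X U that], of Y f] by auto
  thus ?thesis
    using dimap_iff[OF sub_lps(1)[OF X U lps_atlas(1)[OF X]] Y, of f] topspace_sub_lps[OF U] by simp
qed

lemma dimap_at_into_sub:
  assumes Y: "Y \<in> LPS UNIV" and V: "openin (fst Y) V" "f x \<in> V"
  shows "dimap_at X (sub_lps Y V) f x \<longleftrightarrow> dimap_at X Y f x"
proof
  assume "dimap_at X (sub_lps Y V) f x"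
  from dimap_at_compose[of X "sub_lps Y V" f x, OF this dimap_at_inclusion(1)[OF assms]]
  show "dimap_at X Y f x" .
next
  assume "dimap_at X Y f x"
  from dimap_at_compose[of X Y f x, OF this dimap_at_inclusion(2)[OF assms]]
  show "dimap_at X (sub_lps Y V) f x" .
qed

abbreviation img_atlas :: "('a \<Rightarrow> 'b) \<Rightarrow> 'a atlas \<Rightarrow> 'b atlas" where
  "img_atlas c A \<equiv> (\<lambda>(U, r). (c ` U, map_prod c c ` r)) ` A"

context
  fixes M :: "'a topology" and N :: "'b topology" and c d
  assumes cd: "homeomorphic_maps M N c d"
begin

lemma homeo_facts:
  shows "\<And>x. x \<in> topspace M \<Longrightarrow> d (c x) = x" "\<And>y. y \<in> topspace N \<Longrightarrow> c (d y) = y"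
    "\<And>x. x \<in> topspace M \<Longrightarrow> c x \<in> topspace N" "\<And>y. y \<in> topspace N \<Longrightarrow> d y \<in> topspace M"
    "continuous_map M N c" "continuous_map N M d"
    "\<And>U. openin M U \<Longrightarrow> openin N (c ` U)"
proof -
  show *: "\<And>x. x \<in> topspace M \<Longrightarrow> d (c x) = x" "\<And>y. y \<in> topspace N \<Longrightarrow> c (d y) = y"
    and c: "continuous_map M N c" and d: "continuous_map N M d"
    using cd by (auto simp: homeomorphic_maps_def)
  show "\<And>x. x \<in> topspace M \<Longrightarrow> c x \<in> topspace N" "\<And>y. y \<in> topspace N \<Longrightarrow> d y \<in> topspace M"
    using c d by (auto simp: continuous_map_def)
  show "\<And>U. openin M U \<Longrightarrow> openin N (c ` U)"
    using homeomorphic_map_openness_eq homeomorphic_maps_map[of M N c d] cd by blast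
qed

lemma img_atlas_pullback:
  assumes A: "order_atlas M A"
  shows "img_atlas c A = pullback_atlas d ((`) c ` fst ` A) A"
proof -
  have "map_prod c c ` r = {(a, b). a \<in> c ` U \<and> b \<in> c ` U \<and> (d a, d b) \<in> atlas_le A}"
    if U: "(U, r) \<in> A" for U r
  proof -
    have UM: "d (c x) = x" if "x \<in> U" for x using order_atlasD(3)[OF A U] that homeo_facts(1) by blast
    note rU = order_atlasD(4)[OF A U] and le = atlas_le_chart[OF A U]
    show ?thesis
    proof (intro set_eqI iffI)
      fix q assume "q \<in> map_prod c c ` r"
      then obtain x y where "q = (c x, c y)" "(x, y) \<in> r" by auto
      moreover from this have "x \<in> U" "y \<in> U" using rU by auto
      ultimately show "q \<in> {(a, b). a \<in> c ` U \<and> b \<in> c ` U \<and> (d a, d b) \<in> atlas_le A}"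
        using UM le by simp
    next
      fix q assume "q \<in> {(a, b). a \<in> c ` U \<and> b \<in> c ` U \<and> (d a, d b) \<in> atlas_le A}"
      then obtain x y where "q = (c x, c y)" "x \<in> U" "y \<in> U" "(d (c x), d (c y)) \<in> atlas_le A" by auto
      hence "q = map_prod c c (x, y)" "(x, y) \<in> r" using UM le by auto
      thus "q \<in> map_prod c c ` r" by blast
    qed
  qed
  hence "(case q of (U, r) \<Rightarrow> (c ` U, map_prod c c ` r)) =
      (c ` fst q, {(a, b). a \<in> c ` fst q \<and> b \<in> c ` fst q \<and> (d a, d b) \<in> atlas_le A})"
    if "q \<in> A" for q using that by (cases q) (simp only: prod.case fst_conv)
  thus ?thesis unfolding pullback_atlas_def image_image by (rule image_cong[OF refl])
qed

lemma order_atlas_img: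
  assumes A: "order_atlas M A"
  shows "order_atlas N (img_atlas c A)"
  unfolding img_atlas_pullback[OF A]
proof (rule order_atlas_pullback[OF A homeo_facts(6)])
  fix D assume "D \<in> (`) c ` fst ` A"
  then obtain U r where U: "(U, r) \<in> A" "D = c ` U" by auto
  have UM: "d (c x) = x" if "x \<in> U" for x
    using order_atlasD(3)[OF A U(1)] that homeo_facts(1) by blast
  show "openin N D" using order_atlasD(1)[OF A U(1)] U(2) homeo_facts(7) by blast
  show "inj_on d D" unfolding U(2) by (rule inj_onI) (auto simp: UM)
  have "d ` D \<subseteq> U" unfolding U(2) using UM by auto
  thus "\<exists>U r. (U, r) \<in> A \<and> d ` D \<subseteq> U" using U(1) by blast
next
  show "topspace N \<subseteq> \<Union> ((`) c ` fst ` A)"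
  proof
    fix y assume y: "y \<in> topspace N"
    then obtain U r where "(U, r) \<in> A" "d y \<in> U" using order_atlas_cover[OF A homeo_facts(4)] by metis
    hence "y \<in> c ` U" using homeo_facts(2)[OF y] by (metis imageI)
    thus "y \<in> \<Union> ((`) c ` fst ` A)" using \<open>(U, r) \<in> A\<close> by force
  qed
qed

lemma atlas_le_img:
  assumes A: "order_atlas M A" and y: "y \<in> topspace N" "y' \<in> topspace N"
  shows "(y, y') \<in> atlas_le (img_atlas c A) \<longleftrightarrow> (d y, d y') \<in> atlas_le A"
proof -
  have "\<exists>D\<in>(`) c ` fst ` A. y \<in> D \<and> y' \<in> D" if le: "(d y, d y') \<in> atlas_le A"
  proof -
    obtain U r where U: "(U, r) \<in> A" "(d y, d y') \<in> r" using le unfolding atlas_le_def by auto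
    hence "d y \<in> U" "d y' \<in> U" using order_atlasD(4)[OF A U(1)] by auto
    hence "y \<in> c ` U" "y' \<in> c ` U" using homeo_facts(2) y by (metis imageI)+
    thus ?thesis using U(1) by force
  qed
  thus ?thesis unfolding img_atlas_pullback[OF A] atlas_le_pullback by blast
qed

lemma atlas_rel_img:
  assumes AB: "(A, B) \<in> atlas_rel M"
  shows "(img_atlas c A, img_atlas c B) \<in> atlas_rel N"
proof -
  have A: "order_atlas M A" and B: "order_atlas M B" using AB unfolding atlas_rel_iff by auto
  show ?thesis unfolding atlas_rel_iff
  proof (intro conjI order_atlas_img A B ballI)
    fix y assume y: "y \<in> topspace N"
    obtain D where D: "openin M D" "d y \<in> D" 
       and eq: "\<forall>a\<in>D. \<forall>b\<in>D. (a, b) \<in> atlas_le A \<longleftrightarrow> (a, b) \<in> atlas_le B"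
      using atlas_relE[OF AB homeo_facts(4)[OF y]] .
    let ?D = "{y \<in> topspace N. d y \<in> D}"
    have "openin N ?D" using openin_continuous_map_preimage[OF homeo_facts(6) D(1)] .
    thus "\<exists>D. openin N D \<and> y \<in> D \<and>
        (\<forall>a\<in>D. \<forall>b\<in>D. ((a, b) \<in> atlas_le (img_atlas c A)) = ((a, b) \<in> atlas_le (img_atlas c B)))"
      using y D eq by (intro exI[of _ ?D]) (simp add: atlas_le_img[OF A] atlas_le_img[OF B])
  qed
qed

lemma img_atlas_inverse:
  assumes A: "order_atlas M A"
  shows "img_atlas d (img_atlas c A) = A"
proof -
  have id: "d ` c ` U = U" "map_prod d d ` map_prod c c ` r = r" if U: "(U, r) \<in> A" for U r
  proof -
    have UM: "d (c x) = x" if "x \<in> U" for x using order_atlasD(3)[OF A U] that homeo_facts(1) by blast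
    show "d ` c ` U = U" using UM by force
    have "map_prod d d (map_prod c c q) = q" if "q \<in> r" for q
      using that order_atlasD(4)[OF A U] UM by (cases q) auto
    thus "map_prod d d ` map_prod c c ` r = r" by force
  qed
  have "img_atlas d (img_atlas c A) = (\<lambda>(U, r). (d ` c ` U, map_prod d d ` map_prod c c ` r)) ` A"
    by (simp add: image_image case_prod_unfold)
  also have "\<dots> = (\<lambda>q. q) ` A"
  proof (rule image_cong[OF refl])
    show "(case q of (U, r) \<Rightarrow> (d ` c ` U, map_prod d d ` map_prod c c ` r)) = q" if "q \<in> A" for q
      using that by (cases q) (simp only: prod.case id)
  qed
  finally show ?thesis by simp
qed

end

text \<open>
  The image of an equivalence class of atlases is the full class of the image atlas, because an
  equivalent atlas on the target can be carried back by the inverse homeomorphism.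
\<close>

lemma transport_lps:
  assumes X: "X \<in> LPS UNIV" and cd: "homeomorphic_maps (fst X) N c d"
  shows transport_in_LPS: "N \<in> K \<Longrightarrow> transport_lps N c X \<in> LPS K"
    and dimap_at_transport: "x \<in> topspace (fst X) \<Longrightarrow> dimap_at X (transport_lps N c X) c x"
    and dimap_at_transport_inv: "y \<in> topspace N \<Longrightarrow> dimap_at (transport_lps N c X) X d y"
proof -
  let ?A = "lps_atlas X" and ?T = "transport_lps N c X"
  note A = lps_atlas[OF X]
  have dc: "homeomorphic_maps N (fst X) d c" using cd by (rule iffD1[OF homeomorphic_maps_sym])
  have cls: "snd ?T = atlas_rel N `` {img_atlas c ?A}"
  proof (intro set_eqI iffI)
    fix B assume "B \<in> snd ?T"
    then obtain C where C: "C \<in> snd X" "B = img_atlas c C" unfolding transport_lps_def by auto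
    have "(?A, C) \<in> atlas_rel (fst X)" using LPS_atlas_rel[OF X A(1) C(1)] .
    from atlas_rel_img[OF cd this] show "B \<in> atlas_rel N `` {img_atlas c ?A}" using C(2) by simp
  next
    fix B assume B: "B \<in> atlas_rel N `` {img_atlas c ?A}"
    hence B': "(img_atlas c ?A, B) \<in> atlas_rel N" by simp
    hence oB: "order_atlas N B" unfolding atlas_rel_iff by simp
    from atlas_rel_img[OF dc B'] have "(?A, img_atlas d B) \<in> atlas_rel (fst X)"
      unfolding img_atlas_inverse[OF cd A(2)] .
    hence "img_atlas d B \<in> snd X" using LPS_atlasD(2)[OF X A(1)] by simp
    moreover have "B = img_atlas c (img_atlas d B)" using img_atlas_inverse[OF dc oB] by simp
    ultimately show "B \<in> snd ?T" unfolding transport_lps_def by (auto simp del: image_image)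
  qed
  have fT: "fst ?T = N" unfolding transport_lps_def by simp
  have oT: "order_atlas N (img_atlas c ?A)" by (rule order_atlas_img[OF cd A(2)])
  have T: "?T \<in> LPS UNIV" using LPS_I[OF oT] cls fT by (metis prod.collapse)
  thus "?T \<in> LPS K" if "N \<in> K" using that fT unfolding LPS_def by auto
  have "img_atlas c ?A \<in> snd ?T"
    unfolding cls using oT by (simp add: atlas_rel_iff)
      (meson openin_topspace)
  hence P: "pullback_atlas d ((`) c ` fst ` ?A) ?A \<in> snd ?T"
    unfolding img_atlas_pullback[OF cd A(2)] .
  note h = homeo_facts[OF cd]
  show "dimap_at X ?T c x" if "x \<in> topspace (fst X)"
    by (rule dimap_at_into_pullback[OF X A(1) T P openin_topspace that])
       (use h fT in auto)
  show "dimap_at ?T X d y" if "y \<in> topspace N"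
    by (rule dimap_at_pullback[OF X A(1) T P]) (use h fT that in auto)
qed

section \<open>Di-etale bundles and their sections\<close>

definition etale :: "'a lps \<Rightarrow> 'w lps \<Rightarrow> ('w \<Rightarrow> 'a) \<Rightarrow> bool" where
  "etale Z W p \<longleftrightarrow> W \<in> LPS UNIV \<and> p \<in> lps_hom W Z \<and> local_dihomeo W Z p"

locale base_lps =
  fixes Z :: "'a lps"
  assumes Z: "Z \<in> LPS UNIV"
begin

abbreviation op :: "'a set \<Rightarrow> bool" where "op U \<equiv> openin (fst Z) U"

lemma sections_iff:
  assumes W: "W \<in> LPS UNIV" and U: "op U"
  shows "s \<in> sections Z (W, p) U \<longleftrightarrow>
     s \<in> extensional U \<and> (\<forall>x\<in>U. dimap_at Z W s x \<and> p (s x) = x)"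
  by (simp add: sections_def lps_hom_def dimap_sub_iff[OF Z W U] topspace_sub_lps[OF U]
      ball_conj_distrib conj_ac)

lemma etaleD:
  assumes "etale Z W p"
  shows "W \<in> LPS UNIV" "p \<in> extensional (topspace (fst W))"
    "\<And>w. w \<in> topspace (fst W) \<Longrightarrow> dimap_at W Z p w" "continuous_map (fst W) (fst Z) p"
proof -
  show W: "W \<in> LPS UNIV" and "p \<in> extensional (topspace (fst W))" "continuous_map (fst W) (fst Z) p"
    using assms unfolding etale_def lps_hom_def dimap_def by auto
  show "\<And>w. w \<in> topspace (fst W) \<Longrightarrow> dimap_at W Z p w"
    using assms dimap_iff[OF W Z] unfolding etale_def lps_hom_def by auto
qed

lemma section_preimage_open:
  assumes W: "W \<in> LPS UNIV" and U: "op U" and s: "s \<in> sections Z (W, p) U" and D: "openin (fst W) D"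
  shows "op {x \<in> U. s x \<in> D}"
proof -
  have "continuous_map (subtopology (fst Z) U) (fst W) s"
    using s unfolding sections_def lps_hom_def dimap_def sub_lps_def by auto
  from openin_continuous_map_preimage[OF this D]
  have "openin (subtopology (fst Z) U) {x \<in> U. s x \<in> D}" using openin_subset[OF U] by (simp add: inf.absorb2)
  thus ?thesis using openin_trans_full U by blast
qed

lemma section_topspace:
  assumes "W \<in> LPS UNIV" "op U" "s \<in> sections Z (W, p) U" "x \<in> U"
  shows "s x \<in> topspace (fst W)"
  using assms sections_iff[OF assms(1,2), of s p] dimap_at_topspace(2)[of Z W s x] by blast

lemma section_restrict:
  assumes W: "W \<in> LPS UNIV" and U: "op U" and s: "s \<in> sections Z (W, p) U" and V: "op V" "V \<subseteq> U"
  shows "restrict s V \<in> sections Z (W, p) V"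
proof -
  have "dimap_at Z W (restrict s V) x" if "x \<in> V" for x
    by (rule dimap_at_cong[of Z W s x V]) (use s V that sections_iff[OF W U, of s p] in auto)
  thus ?thesis using s V unfolding sections_iff[OF W U] sections_iff[OF W V(1)] by auto
qed

text \<open>
  The local inverses that the definition of a local dihomeomorphism provides are sections with open image.
\<close>

lemma section_through:
  assumes e: "etale Z W p" and w: "w \<in> topspace (fst W)"
  obtains U s where "op U" "s \<in> sections Z (W, p) U" "p w \<in> U" "s (p w) = w" "openin (fst W) (s ` U)"
proof -
  note W = etaleD(1)[OF e]
  obtain V where V: "openin (fst W) V" "w \<in> V" "op (p ` V)"
    and iso: "lps_iso (sub_lps W V) (sub_lps Z (p ` V)) (restrict p V)"
    using e w unfolding etale_def local_dihomeo_def by blast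
  let ?U = "p ` V"
  obtain g where g: "g \<in> lps_hom (sub_lps Z ?U) (sub_lps W V)"
    and gp: "\<And>x. x \<in> V \<Longrightarrow> g (restrict p V x) = x" and pg: "\<And>y. y \<in> ?U \<Longrightarrow> restrict p V (g y) = y"
    using iso unfolding lps_iso_def topspace_sub_lps[OF V(1)] topspace_sub_lps[OF V(3)] by blast
  have gp': "g (p x) = x" if "x \<in> V" for x using gp[OF that] that by simp
  have img: "g ` ?U = V" using gp' by force
  have sub: "sub_lps W V \<in> LPS UNIV" using sub_lps(1)[OF W V(1) lps_atlas(1)[OF W]] .
  have gU: "\<forall>x\<in>?U. dimap_at Z (sub_lps W V) g x" "g \<in> extensional ?U"
    using g dimap_sub_iff[OF Z sub V(3)] topspace_sub_lps[OF V(3)] unfolding lps_hom_def by auto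
  have "dimap_at Z W g x" if "x \<in> ?U" for x
    using gU(1) that dimap_at_into_sub[OF W V(1), of g x Z] img by blast
  moreover have "p (g x) = x" if "x \<in> ?U" for x using that gp' by auto
  ultimately have "g \<in> sections Z (W, p) ?U" using gU(2) unfolding sections_iff[OF W V(3)] by blast
  thus ?thesis using that[OF V(3)] V gp' img by simp
qed

text \<open>
  A section \<open>s\<close> with open image inverts \<open>p\<close> on that image, and both are dimaps; so sections with
  open image through all points make \<open>p\<close> a local dihomeomorphism.
\<close>

lemma etaleI:
  assumes W: "W \<in> LPS UNIV" and ext: "p \<in> extensional (topspace (fst W))"
    and p: "\<And>w. w \<in> topspace (fst W) \<Longrightarrow> dimap_at W Z p w"
    and sec: "\<And>w. w \<in> topspace (fst W) \<Longrightarrow>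
      \<exists>U s. op U \<and> s \<in> sections Z (W, p) U \<and> w \<in> s ` U \<and> openin (fst W) (s ` U)"
  shows "etale Z W p"
proof -
  have "\<exists>V. openin (fst W) V \<and> w \<in> V \<and> op (p ` V) \<and>
        lps_iso (sub_lps W V) (sub_lps Z (p ` V)) (restrict p V)" if w: "w \<in> topspace (fst W)" for w
  proof -
    obtain U s where U: "op U" and s: "s \<in> sections Z (W, p) U" and ws: "w \<in> s ` U" 
      and V: "openin (fst W) (s ` U)" using sec[OF w] by blast
    let ?V = "s ` U"
    have s': "s \<in> extensional U" "\<And>x. x \<in> U \<Longrightarrow> dimap_at Z W s x" "\<And>x. x \<in> U \<Longrightarrow> p (s x) = x"
      using s unfolding sections_iff[OF W U] by auto
    have pV: "p ` ?V = U" using s'(3) by force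
    note subV = sub_lps(1)[OF W V lps_atlas(1)[OF W]] and subU = sub_lps(1)[OF Z U lps_atlas(1)[OF Z]]
    have "dimap_at W (sub_lps Z U) (restrict p ?V) v" if v: "v \<in> ?V" for v
    proof -
      have "dimap_at W Z (restrict p ?V) v"
        by (rule dimap_at_cong[OF p V v]) (use v V openin_subset in auto)
      thus ?thesis using dimap_at_into_sub[OF Z U, of "restrict p ?V" v W] v s'(3) by auto
    qed
    hence 1: "restrict p ?V \<in> lps_hom (sub_lps W ?V) (sub_lps Z U)"
      unfolding lps_hom_def using dimap_sub_iff[OF W subU V] topspace_sub_lps[OF V] by simp
    have "dimap_at Z (sub_lps W ?V) s x" if x: "x \<in> U" for x
      using dimap_at_into_sub[OF W V, of s x Z] s'(2)[OF x] x by auto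
    hence 2: "s \<in> lps_hom (sub_lps Z U) (sub_lps W ?V)"
      unfolding lps_hom_def using dimap_sub_iff[OF Z subV U] topspace_sub_lps[OF U] s'(1) by simp
    have "lps_iso (sub_lps W ?V) (sub_lps Z U) (restrict p ?V)"
      unfolding lps_iso_def topspace_sub_lps[OF V] topspace_sub_lps[OF U]
      by (intro conjI 1 bexI[OF _ 2]) (auto simp: s'(3))
    thus ?thesis using V ws U pV by (intro exI[of _ ?V]) simp
  qed
  hence "local_dihomeo W Z p" unfolding local_dihomeo_def by blast
  moreover have "p \<in> lps_hom W Z" unfolding lps_hom_def using ext p dimap_iff[OF W Z] by blast
  ultimately show ?thesis unfolding etale_def using W by blast
qed

text \<open>
  Near \<open>s x\<close>, compare \<open>s\<close> with a section \<open>t\<close> through \<open>s x\<close> whose image is known to be open.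
  Where \<open>s\<close> lands in the image of \<open>t\<close> it equals \<open>t\<close>, so there the image of \<open>s\<close> is the part
  of the image of \<open>t\<close> that lies over an open set.
\<close>

lemma section_open_image:
  assumes e: "etale Z W p" and U: "op U" and s: "s \<in> sections Z (W, p) U"
  shows "openin (fst W) (s ` U)"
proof (subst openin_subopen, intro ballI)
  note W = etaleD(1)[OF e]
  fix w assume "w \<in> s ` U"
  then obtain x where x: "x \<in> U" "w = s x" by blast
  have ps: "p (s y) = y" if "y \<in> U" for y using s that unfolding sections_iff[OF W U] by blast
  have w: "w \<in> topspace (fst W)" using section_topspace[OF W U s] x by simp
  obtain V t where V: "op V" and t: "t \<in> sections Z (W, p) V" and tx: "x \<in> V" "t x = w"
    and op_t: "openin (fst W) (t ` V)"
    using section_through[OF e w] ps x by metis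
  have pt: "p (t y) = y" if "y \<in> V" for y using t that unfolding sections_iff[OF W V] by blast
  let ?N = "{y \<in> U. s y \<in> t ` V}"
  have N: "op ?N" by (rule section_preimage_open[OF W U s op_t])
  have st: "y \<in> V \<and> s y = t y" if "y \<in> ?N" for y
  proof -
    obtain z where "z \<in> V" "s y = t z" using \<open>y \<in> ?N\<close> by auto
    moreover from this have "y = z" using ps pt \<open>y \<in> ?N\<close> by (metis (lifting) mem_Collect_eq)
    ultimately show ?thesis by simp
  qed
  have "openin (fst W) {v \<in> t ` V. p v \<in> ?N}"
    by (rule openin_continuous_map_preimage_gen[OF etaleD(4)[OF e] op_t N])
  moreover have "{v \<in> t ` V. p v \<in> ?N} \<subseteq> s ` U"
  proof
    fix v assume v: "v \<in> {v \<in> t ` V. p v \<in> ?N}"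
    then obtain y where y: "y \<in> V" "v = t y" by blast
    hence yN: "y \<in> ?N" using v pt by simp
    from st[OF this] have "v = s y" using y by metis
    thus "v \<in> s ` U" using yN by blast
  qed
  moreover have "w \<in> t ` V" using tx by blast
  hence "w \<in> {v \<in> t ` V. p v \<in> ?N}" using x ps by simp
  ultimately show "\<exists>T. openin (fst W) T \<and> w \<in> T \<and> T \<subseteq> s ` U" by blast
qed

lemma sections_agree_near:
  assumes e: "etale Z W p" and U: "op U" and s: "s \<in> sections Z (W, p) U"
    and V: "op V" and t: "t \<in> sections Z (W, p) V" and x: "x \<in> U" "x \<in> V" "s x = t x"
  obtains N where "op N" "x \<in> N" "N \<subseteq> U \<inter> V" "\<forall>y\<in>N. s y = t y"
proof
  note W = etaleD(1)[OF e]
  let ?N = "{y \<in> U. s y \<in> t ` V}"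
  show "op ?N" by (rule section_preimage_open[OF W U s section_open_image[OF e V t]])
  show "x \<in> ?N" using x by auto
  have st: "y \<in> V \<and> s y = t y" if "y \<in> ?N" for y
  proof -
    obtain z where z: "z \<in> V" "s y = t z" using \<open>y \<in> ?N\<close> by auto
    have "p (s y) = y" "p (t z) = z"
      using s t \<open>y \<in> ?N\<close> z unfolding sections_iff[OF W U] sections_iff[OF W V] by auto
    hence "y = z" using z by simp
    thus ?thesis using z by simp
  qed
  show "?N \<subseteq> U \<inter> V" using st by blast
  show "\<forall>y\<in>?N. s y = t y" using st by blast
qed

text \<open>
  On the open image of \<open>s\<close> the map \<open>\<theta>\<close> is the composite of \<open>p\<close> with the section
  \<open>\<theta> s\<close>, and both are dimaps.
\<close>

lemma bundle_map_by_sections: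
  assumes e: "etale Z W p" and e': "etale Z W' p'" and w: "w \<in> topspace (fst W)"
    and U: "op U" and s: "s \<in> sections Z (W, p) U" and ws: "w \<in> s ` U"
    and \<theta>s: "compose U \<theta> s \<in> sections Z (W', p') U"
  shows "dimap_at W W' \<theta> w" "p' (\<theta> w) = p w"
proof -
  note W = etaleD(1)[OF e] and W' = etaleD(1)[OF e']
  obtain x where x: "x \<in> U" "w = s x" using ws by blast
  have ps: "p (s y) = y" if "y \<in> U" for y using s that unfolding sections_iff[OF W U] by blast
  have \<theta>: "dimap_at Z W' (compose U \<theta> s) x" "p' (compose U \<theta> s x) = x"
    using \<theta>s x unfolding sections_iff[OF W' U] by auto
  have "dimap_at W W' (\<lambda>v. compose U \<theta> s (p v)) w"
    using dimap_at_compose[OF etaleD(3)[OF e w]] \<theta>(1) ps x by simp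
  thus "dimap_at W W' \<theta> w"
    by (rule dimap_at_cong[OF _ section_open_image[OF e U s] ws]) (auto simp: ps compose_eq)
  show "p' (\<theta> w) = p w" using \<theta>(2) x ps by (simp add: compose_eq)
qed

lemma section_compose:
  assumes W: "W \<in> LPS UNIV" and W': "W' \<in> LPS UNIV" and U: "op U" and s: "s \<in> sections Z (W, p) U"
    and \<theta>: "\<And>w. w \<in> topspace (fst W) \<Longrightarrow> dimap_at W W' \<theta> w \<and> p' (\<theta> w) = p w"
  shows "compose U \<theta> s \<in> sections Z (W', p') U"
proof -
  have s': "dimap_at Z W s x" "p (s x) = x" "s x \<in> topspace (fst W)" if "x \<in> U" for x
    using s that section_topspace[OF W U s that] unfolding sections_iff[OF W U] by auto
  have "dimap_at Z W' (compose U \<theta> s) x" if x: "x \<in> U" for x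
    by (rule dimap_at_cong[of Z W' "\<lambda>x. \<theta> (s x)" x U,
          OF dimap_at_compose[OF s'(1)[OF x] conjunct1[OF \<theta>[OF s'(3)[OF x]]]] U x])
       (simp add: compose_eq)
  thus ?thesis unfolding sections_iff[OF W' U] using \<theta> s' by (auto simp: compose_def)
qed


section \<open>Germs of a presheaf\<close>

abbreviation presheaf :: "('a, 's) presheaf \<Rightarrow> bool" where
  "presheaf P \<equiv> is_functor (op_cat (Opens Z)) set_cat P"

lemma restr_in:
  assumes P: "presheaf P" and U: "op U" and V: "op V" "V \<subseteq> U"
  shows "restr P U V \<in> fob P U \<rightarrow>\<^sub>E fob P V"
proof -
  have hom: "\<forall>X\<in>Ob (op_cat (Opens Z)). \<forall>Y\<in>Ob (op_cat (Opens Z)). \<forall>f\<in>Hom (op_cat (Opens Z)) X Y.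
      fmor P X Y f \<in> Hom set_cat (fob P X) (fob P Y)"
    using P unfolding is_functor_def by blast
  have "(\<lambda>x\<in>V. x) \<in> Hom (op_cat (Opens Z)) U V" "U \<in> Ob (op_cat (Opens Z))" "V \<in> Ob (op_cat (Opens Z))"
    using U V by (simp_all add: op_cat_def Opens_def)
  hence "fmor P U V (\<lambda>x\<in>V. x) \<in> Hom set_cat (fob P U) (fob P V)" using hom by blast
  thus ?thesis by (simp add: restr_def set_cat_def)
qed

lemma restr_mem:
  assumes "presheaf P" "op U" "op V" "V \<subseteq> U" "s \<in> fob P U"
  shows "restr P U V s \<in> fob P V"
  using restr_in[OF assms(1-4)] assms(5) by blast

lemma restr_id:
  assumes P: "presheaf P" and U: "op U" and s: "s \<in> fob P U"
  shows "restr P U U s = s"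
proof -
  have "\<forall>X\<in>Ob (op_cat (Opens Z)). fmor P X X (Idn (op_cat (Opens Z)) X) = Idn set_cat (fob P X)"
    using P unfolding is_functor_def by blast
  hence "fmor P U U (\<lambda>x\<in>U. x) = (\<lambda>x\<in>fob P U. x)"
    using U by (simp add: op_cat_def Opens_def set_cat_def)
  thus ?thesis using s by (simp add: restr_def)
qed

lemma restr_restr:
  assumes P: "presheaf P" and U: "op U" and V: "op V" "V \<subseteq> U" and N: "op N" "N \<subseteq> V" 
    and s: "s \<in> fob P U"
  shows "restr P V N (restr P U V s) = restr P U N s"
proof -
  have "\<forall>X\<in>Ob (op_cat (Opens Z)). \<forall>Y\<in>Ob (op_cat (Opens Z)). \<forall>W\<in>Ob (op_cat (Opens Z)).
      \<forall>f\<in>Hom (op_cat (Opens Z)) X Y. \<forall>g\<in>Hom (op_cat (Opens Z)) Y W.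
        fmor P X W (Cmp (op_cat (Opens Z)) X Y W g f) =
        Cmp set_cat (fob P X) (fob P Y) (fob P W) (fmor P Y W g) (fmor P X Y f)"
    using P unfolding is_functor_def by blast
  moreover have "(\<lambda>x\<in>V. x) \<in> Hom (op_cat (Opens Z)) U V" "(\<lambda>x\<in>N. x) \<in> Hom (op_cat (Opens Z)) V N"
    "U \<in> Ob (op_cat (Opens Z))" "V \<in> Ob (op_cat (Opens Z))" "N \<in> Ob (op_cat (Opens Z))"
    using U V N by (simp_all add: op_cat_def Opens_def)
  ultimately have "fmor P U N (Cmp (op_cat (Opens Z)) U V N (\<lambda>x\<in>N. x) (\<lambda>x\<in>V. x)) =
      Cmp set_cat (fob P U) (fob P V) (fob P N) (fmor P V N (\<lambda>x\<in>N. x)) (fmor P U V (\<lambda>x\<in>V. x))"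
    by blast
  moreover have "Cmp (op_cat (Opens Z)) U V N (\<lambda>x\<in>N. x) (\<lambda>x\<in>V. x) = (\<lambda>x\<in>N. x)"
    using N(2) by (auto simp: op_cat_def Opens_def compose_def intro!: restrict_ext)
  ultimately have "fmor P U N (\<lambda>x\<in>N. x) = compose (fob P U) (fmor P V N (\<lambda>x\<in>N. x)) (fmor P U V (\<lambda>x\<in>V. x))"
    by (simp add: set_cat_def)
  thus ?thesis using s by (simp add: restr_def compose_eq)
qed

lemma fst_germ [simp]: "fst (germ Z P x U s) = x"
  by (simp add: germ_def)

lemma mem_germ:
  "(V, t) \<in> snd (germ Z P x U s) \<longleftrightarrow> op V \<and> x \<in> V \<and> t \<in> fob P V \<and>
     (\<exists>N. op N \<and> x \<in> N \<and> N \<subseteq> U \<inter> V \<and> restr P U N s = restr P V N t)"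
  by (simp add: germ_def)

text \<open>
  Every representative of the first germ, compared on a neighbourhood \<open>N'\<close>, is compared with the
  second section on \<open>N \<inter> N'\<close>; so the two sets of representatives coincide.
\<close>

lemma germ_eqI:
  assumes P: "presheaf P" and U: "op U" "s \<in> fob P U" and V: "op V" "t \<in> fob P V"
    and N: "op N" "x \<in> N" "N \<subseteq> U" "N \<subseteq> V" and eq: "restr P U N s = restr P V N t"
  shows "germ Z P x U s = germ Z P x V t"
proof -
  have *: "q \<in> snd (germ Z P x V t)"
    if U: "op U" "s \<in> fob P U" and V: "op V" "t \<in> fob P V" and N: "N \<subseteq> U" "N \<subseteq> V"
      and eq: "restr P U N s = restr P V N t" and q: "q \<in> snd (germ Z P x U s)" for U V s t q
  proof -
    obtain D r where qq: "q = (D, r)" by fastforce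
    obtain N' where D: "op D" "x \<in> D" "r \<in> fob P D"
      and N': "op N'" "x \<in> N'" "N' \<subseteq> U" "N' \<subseteq> D" "restr P U N' s = restr P D N' r"
      using q unfolding qq mem_germ by blast
    let ?N = "N \<inter> N'"
    have op: "op ?N" using \<open>op N\<close> N'(1) by blast
    have "restr P V ?N t = restr P N ?N (restr P V N t)"
      using restr_restr[OF P V(1) \<open>op N\<close> N(2) op _ V(2)] by simp
    also have "\<dots> = restr P U ?N s"
      unfolding eq[symmetric] using restr_restr[OF P U(1) \<open>op N\<close> N(1) op _ U(2)] by simp
    also have "\<dots> = restr P N' ?N (restr P U N' s)"
      using restr_restr[OF P U(1) N'(1,3) op _ U(2)] by simp
    also have "\<dots> = restr P D ?N r"
      unfolding N'(5) using restr_restr[OF P D(1) N'(1,4) op _ D(3)] by simp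
    finally have eq: "restr P V ?N t = restr P D ?N r" .
    show ?thesis unfolding qq mem_germ
      by (intro conjI D exI[of _ ?N] op eq) (use \<open>x \<in> N\<close> N'(2,4) N(2) in auto)
  qed
  have "snd (germ Z P x U s) = snd (germ Z P x V t)"
    using *[OF U V N(3,4) eq] *[OF V U N(4,3) eq[symmetric]] by blast
  thus ?thesis by (simp add: germ_def)
qed

lemma germ_eqD:
  assumes P: "presheaf P" and V: "op V" "t \<in> fob P V" "x \<in> V"
    and eq: "germ Z P x U s = germ Z P x V t"
  obtains N where "op N" "x \<in> N" "N \<subseteq> U" "N \<subseteq> V" "restr P U N s = restr P V N t"
proof -
  have "(V, t) \<in> snd (germ Z P x V t)"
    unfolding mem_germ using V by (intro conjI exI[of _ V]) auto
  thus ?thesis unfolding eq[symmetric] mem_germ using that by blast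
qed

lemma germ_restr:
  assumes P: "presheaf P" and U: "op U" "s \<in> fob P U" and V: "op V" "V \<subseteq> U" "x \<in> V"
  shows "germ Z P x V (restr P U V s) = germ Z P x U s"
proof (rule germ_eqI[OF P V(1) restr_mem[OF P U(1) V(1,2) U(2)] U V(1,3) subset_refl V(2)])
  show "restr P V V (restr P U V s) = restr P U V s"
    using restr_id[OF P V(1) restr_mem[OF P U(1) V(1,2) U(2)]] .
qed

lemma topspace_germ_top:
  "g \<in> topspace (germ_top Z P) \<longleftrightarrow> (\<exists>x U s. op U \<and> s \<in> fob P U \<and> x \<in> U \<and> g = germ Z P x U s)"
  unfolding germ_top_def dot_sec_def by auto

lemma germ_in_top: "op U \<Longrightarrow> s \<in> fob P U \<Longrightarrow> x \<in> U \<Longrightarrow> germ Z P x U s \<in> topspace (germ_top Z P)"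
  unfolding topspace_germ_top by blast

lemma dot_sec_open: "op U \<Longrightarrow> s \<in> fob P U \<Longrightarrow> openin (germ_top Z P) (dot_sec Z P s U)"
  unfolding germ_top_def by (rule topology_generated_by_Basis) blast

lemma dot_sec_inj: "inj_on fst (dot_sec Z P s U)"
  unfolding dot_sec_def by (rule inj_onI, elim imageE) simp

text \<open>
  Over an open set \<open>D\<close>, each germ of \<open>s \<in> P(U)\<close> is a germ of the restriction of \<open>s\<close> to
  \<open>U \<inter> D\<close>, whose germs form a basic open set.
\<close>

lemma continuous_germ_fst:
  assumes P: "presheaf P"
  shows "continuous_map (germ_top Z P) (fst Z) fst"
  unfolding continuous_map_def
proof (intro conjI allI impI)
  show "fst \<in> topspace (germ_top Z P) \<rightarrow> topspace (fst Z)"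
  proof
    fix g assume "g \<in> topspace (germ_top Z P)"
    then obtain x U s where g: "op U" "x \<in> U" "g = germ Z P x U s"
      unfolding topspace_germ_top by blast
    thus "fst g \<in> topspace (fst Z)" using openin_subset[OF g(1)] by auto
  qed
  fix D assume D: "op D"
  show "openin (germ_top Z P) {g \<in> topspace (germ_top Z P). fst g \<in> D}"
  proof (subst openin_subopen, intro ballI)
    fix g assume "g \<in> {g \<in> topspace (germ_top Z P). fst g \<in> D}"
    hence "g \<in> topspace (germ_top Z P)" and gD: "fst g \<in> D" by auto
    then obtain x U s where g: "op U" "s \<in> fob P U" "x \<in> U" "g = germ Z P x U s"
      unfolding topspace_germ_top by blast
    have xD: "x \<in> D" using gD g(4) by simp
    let ?V = "U \<inter> D"
    have V: "op ?V" using g(1) D by blast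
    have mem: "restr P U ?V s \<in> fob P ?V" using restr_mem[OF P g(1) V _ g(2)] by simp
    have eq: "germ Z P y ?V (restr P U ?V s) = germ Z P y U s" if "y \<in> ?V" for y
      using germ_restr[OF P g(1,2) V _ that] by simp
    have "dot_sec Z P (restr P U ?V s) ?V \<subseteq> {g \<in> topspace (germ_top Z P). fst g \<in> D}"
      unfolding dot_sec_def using germ_in_top[OF V mem] by auto
    moreover have "g \<in> dot_sec Z P (restr P U ?V s) ?V"
      unfolding dot_sec_def g(4) using g(3) xD eq[of x] by (intro image_eqI[of _ _ x]) simp_all
    ultimately show "\<exists>T. openin (germ_top Z P) T \<and> g \<in> T \<and> T \<subseteq> {g \<in> topspace (germ_top Z P). fst g \<in> D}"
      using dot_sec_open[OF V mem] by blast
  qed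
qed

text \<open>
  Equality of two germs at a point spreads to a neighbourhood, so \<open>{x. germ\<^sub>x s \<in> dot_sec t V}\<close>
  is open.
\<close>

lemma continuous_germ:
  assumes P: "presheaf P" and U: "op U" "s \<in> fob P U"
  shows "continuous_map (subtopology (fst Z) U) (germ_top Z P) (\<lambda>x. germ Z P x U s)"
  unfolding germ_top_def
proof (rule continuous_on_generated_topo)
  have top: "topspace (subtopology (fst Z) U) = U" using openin_subset[OF U(1)] by auto
  show "(\<lambda>x. germ Z P x U s) ` topspace (subtopology (fst Z) U)
      \<subseteq> \<Union> {dot_sec Z P s U |s U. op U \<and> s \<in> fob P U}"
    unfolding top using U by (auto simp: dot_sec_def)
  fix B assume "B \<in> {dot_sec Z P s U |s U. op U \<and> s \<in> fob P U}"
  then obtain t V where V: "op V" "t \<in> fob P V" "B = dot_sec Z P t V" by blast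
  let ?R = "(\<lambda>x. germ Z P x U s) -` B \<inter> U"
  have "op ?R"
  proof (subst openin_subopen, intro ballI)
    fix x assume "x \<in> ?R"
    then obtain y where "y \<in> V" "germ Z P x U s = germ Z P y V t" "x \<in> U"
      unfolding V(3) dot_sec_def by auto
    hence x: "x \<in> V" "germ Z P x U s = germ Z P x V t" "x \<in> U" by (metis fst_germ)+
    obtain N where N: "op N" "x \<in> N" "N \<subseteq> U" "N \<subseteq> V" "restr P U N s = restr P V N t"
      using germ_eqD[OF P V(1,2) x(1,2)] .
    have "germ Z P y U s = germ Z P y V t" if "y \<in> N" for y
      using germ_eqI[OF P U V(1,2) N(1) that N(3-5)] .
    hence "N \<subseteq> ?R" unfolding V(3) dot_sec_def using N(3,4) by auto
    thus "\<exists>T. op T \<and> x \<in> T \<and> T \<subseteq> ?R" using N(1,2) by blast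
  qed
  thus "openin (subtopology (fst Z) U) ((\<lambda>x. germ Z P x U s) -` B \<inter> topspace (subtopology (fst Z) U))"
    unfolding top using U(1) by (simp add: openin_open_subtopology)
qed

definition small_dots :: "('a, 's) presheaf \<Rightarrow> ('a, 's) germ set set" where
  "small_dots P = {dot_sec Z P s V | s V U r. (U, r) \<in> lps_atlas Z \<and> op V \<and> V \<subseteq> U \<and> s \<in> fob P V}"

text \<open>
  A germ is related to another in a chart exactly if their base points are, so the germ atlas is
  pulled back along the projection, which is injective on each set of germs of one section.
\<close>

lemma germ_atlas_pullback:
  "germ_atlas Z P (lps_atlas Z) = pullback_atlas fst (small_dots P) (lps_atlas Z)"
proof -
  note A = lps_atlas(2)[OF Z]
  have eq: "{(germ Z P x V s, germ Z P y V s) | x y. x \<in> V \<and> y \<in> V \<and> (x, y) \<in> r} =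
      {(a, b). a \<in> dot_sec Z P s V \<and> b \<in> dot_sec Z P s V \<and> (fst a, fst b) \<in> atlas_le (lps_atlas Z)}"
    if "(U, r) \<in> lps_atlas Z" "V \<subseteq> U" for U r V s
  proof -
    have "(x, y) \<in> r \<longleftrightarrow> (x, y) \<in> atlas_le (lps_atlas Z)" if "x \<in> V" "y \<in> V" for x y
      using atlas_le_chart[OF A \<open>(U, r) \<in> lps_atlas Z\<close>, of x y] that \<open>V \<subseteq> U\<close> by blast
    thus ?thesis unfolding dot_sec_def by fastforce
  qed
  show ?thesis
  proof (intro set_eqI iffI)
    fix q assume "q \<in> germ_atlas Z P (lps_atlas Z)"
    then obtain s V U r where "(U, r) \<in> lps_atlas Z" "op V" "V \<subseteq> U" "s \<in> fob P V"
      "q = (dot_sec Z P s V, {(germ Z P x V s, germ Z P y V s) | x y. x \<in> V \<and> y \<in> V \<and> (x, y) \<in> r})"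
      unfolding germ_atlas_def by blast
    thus "q \<in> pullback_atlas fst (small_dots P) (lps_atlas Z)"
      unfolding pullback_atlas_def small_dots_def using eq[of U r V s]
      by (intro image_eqI[of _ _ "dot_sec Z P s V"]) auto
  next
    fix q assume "q \<in> pullback_atlas fst (small_dots P) (lps_atlas Z)"
    then obtain s V U r where V: "(U, r) \<in> lps_atlas Z" "op V" "V \<subseteq> U" "s \<in> fob P V"
      "q = (dot_sec Z P s V, {(a, b). a \<in> dot_sec Z P s V \<and> b \<in> dot_sec Z P s V \<and>
          (fst a, fst b) \<in> atlas_le (lps_atlas Z)})"
      unfolding pullback_atlas_def small_dots_def by blast
    show "q \<in> germ_atlas Z P (lps_atlas Z)"
      unfolding germ_atlas_def mem_Collect_eq V(5) eq[OF V(1,3), symmetric]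
      by (rule exI[of _ s], rule exI[of _ V], rule exI[of _ U], rule exI[of _ r]) (intro conjI refl V)
  qed
qed

lemma germ_lps:
  assumes P: "presheaf P"
  shows "germ_lps Z P \<in> LPS UNIV" "fst (germ_lps Z P) = germ_top Z P"
    "pullback_atlas fst (small_dots P) (lps_atlas Z) \<in> snd (germ_lps Z P)"
proof -
  note A = lps_atlas(2)[OF Z]
  have o: "order_atlas (germ_top Z P) (pullback_atlas fst (small_dots P) (lps_atlas Z))"
  proof (rule order_atlas_pullback[OF A continuous_germ_fst[OF P]])
    fix D assume "D \<in> small_dots P"
    then obtain s V U r where D: "(U, r) \<in> lps_atlas Z" "op V" "V \<subseteq> U" "s \<in> fob P V" "D = dot_sec Z P s V"
      unfolding small_dots_def by blast
    show "openin (germ_top Z P) D" "inj_on fst D"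
      unfolding D(5) using dot_sec_open[OF D(2,4)] dot_sec_inj by auto
    have "fst ` D \<subseteq> U" unfolding D(5) dot_sec_def using D(3) by auto
    thus "\<exists>U r. (U, r) \<in> lps_atlas Z \<and> fst ` D \<subseteq> U" using D(1) by blast
  next
    show "topspace (germ_top Z P) \<subseteq> \<Union> (small_dots P)"
    proof
      fix g assume "g \<in> topspace (germ_top Z P)"
      then obtain x V s where V: "op V" "s \<in> fob P V" "x \<in> V" "g = germ Z P x V s"
        unfolding topspace_germ_top by blast
      have "x \<in> topspace (fst Z)" using V openin_subset by blast
      then obtain U r where U: "(U, r) \<in> lps_atlas Z" "x \<in> U" using order_atlas_cover[OF A] by blast
      let ?N = "V \<inter> U"
      have N: "op ?N" using V order_atlasD(1)[OF A U(1)] by blast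
      have mem: "restr P V ?N s \<in> fob P ?N" using restr_mem[OF P V(1) N _ V(2)] by simp
      have "g \<in> dot_sec Z P (restr P V ?N s) ?N"
        unfolding dot_sec_def V(4) using germ_restr[OF P V(1,2) N, of x] V(3) U(2)
        by (intro image_eqI[of _ _ x]) auto
      moreover have "dot_sec Z P (restr P V ?N s) ?N \<in> small_dots P"
        unfolding small_dots_def using U(1) N mem by blast
      ultimately show "g \<in> \<Union> (small_dots P)" by blast
    qed
  qed
  have eq: "germ_lps Z P = (germ_top Z P, atlas_rel (germ_top Z P) ``
      {pullback_atlas fst (small_dots P) (lps_atlas Z)})"
    unfolding germ_lps_def lps_atlas_def[symmetric] germ_atlas_pullback ..
  show "germ_lps Z P \<in> LPS UNIV" unfolding eq by (rule LPS_I[OF o])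
  show "fst (germ_lps Z P) = germ_top Z P" unfolding eq by simp
  have "(pullback_atlas fst (small_dots P) (lps_atlas Z), pullback_atlas fst (small_dots P) (lps_atlas Z))
     \<in> atlas_rel (germ_top Z P)"
    using o equiv_class_self[OF equiv_atlas_rel] by simp
  thus "pullback_atlas fst (small_dots P) (lps_atlas Z) \<in> snd (germ_lps Z P)" unfolding eq by simp
qed

lemma dimap_at_germ_fst:
  assumes P: "presheaf P" and g: "g \<in> topspace (germ_top Z P)"
  shows "dimap_at (germ_lps Z P) Z fst g"
  by (rule dimap_at_pullback[OF Z lps_atlas(1)[OF Z] germ_lps(1)[OF P] germ_lps(3)[OF P]])
     (use germ_lps(2)[OF P] continuous_germ_fst[OF P] g in auto)

lemma dimap_at_germ:
  assumes P: "presheaf P" and U: "op U" "s \<in> fob P U" "x \<in> U"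
  shows "dimap_at Z (germ_lps Z P) (\<lambda>x. germ Z P x U s) x"
  by (rule dimap_at_into_pullback[OF Z lps_atlas(1)[OF Z] germ_lps(1)[OF P] germ_lps(3)[OF P] U(1,3)])
     (use germ_lps(2)[OF P] continuous_germ[OF P U(1,2)] in auto)

text \<open>
  Equal germs mean equal restrictions on the members of an open cover, and the amalgamation of a
  compatible family is unique.
\<close>

lemma sheaf_germs_eqI:
  assumes P: "presheaf P" and sh: "sheaf_condition Z P" and U: "op U"
    and s: "s \<in> fob P U" and t: "t \<in> fob P U" and eq: "\<And>x. x \<in> U \<Longrightarrow> germ Z P x U s = germ Z P x U t"
  shows "s = t"
proof -
  define \<V> where "\<V> = {N. op N \<and> N \<subseteq> U \<and> restr P U N s = restr P U N t}"
  have cov: "\<Union>\<V> = U"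
  proof
    show "U \<subseteq> \<Union>\<V>"
    proof
      fix x assume x: "x \<in> U"
      obtain N where "op N" "x \<in> N" "N \<subseteq> U" "N \<subseteq> U" "restr P U N s = restr P U N t"
        using germ_eqD[OF P U t x eq[OF x]] .
      thus "x \<in> \<Union>\<V>" unfolding \<V>_def by blast
    qed
  qed (auto simp: \<V>_def)
  have 1: "\<forall>V\<in>\<V>. op V" unfolding \<V>_def by blast
  have 2: "\<forall>V\<in>\<V>. restr P U V s \<in> fob P V" unfolding \<V>_def using restr_mem[OF P U _ _ s] by blast
  have 3: "\<forall>V\<in>\<V>. \<forall>V'\<in>\<V>. restr P V (V \<inter> V') (restr P U V s) = restr P V' (V \<inter> V') (restr P U V' s)"
  proof (intro ballI)
    fix V V' assume "V \<in> \<V>" "V' \<in> \<V>"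
    hence V: "op V" "V \<subseteq> U" "op V'" "V' \<subseteq> U" "op (V \<inter> V')" unfolding \<V>_def by auto
    show "restr P V (V \<inter> V') (restr P U V s) = restr P V' (V \<inter> V') (restr P U V' s)"
      using restr_restr[OF P U V(1,2,5) _ s] restr_restr[OF P U V(3,4,5) _ s] by simp
  qed
  from sh[unfolded sheaf_condition_def, rule_format, of \<V> "\<lambda>V. restr P U V s"] 1 2 3
  have "\<exists>!r. r \<in> fob P (\<Union>\<V>) \<and> (\<forall>V\<in>\<V>. restr P (\<Union>\<V>) V r = restr P U V s)" by blast
  hence ex: "\<exists>!r. r \<in> fob P U \<and> (\<forall>V\<in>\<V>. restr P U V r = restr P U V s)" unfolding cov .
  have "\<forall>V\<in>\<V>. restr P U V t = restr P U V s" unfolding \<V>_def by auto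
  thus ?thesis using ex s t by blast
qed

section \<open>The space of germs as an etale bundle\<close>

definition label_section :: "('a, 's) presheaf \<Rightarrow> (('a, 's) germ \<Rightarrow> 'w) \<Rightarrow> 'a set \<Rightarrow> 's \<Rightarrow> 'a \<Rightarrow> 'w" where
  "label_section P c U s = (\<lambda>x\<in>U. c (germ Z P x U s))"

definition label_proj :: "'w lps \<Rightarrow> ('w \<Rightarrow> ('a, 's) germ) \<Rightarrow> 'w \<Rightarrow> 'a" where
  "label_proj T d = (\<lambda>w\<in>topspace (fst T). fst (d w))"

text \<open>
  The space of germs up to an isomorphism \<open>c\<close> with inverse \<open>d\<close>. This covers both the space of
  germs itself and its relabellings, so that each fact about its sections is proved once.
\<close>

definition germ_model :: "('a, 's) presheaf \<Rightarrow> 'w lps \<Rightarrow> (('a, 's) germ \<Rightarrow> 'w) \<Rightarrow> ('w \<Rightarrow> ('a, 's) germ) \<Rightarrow> bool" where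
  "germ_model P T c d \<longleftrightarrow> T \<in> LPS UNIV \<and> homeomorphic_maps (germ_top Z P) (fst T) c d \<and>
     (\<forall>g\<in>topspace (germ_top Z P). dimap_at (germ_lps Z P) T c g) \<and>
     (\<forall>w\<in>topspace (fst T). dimap_at T (germ_lps Z P) d w)"

lemma germ_model_lps:
  assumes P: "presheaf P"
  shows "germ_model P (germ_lps Z P) (\<lambda>g. g) (\<lambda>g. g)"
  unfolding germ_model_def using germ_lps(1,2)[OF P] dimap_at_id[of _ "germ_lps Z P"]
  by (auto simp: homeomorphic_maps_def)

lemma germ_model_transport:
  assumes P: "presheaf P" and cd: "homeomorphic_maps (germ_top Z P) N c d"
  shows "germ_model P (transport_lps N c (germ_lps Z P)) c d"
proof -
  note G = germ_lps(1,2)[OF P]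
  have cd': "homeomorphic_maps (fst (germ_lps Z P)) N c d" using cd G(2) by simp
  have "fst (transport_lps N c (germ_lps Z P)) = N" by (simp add: transport_lps_def)
  thus ?thesis unfolding germ_model_def
    using cd transport_in_LPS[OF G(1) cd', of UNIV] dimap_at_transport[OF G(1) cd']
      dimap_at_transport_inv[OF G(1) cd'] G(2) by simp
qed

context
  fixes P :: "('a, 's) presheaf" and T :: "'w lps" and c d
  assumes P: "presheaf P" and m: "germ_model P T c d"
begin

lemma model_facts:
  shows "T \<in> LPS UNIV" "\<And>g. g \<in> topspace (germ_top Z P) \<Longrightarrow> d (c g) = g"
    "\<And>w. w \<in> topspace (fst T) \<Longrightarrow> c (d w) = w"
    "\<And>g. g \<in> topspace (germ_top Z P) \<Longrightarrow> c g \<in> topspace (fst T)"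
    "\<And>w. w \<in> topspace (fst T) \<Longrightarrow> d w \<in> topspace (germ_top Z P)"
    "\<And>D. openin (germ_top Z P) D \<Longrightarrow> openin (fst T) (c ` D)"
  using m homeo_facts[of "germ_top Z P" "fst T" c d] unfolding germ_model_def by blast+

lemma model_germ:
  assumes "w \<in> topspace (fst T)"
  obtains x U s where "op U" "s \<in> fob P U" "x \<in> U" "w = c (germ Z P x U s)"
  using model_facts(3,5)[OF assms] unfolding topspace_germ_top by metis

lemma label_proj_germ:
  assumes "op U" "s \<in> fob P U" "x \<in> U"
  shows "label_proj T d (c (germ Z P x U s)) = x"
  using model_facts(2,4)[OF germ_in_top[OF assms]] by (simp add: label_proj_def)

lemma label_section:
  assumes U: "op U" and s: "s \<in> fob P U"
  shows "label_section P c U s \<in> sections Z (T, label_proj T d) U"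
  unfolding sections_iff[OF model_facts(1) U]
proof (intro conjI ballI)
  show "label_section P c U s \<in> extensional U" by (simp add: label_section_def)
  fix x assume x: "x \<in> U"
  have "dimap_at (germ_lps Z P) T c (germ Z P x U s)"
    using m germ_in_top[OF U s x] unfolding germ_model_def by blast
  from dimap_at_compose[OF dimap_at_germ[OF P U s x] this]
  show "dimap_at Z T (label_section P c U s) x"
    by (rule dimap_at_cong[OF _ U x]) (simp add: label_section_def)
  show "label_proj T d (label_section P c U s x) = x"
    using label_proj_germ[OF U s x] x by (simp add: label_section_def)
qed

lemma etale_model: "etale Z T (label_proj T d)"
proof (rule etaleI[OF model_facts(1)])
  show "label_proj T d \<in> extensional (topspace (fst T))" by (simp add: label_proj_def)
  fix w assume w: "w \<in> topspace (fst T)"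
  have "dimap_at T (germ_lps Z P) d w" using m w unfolding germ_model_def by blast
  from dimap_at_compose[OF this dimap_at_germ_fst[OF P model_facts(5)[OF w]]]
  show "dimap_at T Z (label_proj T d) w"
    by (rule dimap_at_cong[OF _ openin_topspace w]) (simp add: label_proj_def)
  obtain x U s where U: "op U" "s \<in> fob P U" "x \<in> U" "w = c (germ Z P x U s)" using model_germ[OF w] .
  have img: "label_section P c U s ` U = c ` dot_sec Z P s U"
    unfolding label_section_def dot_sec_def image_image by (rule image_cong) auto
  show "\<exists>U s. op U \<and> s \<in> sections Z (T, label_proj T d) U \<and> w \<in> s ` U \<and> openin (fst T) (s ` U)"
  proof (intro exI conjI)
    show "op U" by fact
    show "label_section P c U s \<in> sections Z (T, label_proj T d) U" by (rule label_section[OF U(1,2)])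
    show "w \<in> label_section P c U s ` U" unfolding img dot_sec_def using U by blast
    show "openin (fst T) (label_section P c U s ` U)"
      unfolding img using model_facts(6)[OF dot_sec_open[OF U(1,2)]] .
  qed
qed

lemma label_section_eqD:
  assumes "op U" "s \<in> fob P U" "x \<in> U" "op V" "t \<in> fob P V" "x \<in> V"
    "c (germ Z P x U s) = c (germ Z P x V t)"
  shows "germ Z P x U s = germ Z P x V t"
  using model_facts(2)[OF germ_in_top] assms by metis

text \<open>
  A section of the space of germs passes at each point through the germ of some element of \<open>P\<close>, hence
  agrees with the section of that element nearby. These elements have equal germs
  wherever two of them are defined, so they are compatible and glue to an element of \<open>P(U)\<close>.
\<close>

lemma label_section_bij:
  assumes sh: "sheaf_condition Z P" and U: "op U"
  shows "bij_betw (label_section P c U) (fob P U) (sections Z (T, label_proj T d) U)"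
proof (rule bij_betwI')
  have inj: "s = t" if U: "op U" and s: "s \<in> fob P U" and t: "t \<in> fob P U"
    and eq: "\<And>x. x \<in> U \<Longrightarrow> c (germ Z P x U s) = c (germ Z P x U t)" for U s t
    by (rule sheaf_germs_eqI[OF P sh U s t]) (use label_section_eqD U s t eq in blast)
  show "(label_section P c U s = label_section P c U t) = (s = t)" if "s \<in> fob P U" "t \<in> fob P U" for s t
  proof
    assume eq: "label_section P c U s = label_section P c U t"
    have "c (germ Z P x U s) = c (germ Z P x U t)" if "x \<in> U" for x
      using fun_cong[OF eq, of x] that by (simp add: label_section_def)
    thus "s = t" by (rule inj[OF U that])
  qed simp
  show "label_section P c U s \<in> sections Z (T, label_proj T d) U" if "s \<in> fob P U" for s
    using label_section[OF U that] .
  fix \<sigma> assume \<sigma>: "\<sigma> \<in> sections Z (T, label_proj T d) U"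
  note e = etale_model and T = model_facts(1)
  define \<V> where "\<V> = {N. op N \<and> N \<subseteq> U \<and> (\<exists>t\<in>fob P N. \<forall>y\<in>N. \<sigma> y = c (germ Z P y N t))}"
  have cov: "\<Union>\<V> = U"
  proof
    show "U \<subseteq> \<Union>\<V>"
    proof
      fix x assume x: "x \<in> U"
      have \<sigma>T: "\<sigma> x \<in> topspace (fst T)" using section_topspace[OF T U \<sigma> x] .
      obtain y V t where V: "op V" "t \<in> fob P V" "y \<in> V" and \<sigma>x: "\<sigma> x = c (germ Z P y V t)"
        using model_germ[OF \<sigma>T] .
      have "label_proj T d (\<sigma> x) = x" using \<sigma> x unfolding sections_iff[OF T U] by blast
      hence "y = x" unfolding \<sigma>x label_proj_germ[OF V] .
      hence xV: "x \<in> V" and \<sigma>x': "\<sigma> x = label_section P c V t x" using V \<sigma>x by (auto simp: label_section_def)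
      obtain N where N: "op N" "x \<in> N" "N \<subseteq> U \<inter> V" "\<forall>y\<in>N. \<sigma> y = label_section P c V t y"
        using sections_agree_near[OF e U \<sigma> V(1) label_section[OF V(1,2)] x xV \<sigma>x'] .
      have NV: "N \<subseteq> V" using N(3) by blast
      have "\<sigma> z = c (germ Z P z N (restr P V N t))" if "z \<in> N" for z
        using N(4)[rule_format, OF that] NV that germ_restr[OF P V(1,2) N(1) NV that] by (auto simp: label_section_def)
      hence "N \<in> \<V>" unfolding \<V>_def using N restr_mem[OF P V(1) N(1) NV V(2)] by blast
      thus "x \<in> \<Union>\<V>" using N(2) by blast
    qed
  qed (auto simp: \<V>_def)
  have "\<forall>N\<in>\<V>. \<exists>t. t \<in> fob P N \<and> (\<forall>y\<in>N. \<sigma> y = c (germ Z P y N t))" unfolding \<V>_def by blast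
  from bchoice[OF this] obtain t
    where t: "\<And>N. N \<in> \<V> \<Longrightarrow> t N \<in> fob P N" "\<And>N y. N \<in> \<V> \<Longrightarrow> y \<in> N \<Longrightarrow> \<sigma> y = c (germ Z P y N (t N))"
    by blast
  have 1: "\<forall>V\<in>\<V>. op V" unfolding \<V>_def by blast
  have 2: "\<forall>V\<in>\<V>. t V \<in> fob P V" using t(1) by blast
  have 3: "\<forall>V\<in>\<V>. \<forall>V'\<in>\<V>. restr P V (V \<inter> V') (t V) = restr P V' (V \<inter> V') (t V')"
  proof (intro ballI)
    fix V V' assume V: "V \<in> \<V>" "V' \<in> \<V>"
    hence o: "op V" "op V'" "op (V \<inter> V')" using 1 by auto
    have r: "restr P V (V \<inter> V') (t V) \<in> fob P (V \<inter> V')" "restr P V' (V \<inter> V') (t V') \<in> fob P (V \<inter> V')"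
      using restr_mem[OF P o(1,3) _ t(1)[OF V(1)]] restr_mem[OF P o(2,3) _ t(1)[OF V(2)]] by auto
    show "restr P V (V \<inter> V') (t V) = restr P V' (V \<inter> V') (t V')"
    proof (rule inj[OF o(3) r])
      fix x assume x: "x \<in> V \<inter> V'"
      have "c (germ Z P x (V \<inter> V') (restr P V (V \<inter> V') (t V))) = \<sigma> x"
        using germ_restr[OF P o(1) t(1)[OF V(1)] o(3) _ x] t(2)[OF V(1)] x by simp
      moreover have "c (germ Z P x (V \<inter> V') (restr P V' (V \<inter> V') (t V'))) = \<sigma> x"
        using germ_restr[OF P o(2) t(1)[OF V(2)] o(3) _ x] t(2)[OF V(2)] x by simp
      ultimately show "c (germ Z P x (V \<inter> V') (restr P V (V \<inter> V') (t V))) =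
          c (germ Z P x (V \<inter> V') (restr P V' (V \<inter> V') (t V')))" by simp
    qed
  qed
  from sh[unfolded sheaf_condition_def, rule_format, of \<V> t] 1 2 3
  have "\<exists>r. r \<in> fob P (\<Union>\<V>) \<and> (\<forall>V\<in>\<V>. restr P (\<Union>\<V>) V r = t V)" by blast
  then obtain r where r: "r \<in> fob P U" "\<And>V. V \<in> \<V> \<Longrightarrow> restr P U V r = t V" unfolding cov by blast
  have "\<sigma> = label_section P c U r"
  proof (rule extensionalityI[of _ U])
    show "\<sigma> \<in> extensional U" using \<sigma> unfolding sections_iff[OF T U] by blast
    show "label_section P c U r \<in> extensional U" by (simp add: label_section_def)
    fix x assume x: "x \<in> U"
    then obtain V where V: "V \<in> \<V>" "x \<in> V" using cov by blast
    hence "op V" "V \<subseteq> U" unfolding \<V>_def by auto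
    from germ_restr[OF P U r(1) this V(2)] have "germ Z P x V (t V) = germ Z P x U r"
      using r(2)[OF V(1)] by simp
    thus "\<sigma> x = label_section P c U r x" using t(2)[OF V] x by (simp add: label_section_def)
  qed
  thus "\<exists>s\<in>fob P U. \<sigma> = label_section P c U s" using r(1) by blast
qed

end

end

section \<open>Functor categories and natural isomorphisms\<close>

lemma is_category_set_cat: "is_category set_cat"
  unfolding is_category_def set_cat_def
  by (auto simp: compose_def fun_eq_iff PiE_def extensional_def Pi_iff)

lemma is_category_full_subcat: "is_category C \<Longrightarrow> is_category (full_subcat C S)"
  unfolding is_category_def full_subcat_def by simp

context
  fixes C :: "('o, 'm) cat" and D :: "('p, 'n) cat"
  assumes D: "is_category D"
begin

lemma cat_comp: "X \<in> Ob D \<Longrightarrow> Y \<in> Ob D \<Longrightarrow> W \<in> Ob D \<Longrightarrow> f \<in> Hom D X Y \<Longrightarrow> g \<in> Hom D Y W \<Longrightarrow>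
   Cmp D X Y W g f \<in> Hom D X W"
  using D unfolding is_category_def by blast

lemma cat_idn: "X \<in> Ob D \<Longrightarrow> Idn D X \<in> Hom D X X"
  using D unfolding is_category_def by blast

lemma cat_id:
  assumes "X \<in> Ob D" "Y \<in> Ob D" "f \<in> Hom D X Y"
  shows "Cmp D X X Y f (Idn D X) = f" "Cmp D X Y Y (Idn D Y) f = f"
  using D assms unfolding is_category_def by blast+

lemma cat_assoc:
  assumes "X \<in> Ob D" "Y \<in> Ob D" "W \<in> Ob D" "V \<in> Ob D" 
    "f \<in> Hom D X Y" "g \<in> Hom D Y W" "h \<in> Hom D W V"
  shows "Cmp D X W V h (Cmp D X Y W g f) = Cmp D X Y V (Cmp D Y W V h g) f"
  using D assms unfolding is_category_def by blast

lemma functorD: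
  assumes "is_functor C D F"
  shows "\<And>X. X \<in> Ob C \<Longrightarrow> fob F X \<in> Ob D"
    "\<And>X Y f. X \<in> Ob C \<Longrightarrow> Y \<in> Ob C \<Longrightarrow> f \<in> Hom C X Y \<Longrightarrow> fmor F X Y f \<in> Hom D (fob F X) (fob F Y)"
  using assms unfolding is_functor_def by blast+

lemma is_category_func_cat: "is_category (func_cat C D)"
proof -
  have comp: "is_nat_trans C D F H (\<lambda>X\<in>Ob C. Cmp D (fob F X) (fob G X) (fob H X) (\<theta> X) (\<eta> X))"
    if F: "is_functor C D F" and G: "is_functor C D G" and H: "is_functor C D H"
      and \<eta>: "is_nat_trans C D F G \<eta>" and \<theta>: "is_nat_trans C D G H \<theta>" for F G H \<eta> \<theta>
  proof -
    note o = functorD(1)[OF F] functorD(1)[OF G] functorD(1)[OF H]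
    have \<eta>': "\<And>X. X \<in> Ob C \<Longrightarrow> \<eta> X \<in> Hom D (fob F X) (fob G X)"
      and \<theta>': "\<And>X. X \<in> Ob C \<Longrightarrow> \<theta> X \<in> Hom D (fob G X) (fob H X)"
      using \<eta> \<theta> unfolding is_nat_trans_def by blast+
    have "Cmp D (fob F X) (fob F Y) (fob H Y) (Cmp D (fob F Y) (fob G Y) (fob H Y) (\<theta> Y) (\<eta> Y)) (fmor F X Y f) =
        Cmp D (fob F X) (fob H X) (fob H Y) (fmor H X Y f) (Cmp D (fob F X) (fob G X) (fob H X) (\<theta> X) (\<eta> X))"
      if X: "X \<in> Ob C" and Y: "Y \<in> Ob C" and f: "f \<in> Hom C X Y" for X Y f
    proof -
      note m = functorD(2)[OF F X Y f] functorD(2)[OF G X Y f] functorD(2)[OF H X Y f]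
      have "Cmp D (fob F X) (fob F Y) (fob H Y) (Cmp D (fob F Y) (fob G Y) (fob H Y) (\<theta> Y) (\<eta> Y)) (fmor F X Y f)
          = Cmp D (fob F X) (fob G Y) (fob H Y) (\<theta> Y) (Cmp D (fob F X) (fob F Y) (fob G Y) (\<eta> Y) (fmor F X Y f))"
        by (rule cat_assoc[symmetric]) (use o X Y m \<eta>' \<theta>' in auto)
      also have "\<dots> = Cmp D (fob F X) (fob G Y) (fob H Y) (\<theta> Y) (Cmp D (fob F X) (fob G X) (fob G Y) (fmor G X Y f) (\<eta> X))"
        using \<eta> X Y f unfolding is_nat_trans_def by simp
      also have "\<dots> = Cmp D (fob F X) (fob G X) (fob H Y) (Cmp D (fob G X) (fob G Y) (fob H Y) (\<theta> Y) (fmor G X Y f)) (\<eta> X)"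
        by (rule cat_assoc) (use o X Y m \<eta>' \<theta>' in auto)
      also have "\<dots> = Cmp D (fob F X) (fob G X) (fob H Y) (Cmp D (fob G X) (fob H X) (fob H Y) (fmor H X Y f) (\<theta> X)) (\<eta> X)"
        using \<theta> X Y f unfolding is_nat_trans_def by simp
      also have "\<dots> = Cmp D (fob F X) (fob H X) (fob H Y) (fmor H X Y f) (Cmp D (fob F X) (fob G X) (fob H X) (\<theta> X) (\<eta> X))"
        by (rule cat_assoc[symmetric]) (use o X Y m \<eta>' \<theta>' in auto)
      finally show ?thesis .
    qed
    thus ?thesis unfolding is_nat_trans_def using cat_comp o \<eta>' \<theta>' by simp
  qed
  have idn: "is_nat_trans C D F F (\<lambda>X\<in>Ob C. Idn D (fob F X))" if F: "is_functor C D F" for F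
    unfolding is_nat_trans_def using functorD[OF F] cat_idn cat_id by simp
  have ids: "(\<lambda>X\<in>Ob C. Cmp D (fob F X) (fob F X) (fob G X) (\<eta> X) ((\<lambda>X\<in>Ob C. Idn D (fob F X)) X)) = \<eta>"
    "(\<lambda>X\<in>Ob C. Cmp D (fob F X) (fob G X) (fob G X) ((\<lambda>X\<in>Ob C. Idn D (fob G X)) X) (\<eta> X)) = \<eta>"
    if F: "is_functor C D F" and G: "is_functor C D G"
      and e: "\<eta> \<in> extensional (Ob C)" and \<eta>: "is_nat_trans C D F G \<eta>" for F G \<eta>
  proof -
    have \<eta>': "\<And>X. X \<in> Ob C \<Longrightarrow> \<eta> X \<in> Hom D (fob F X) (fob G X)"
      using \<eta> unfolding is_nat_trans_def by blast
    show "(\<lambda>X\<in>Ob C. Cmp D (fob F X) (fob F X) (fob G X) (\<eta> X) ((\<lambda>X\<in>Ob C. Idn D (fob F X)) X)) = \<eta>"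
      by (rule extensionalityI[OF _ e]) (use functorD[OF F] functorD[OF G] cat_id \<eta>' in auto)
    show "(\<lambda>X\<in>Ob C. Cmp D (fob F X) (fob G X) (fob G X) ((\<lambda>X\<in>Ob C. Idn D (fob G X)) X) (\<eta> X)) = \<eta>"
      by (rule extensionalityI[OF _ e]) (use functorD[OF F] functorD[OF G] cat_id \<eta>' in auto)
  qed
  have assoc: "(\<lambda>X\<in>Ob C. Cmp D (fob F X) (fob H X) (fob L X) (\<zeta> X)
        ((\<lambda>X\<in>Ob C. Cmp D (fob F X) (fob G X) (fob H X) (\<theta> X) (\<eta> X)) X)) =
      (\<lambda>X\<in>Ob C. Cmp D (fob F X) (fob G X) (fob L X)
        ((\<lambda>X\<in>Ob C. Cmp D (fob G X) (fob H X) (fob L X) (\<zeta> X) (\<theta> X)) X) (\<eta> X))"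
    if F: "is_functor C D F" and G: "is_functor C D G" and H: "is_functor C D H" and L: "is_functor C D L"
      and \<eta>: "is_nat_trans C D F G \<eta>" and \<theta>: "is_nat_trans C D G H \<theta>" and \<zeta>: "is_nat_trans C D H L \<zeta>"
    for F G H L \<eta> \<theta> \<zeta>
  proof (rule restrict_ext)
    fix X assume X: "X \<in> Ob C"
    have "\<eta> X \<in> Hom D (fob F X) (fob G X)" "\<theta> X \<in> Hom D (fob G X) (fob H X)" "\<zeta> X \<in> Hom D (fob H X) (fob L X)"
      using X \<eta> \<theta> \<zeta> unfolding is_nat_trans_def by blast+
    thus "Cmp D (fob F X) (fob H X) (fob L X) (\<zeta> X)
        ((\<lambda>X\<in>Ob C. Cmp D (fob F X) (fob G X) (fob H X) (\<theta> X) (\<eta> X)) X) =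
      Cmp D (fob F X) (fob G X) (fob L X)
        ((\<lambda>X\<in>Ob C. Cmp D (fob G X) (fob H X) (fob L X) (\<zeta> X) (\<theta> X)) X) (\<eta> X)"
      using X cat_assoc functorD(1)[OF F X] functorD(1)[OF G X] functorD(1)[OF H X] functorD(1)[OF L X] by simp
  qed
  show ?thesis
    unfolding is_category_def
  proof (intro conjI ballI)
    fix F assume "F \<in> Ob (func_cat C D)"
    thus "Idn (func_cat C D) F \<in> Hom (func_cat C D) F F" using idn by (simp add: func_cat_def)
  next
    fix F G H \<eta> \<theta> assume "F \<in> Ob (func_cat C D)" "G \<in> Ob (func_cat C D)" "H \<in> Ob (func_cat C D)"
      "\<eta> \<in> Hom (func_cat C D) F G" "\<theta> \<in> Hom (func_cat C D) G H"
    thus "Cmp (func_cat C D) F G H \<theta> \<eta> \<in> Hom (func_cat C D) F H" using comp by (simp add: func_cat_def)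
  next
    fix F G \<eta> assume "F \<in> Ob (func_cat C D)" "G \<in> Ob (func_cat C D)" "\<eta> \<in> Hom (func_cat C D) F G"
    thus "Cmp (func_cat C D) F F G \<eta> (Idn (func_cat C D) F) = \<eta>"
      "Cmp (func_cat C D) F G G (Idn (func_cat C D) G) \<eta> = \<eta>"
      using ids by (simp_all add: func_cat_def)
  next
    fix F G H L \<eta> \<theta> \<zeta> assume "F \<in> Ob (func_cat C D)" "G \<in> Ob (func_cat C D)" "H \<in> Ob (func_cat C D)"
      "L \<in> Ob (func_cat C D)"
      "\<eta> \<in> Hom (func_cat C D) F G" "\<theta> \<in> Hom (func_cat C D) G H" "\<zeta> \<in> Hom (func_cat C D) H L"
    thus "Cmp (func_cat C D) F H L \<zeta> (Cmp (func_cat C D) F G H \<theta> \<eta>) =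
       Cmp (func_cat C D) F G L (Cmp (func_cat C D) G H L \<zeta> \<theta>) \<eta>"
      using assoc by (simp add: func_cat_def)
  qed
qed

lemma nat_iso_inverse:
  assumes F: "is_functor C D F" and G: "is_functor C D G" and \<eta>: "is_nat_iso C D F G \<eta>"
  shows "\<exists>\<epsilon>. is_nat_iso C D G F \<epsilon>"
proof -
  have nat: "\<And>X. X \<in> Ob C \<Longrightarrow> \<eta> X \<in> Hom D (fob F X) (fob G X)"
    "\<And>X Y f. X \<in> Ob C \<Longrightarrow> Y \<in> Ob C \<Longrightarrow> f \<in> Hom C X Y \<Longrightarrow>
        Cmp D (fob F X) (fob F Y) (fob G Y) (\<eta> Y) (fmor F X Y f) =
        Cmp D (fob F X) (fob G X) (fob G Y) (fmor G X Y f) (\<eta> X)"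
    using \<eta> unfolding is_nat_iso_def is_nat_trans_def by blast+
  have "\<forall>X\<in>Ob C. \<exists>g. g \<in> Hom D (fob G X) (fob F X) \<and>
      Cmp D (fob F X) (fob G X) (fob F X) g (\<eta> X) = Idn D (fob F X) \<and>
      Cmp D (fob G X) (fob F X) (fob G X) (\<eta> X) g = Idn D (fob G X)"
    using \<eta> unfolding is_nat_iso_def is_isomorphism_def by blast
  from bchoice[OF this] obtain \<epsilon> where \<epsilon>: "\<And>X. X \<in> Ob C \<Longrightarrow> \<epsilon> X \<in> Hom D (fob G X) (fob F X)"
      "\<And>X. X \<in> Ob C \<Longrightarrow> Cmp D (fob F X) (fob G X) (fob F X) (\<epsilon> X) (\<eta> X) = Idn D (fob F X)"
      "\<And>X. X \<in> Ob C \<Longrightarrow> Cmp D (fob G X) (fob F X) (fob G X) (\<eta> X) (\<epsilon> X) = Idn D (fob G X)"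
    by blast
  note o = functorD(1)[OF F] functorD(1)[OF G]
  have "Cmp D (fob G X) (fob G Y) (fob F Y) (\<epsilon> Y) (fmor G X Y f) =
        Cmp D (fob G X) (fob F X) (fob F Y) (fmor F X Y f) (\<epsilon> X)"
    if X: "X \<in> Ob C" and Y: "Y \<in> Ob C" and f: "f \<in> Hom C X Y" for X Y f
  proof -
    note m = functorD(2)[OF F X Y f] functorD(2)[OF G X Y f]
    let ?FX = "fob F X" and ?FY = "fob F Y" and ?GX = "fob G X" and ?GY = "fob G Y"
    have "Cmp D ?GX ?GY ?FY (\<epsilon> Y) (fmor G X Y f)
       = Cmp D ?GX ?GY ?FY (\<epsilon> Y) (Cmp D ?GX ?GX ?GY (fmor G X Y f) (Cmp D ?GX ?FX ?GX (\<eta> X) (\<epsilon> X)))"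
      using \<epsilon>(3)[OF X] cat_id(1) o X Y m by simp
    also have "\<dots> = Cmp D ?GX ?GY ?FY (\<epsilon> Y) (Cmp D ?GX ?FX ?GY (Cmp D ?FX ?GX ?GY (fmor G X Y f) (\<eta> X)) (\<epsilon> X))"
      using cat_assoc[of ?GX ?FX ?GX ?GY] o X Y m nat(1) \<epsilon>(1) by simp
    also have "\<dots> = Cmp D ?GX ?GY ?FY (\<epsilon> Y) (Cmp D ?GX ?FX ?GY (Cmp D ?FX ?FY ?GY (\<eta> Y) (fmor F X Y f)) (\<epsilon> X))"
      using nat(2)[OF X Y f] by simp
    also have "\<dots> = Cmp D ?GX ?FX ?FY (Cmp D ?FX ?GY ?FY (\<epsilon> Y) (Cmp D ?FX ?FY ?GY (\<eta> Y) (fmor F X Y f))) (\<epsilon> X)"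
      by (rule cat_assoc) (use o X Y m nat(1) \<epsilon>(1) cat_comp in auto)
    also have "\<dots> = Cmp D ?GX ?FX ?FY (Cmp D ?FX ?FY ?FY (Cmp D ?FY ?GY ?FY (\<epsilon> Y) (\<eta> Y)) (fmor F X Y f)) (\<epsilon> X)"
      using cat_assoc[of ?FX ?FY ?GY ?FY] o X Y m nat(1) \<epsilon>(1) by simp
    also have "\<dots> = Cmp D ?GX ?FX ?FY (fmor F X Y f) (\<epsilon> X)"
      using \<epsilon>(2)[OF Y] cat_id(2) o X Y m by simp
    finally show ?thesis .
  qed
  hence "is_nat_iso C D G F \<epsilon>"
    unfolding is_nat_iso_def is_nat_trans_def is_isomorphism_def using \<epsilon> nat(1) by blast
  thus ?thesis by blast
qed

end

lemma is_functor_id: "is_functor C C id_func"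
  unfolding is_functor_def id_func_def by simp

lemma is_functor_comp: "is_functor C D F \<Longrightarrow> is_functor D E G \<Longrightarrow> is_functor C E (comp_func G F)"
  unfolding is_functor_def comp_func_def by simp

text \<open>
  The componentwise inverses of a natural family of bijections are again natural.
\<close>

lemma set_valued_isoI:
  assumes F: "is_functor C set_cat F" and G: "is_functor C set_cat G"
    and \<eta>: "\<eta> \<in> Hom (func_cat C set_cat) F G"
    and bij: "\<And>X. X \<in> Ob C \<Longrightarrow> bij_betw (\<eta> X) (fob F X) (fob G X)"
  shows "is_isomorphism (func_cat C set_cat) F G \<eta>"
proof -
  define \<theta> where "\<theta> = (\<lambda>X\<in>Ob C. \<lambda>y\<in>fob G X. inv_into (fob F X) (\<eta> X) y)"
  have \<theta>_in: "\<theta> X y \<in> fob F X" "\<eta> X (\<theta> X y) = y" if "X \<in> Ob C" "y \<in> fob G X" for X y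
    using that bij[OF that(1)] unfolding \<theta>_def bij_betw_def
    by (simp_all add: inv_into_into f_inv_into_f)
  have \<theta>\<eta>: "\<theta> X (\<eta> X x) = x" if "X \<in> Ob C" "x \<in> fob F X" for X x
    using that bij[OF that(1)] bij_betwE[OF bij[OF that(1)]] unfolding \<theta>_def bij_betw_def by simp
  have \<eta>_in: "\<eta> X x \<in> fob G X" if "X \<in> Ob C" "x \<in> fob F X" for X x
    using bij_betwE[OF bij[OF that(1)]] that(2) by blast
  have Fm: "fmor F X Y f x \<in> fob F Y" if "X \<in> Ob C" "Y \<in> Ob C" "f \<in> Hom C X Y" "x \<in> fob F X" for X Y f x
    using functorD(2)[OF is_category_set_cat F that(1-3)] that(4) by (auto simp: set_cat_def)
  have Gm: "fmor G X Y f x \<in> fob G Y" if "X \<in> Ob C" "Y \<in> Ob C" "f \<in> Hom C X Y" "x \<in> fob G X" for X Y f x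
    using functorD(2)[OF is_category_set_cat G that(1-3)] that(4) by (auto simp: set_cat_def)
  have nat: "\<eta> Y (fmor F X Y f x) = fmor G X Y f (\<eta> X x)"
    if "X \<in> Ob C" "Y \<in> Ob C" "f \<in> Hom C X Y" "x \<in> fob F X" for X Y f x
  proof -
    have "compose (fob F X) (\<eta> Y) (fmor F X Y f) = compose (fob F X) (fmor G X Y f) (\<eta> X)"
      using \<eta> that(1-3) unfolding func_cat_def is_nat_trans_def set_cat_def by simp
    from fun_cong[OF this, of x] show ?thesis using that(4) by (simp add: compose_eq)
  qed
  have "compose (fob G X) (\<theta> Y) (fmor G X Y f) = compose (fob G X) (fmor F X Y f) (\<theta> X)"
    if XY: "X \<in> Ob C" "Y \<in> Ob C" "f \<in> Hom C X Y" for X Y f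
    unfolding compose_def
  proof (rule restrict_ext)
    fix y assume y: "y \<in> fob G X"
    have "fmor G X Y f y = \<eta> Y (fmor F X Y f (\<theta> X y))"
      using nat[OF XY \<theta>_in(1)[OF XY(1) y]] \<theta>_in(2)[OF XY(1) y] by simp
    thus "\<theta> Y (fmor G X Y f y) = fmor F X Y f (\<theta> X y)"
      using \<theta>\<eta>[OF XY(2) Fm[OF XY \<theta>_in(1)[OF XY(1) y]]] by simp
  qed
  moreover have "\<theta> X \<in> fob G X \<rightarrow>\<^sub>E fob F X" if "X \<in> Ob C" for X
    using \<theta>_in(1)[OF that] that unfolding \<theta>_def by auto
  ultimately have "\<theta> \<in> Hom (func_cat C set_cat) G F"
    unfolding func_cat_def is_nat_trans_def set_cat_def by (simp add: \<theta>_def)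
  moreover have "Cmp (func_cat C set_cat) F G F \<theta> \<eta> = Idn (func_cat C set_cat) F"
    unfolding func_cat_def set_cat_def compose_def using \<theta>\<eta> by (auto intro!: restrict_ext)
  moreover have "Cmp (func_cat C set_cat) G F G \<eta> \<theta> = Idn (func_cat C set_cat) G"
    unfolding func_cat_def set_cat_def compose_def using \<theta>_in(2) by (auto intro!: restrict_ext)
  ultimately show ?thesis unfolding is_isomorphism_def using \<eta> by blast
qed

section \<open>The categories of bundles and of sheaves\<close>

context base_lps
begin

definition bundle_map :: "'w lps \<Rightarrow> ('w \<Rightarrow> 'a) \<Rightarrow> 'v lps \<Rightarrow> ('v \<Rightarrow> 'a) \<Rightarrow> ('w \<Rightarrow> 'v) \<Rightarrow> bool" where
  "bundle_map W p W' p' \<theta> \<longleftrightarrow> (\<forall>w\<in>topspace (fst W). dimap_at W W' \<theta> w \<and> p' (\<theta> w) = p w)"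

lemma bundle_mapD:
  assumes "bundle_map W p W' p' \<theta>" "w \<in> topspace (fst W)"
  shows "dimap_at W W' \<theta> w" "p' (\<theta> w) = p w" "\<theta> w \<in> topspace (fst W')"
  using assms dimap_at_topspace(2)[of W W' \<theta> w] unfolding bundle_map_def by auto

lemma bundle_map_cong:
  assumes "\<And>w. w \<in> topspace (fst W) \<Longrightarrow> \<theta> w = \<theta>' w" "bundle_map W p W' p' \<theta>"
  shows "bundle_map W p W' p' \<theta>'"
  unfolding bundle_map_def
proof (intro ballI conjI)
  fix w assume w: "w \<in> topspace (fst W)"
  show "dimap_at W W' \<theta>' w"
    by (rule dimap_at_cong[OF bundle_mapD(1)[OF assms(2) w] openin_topspace w assms(1)])
  show "p' (\<theta>' w) = p w" using bundle_mapD(2)[OF assms(2) w] assms(1)[OF w] by simp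
qed

lemma bundle_map_continuous:
  assumes "bundle_map W p W' p' \<theta>"
  shows "continuous_map (fst W) (fst W') \<theta>"
  by (rule continuous_map_locally)
     (use bundle_mapD(1)[OF assms] in \<open>unfold dimap_at_def, blast\<close>)

lemma bundle_map_compose:
  assumes f: "bundle_map W p W' p' f" and g: "bundle_map W' p' W'' p'' g"
  shows "bundle_map W p W'' p'' (compose (topspace (fst W)) g f)"
proof (rule bundle_map_cong)
  show "bundle_map W p W'' p'' (\<lambda>w. g (f w))"
    unfolding bundle_map_def
  proof (intro ballI conjI)
    fix w assume w: "w \<in> topspace (fst W)"
    note fw = bundle_mapD[OF f w]
    note gw = bundle_mapD[OF g fw(3)]
    show "dimap_at W W'' (\<lambda>w. g (f w)) w" by (rule dimap_at_compose[OF fw(1) gw(1)])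
    show "p'' (g (f w)) = p w" using fw(2) gw(2) by simp
  qed
qed (simp add: compose_eq)

lemma bundle_map_section:
  assumes "etale Z W p" "etale Z W' p'" "bundle_map W p W' p' \<theta>" "op U" "s \<in> sections Z (W, p) U"
  shows "compose U \<theta> s \<in> sections Z (W', p') U"
  using section_compose[OF etaleD(1)[OF assms(1)] etaleD(1)[OF assms(2)] assms(4,5)] assms(3)
  unfolding bundle_map_def by blast

lemma Etale_Ob: "(W, p) \<in> Ob (Etale K Z) \<longleftrightarrow> W \<in> LPS K \<and> etale Z W p"
  by (auto simp: Etale_def etale_def intro: LPS_mono)

lemma Etale_Hom:
  assumes "etale Z W p" "etale Z W' p'"
  shows "\<theta> \<in> Hom (Etale K Z) (W, p) (W', p') \<longleftrightarrow>
    \<theta> \<in> extensional (topspace (fst W)) \<and> bundle_map W p W' p' \<theta>"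
  unfolding Etale_def lps_hom_def bundle_map_def
  by (auto simp: dimap_iff[OF etaleD(1)[OF assms(1)] etaleD(1)[OF assms(2)]])

lemma Etale_Idn: "Idn (Etale K Z) (W, p) = (\<lambda>w\<in>topspace (fst W). w)"
  by (simp add: Etale_def)

lemma Etale_Cmp: "Cmp (Etale K Z) (W, p) Y X g f = compose (topspace (fst W)) g f"
  by (simp add: Etale_def)

lemma bundle_map_id: "bundle_map W p W p (\<lambda>w\<in>topspace (fst W). w)"
proof (rule bundle_map_cong)
  show "bundle_map W p W p (\<lambda>w. w)" 
    unfolding bundle_map_def by (intro ballI conjI refl dimap_at_id)
qed simp

lemma is_category_Etale: "is_category (Etale K Z)"
  unfolding is_category_def
proof (intro conjI ballI)
  fix E assume E: "E \<in> Ob (Etale K Z)"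
  obtain W p where [simp]: "E = (W, p)" by (cases E)
  have e: "etale Z W p" using E by (simp add: Etale_Ob)
  show "Idn (Etale K Z) E \<in> Hom (Etale K Z) E E"
    using bundle_map_id by (simp add: Etale_Hom[OF e e] Etale_Idn)
next
  fix E E' E'' f g assume E: "E \<in> Ob (Etale K Z)" "E' \<in> Ob (Etale K Z)" "E'' \<in> Ob (Etale K Z)"
    and f: "f \<in> Hom (Etale K Z) E E'" and g: "g \<in> Hom (Etale K Z) E' E''"
  obtain W p where [simp]: "E = (W, p)" by (cases E)
  obtain W' p' where [simp]: "E' = (W', p')" by (cases E')
  obtain W'' p'' where [simp]: "E'' = (W'', p'')" by (cases E'')
  have e: "etale Z W p" "etale Z W' p'" "etale Z W'' p''" using E by (simp_all add: Etale_Ob)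
  show "Cmp (Etale K Z) E E' E'' g f \<in> Hom (Etale K Z) E E''"
    using f g bundle_map_compose[of W p W' p' f W'' p'' g]
    by (simp add: Etale_Hom[OF e(1,2)] Etale_Hom[OF e(2,3)] Etale_Hom[OF e(1,3)] Etale_Cmp)
next
  fix E E' f assume E: "E \<in> Ob (Etale K Z)" "E' \<in> Ob (Etale K Z)" and f: "f \<in> Hom (Etale K Z) E E'"
  obtain W p where [simp]: "E = (W, p)" by (cases E)
  obtain W' p' where [simp]: "E' = (W', p')" by (cases E')
  have e: "etale Z W p" "etale Z W' p'" using E by (simp_all add: Etale_Ob)
  have f': "f \<in> extensional (topspace (fst W))" "bundle_map W p W' p' f"
    using f by (simp_all add: Etale_Hom[OF e])
  show "Cmp (Etale K Z) E E E' f (Idn (Etale K Z) E) = f"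
    by (simp add: Etale_Cmp Etale_Idn, rule extensionalityI[OF _ f'(1)])
       (auto simp: compose_eq compose_extensional)
  show "Cmp (Etale K Z) E E' E' (Idn (Etale K Z) E') f = f"
    by (simp add: Etale_Cmp Etale_Idn, rule extensionalityI[OF _ f'(1)])
       (use bundle_mapD(3)[OF f'(2)] in \<open>auto simp: compose_eq\<close>)
next
  fix E E' E'' E''' f g h assume E: "E \<in> Ob (Etale K Z)" "E' \<in> Ob (Etale K Z)" 
    and f: "f \<in> Hom (Etale K Z) E E'"
  obtain W p where [simp]: "E = (W, p)" by (cases E)
  obtain W' p' where [simp]: "E' = (W', p')" by (cases E')
  have e: "etale Z W p" "etale Z W' p'" using E by (simp_all add: Etale_Ob)
  have f': "bundle_map W p W' p' f" using f by (simp add: Etale_Hom[OF e])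
  show "Cmp (Etale K Z) E E'' E''' h (Cmp (Etale K Z) E E' E'' g f) =
       Cmp (Etale K Z) E E' E''' (Cmp (Etale K Z) E' E'' E''' h g) f"
    using bundle_mapD(3)[OF f'] by (auto simp: Etale_Cmp compose_def intro!: restrict_ext)
qed

text \<open>
  The image of a section \<open>s\<close> through the preimage of \<open>w'\<close> is a section through \<open>w'\<close>, and the
  inverse of \<open>\<theta>\<close> sends it back to \<open>s\<close>. So the inverse preserves sections, which suffices for a
  bundle map.
\<close>

lemma bundle_map_inverse:
  assumes e: "etale Z W p" and e': "etale Z W' p'" and \<theta>: "bundle_map W p W' p' \<theta>"
    and bij: "bij_betw \<theta> (topspace (fst W)) (topspace (fst W'))"
  shows "bundle_map W' p' W p (inv_into (topspace (fst W)) \<theta>)"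
  unfolding bundle_map_def
proof
  let ?i = "inv_into (topspace (fst W)) \<theta>"
  fix w' assume w': "w' \<in> topspace (fst W')"
  have w: "?i w' \<in> topspace (fst W)" "\<theta> (?i w') = w'"
    using bij w' unfolding bij_betw_def by (auto simp: inv_into_into f_inv_into_f)
  obtain U s where U: "op U" and s: "s \<in> sections Z (W, p) U" and "p (?i w') \<in> U" "s (p (?i w')) = ?i w'"
    using section_through[OF e w(1)] .
  hence mem: "w' \<in> compose U \<theta> s ` U" using w(2) by (intro image_eqI[of _ _ "p (?i w')"]) (auto simp: compose_eq)
  have \<theta>s: "compose U \<theta> s \<in> sections Z (W', p') U" by (rule bundle_map_section[OF e e' \<theta> U s])
  have "compose U ?i (compose U \<theta> s) = s"
  proof (rule extensionalityI[of _ U])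
    show "s \<in> extensional U" using s unfolding sections_iff[OF etaleD(1)[OF e] U] by blast
    fix x assume x: "x \<in> U"
    have "s x \<in> topspace (fst W)" using section_topspace[OF etaleD(1)[OF e] U s x] .
    thus "compose U ?i (compose U \<theta> s) x = s x"
      using x bij unfolding bij_betw_def by (simp add: compose_eq)
  qed (rule compose_extensional)
  hence "compose U ?i (compose U \<theta> s) \<in> sections Z (W, p) U" using s by simp
  from bundle_map_by_sections[OF e' e w' U \<theta>s mem this]
  show "dimap_at W' W ?i w' \<and> p (?i w') = p' w'" by blast
qed

lemma bundle_map_homeomorphism:
  assumes e: "etale Z W p" and e': "etale Z W' p'" and \<theta>: "bundle_map W p W' p' \<theta>"
    and bij: "bij_betw \<theta> (topspace (fst W)) (topspace (fst W'))"
  shows "fst W homeomorphic_space fst W'"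
proof -
  let ?i = "inv_into (topspace (fst W)) \<theta>"
  have "continuous_map (fst W) (fst W') \<theta>"
    by (rule bundle_map_continuous[OF \<theta>])
  moreover have "continuous_map (fst W') (fst W) ?i"
    by (rule bundle_map_continuous[OF bundle_map_inverse[OF assms]])
  ultimately have "homeomorphic_maps (fst W) (fst W') \<theta> ?i"
    using bij unfolding homeomorphic_maps_def bij_betw_def by (simp add: f_inv_into_f)
  thus ?thesis unfolding homeomorphic_space_def by blast
qed

lemma is_isomorphism_Etale:
  assumes E: "(W, p) \<in> Ob (Etale K Z)" "(W', p') \<in> Ob (Etale K Z)"
    and ext: "\<theta> \<in> extensional (topspace (fst W))" and \<theta>: "bundle_map W p W' p' \<theta>"
    and bij: "bij_betw \<theta> (topspace (fst W)) (topspace (fst W'))"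
  shows "is_isomorphism (Etale K Z) (W, p) (W', p') \<theta>"
proof -
  have e: "etale Z W p" "etale Z W' p'" using E by (simp_all add: Etale_Ob)
  let ?i = "inv_into (topspace (fst W)) \<theta>"
  let ?g = "restrict ?i (topspace (fst W'))"
  have "bundle_map W' p' W p ?g"
    by (rule bundle_map_cong[OF _ bundle_map_inverse[OF e \<theta> bij]]) simp
  hence "?g \<in> Hom (Etale K Z) (W', p') (W, p)" by (simp add: Etale_Hom[OF e(2,1)])
  moreover have "\<theta> \<in> Hom (Etale K Z) (W, p) (W', p')" using ext \<theta> by (simp add: Etale_Hom[OF e])
  moreover have "compose (topspace (fst W)) ?g \<theta> = (\<lambda>w\<in>topspace (fst W). w)"
    unfolding compose_def using bij bij_betwE[OF bij] unfolding bij_betw_def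
    by (intro restrict_ext) simp
  moreover have "compose (topspace (fst W')) \<theta> ?g = (\<lambda>w\<in>topspace (fst W'). w)"
    unfolding compose_def using bij unfolding bij_betw_def
    by (intro restrict_ext) (simp add: f_inv_into_f)
  ultimately show ?thesis unfolding is_isomorphism_def by (auto simp: Etale_Cmp Etale_Idn)
qed

lemma Opens_simps: "Ob (op_cat (Opens Z)) = {U. op U}"
  "i \<in> Hom (op_cat (Opens Z)) U V \<longleftrightarrow> V \<subseteq> U \<and> i = (\<lambda>x\<in>V. x)"
  "Idn (op_cat (Opens Z)) U = (\<lambda>x\<in>U. x)"
  "Cmp (op_cat (Opens Z)) U V N g f = compose N f g"
  by (auto simp: op_cat_def Opens_def)

text \<open>
  For each inclusion of open sets there is only one morphism, so naturality is compatibility with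
  restriction.
\<close>

lemma nat_trans_iff:
  "is_nat_trans (op_cat (Opens Z)) set_cat P Q \<eta> \<longleftrightarrow>
    (\<forall>U. op U \<longrightarrow> \<eta> U \<in> fob P U \<rightarrow>\<^sub>E fob Q U) \<and>
    (\<forall>U V s. op U \<longrightarrow> op V \<longrightarrow> V \<subseteq> U \<longrightarrow> s \<in> fob P U \<longrightarrow> \<eta> V (restr P U V s) = restr Q U V (\<eta> U s))"
proof -
  have "compose (fob P U) (\<eta> V) (fmor P U V (\<lambda>x\<in>V. x)) = compose (fob P U) (fmor Q U V (\<lambda>x\<in>V. x)) (\<eta> U)
     \<longleftrightarrow> (\<forall>s\<in>fob P U. \<eta> V (restr P U V s) = restr Q U V (\<eta> U s))" for U V
  proof
    assume eq: "compose (fob P U) (\<eta> V) (fmor P U V (\<lambda>x\<in>V. x)) = compose (fob P U) (fmor Q U V (\<lambda>x\<in>V. x)) (\<eta> U)"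
    show "\<forall>s\<in>fob P U. \<eta> V (restr P U V s) = restr Q U V (\<eta> U s)"
    proof
      fix s assume "s \<in> fob P U"
      thus "\<eta> V (restr P U V s) = restr Q U V (\<eta> U s)"
        using fun_cong[OF eq, of s] by (simp add: restr_def compose_eq)
    qed
  next
    assume "\<forall>s\<in>fob P U. \<eta> V (restr P U V s) = restr Q U V (\<eta> U s)"
    thus "compose (fob P U) (\<eta> V) (fmor P U V (\<lambda>x\<in>V. x)) = compose (fob P U) (fmor Q U V (\<lambda>x\<in>V. x)) (\<eta> U)"
      unfolding restr_def compose_def by (intro restrict_ext) simp
  qed
  moreover have "is_nat_trans (op_cat (Opens Z)) set_cat P Q \<eta> \<longleftrightarrow>
    (\<forall>U. op U \<longrightarrow> \<eta> U \<in> fob P U \<rightarrow>\<^sub>E fob Q U) \<and>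
    (\<forall>U V. op U \<longrightarrow> op V \<longrightarrow> V \<subseteq> U \<longrightarrow>
       compose (fob P U) (\<eta> V) (fmor P U V (\<lambda>x\<in>V. x)) = compose (fob P U) (fmor Q U V (\<lambda>x\<in>V. x)) (\<eta> U))"
    unfolding is_nat_trans_def Opens_simps(1) Ball_def mem_Collect_eq Opens_simps(2)
    by (auto simp: set_cat_def)
  ultimately show ?thesis by simp blast
qed

lemma Shv_Ob:
  "P \<in> Ob (Shv_in K Z) \<longleftrightarrow> presheaf P \<and> sheaf_condition Z P \<and> (\<exists>M\<in>K. germ_top Z P homeomorphic_space M)"
  by (auto simp: Shv_in_def Shv_def full_subcat_def func_cat_def)

lemma Shv_Hom:
  "\<eta> \<in> Hom (Shv_in K Z) P Q \<longleftrightarrow>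
     \<eta> \<in> extensional {U. op U} \<and> is_nat_trans (op_cat (Opens Z)) set_cat P Q \<eta>"
  by (simp add: Shv_in_def Shv_def full_subcat_def func_cat_def Opens_simps)

lemma Shv_Idn: "Idn (Shv_in K Z) P = (\<lambda>U\<in>{U. op U}. \<lambda>s\<in>fob P U. s)"
  by (simp add: Shv_in_def Shv_def full_subcat_def func_cat_def Opens_simps set_cat_def)

lemma Shv_Cmp: "Cmp (Shv_in K Z) P Q R \<theta> \<eta> = (\<lambda>U\<in>{U. op U}. compose (fob P U) (\<theta> U) (\<eta> U))"
  by (simp add: Shv_in_def Shv_def full_subcat_def func_cat_def Opens_simps set_cat_def)

lemma is_category_Shv: "is_category (Shv_in K Z)"
  unfolding Shv_in_def Shv_def
  by (intro is_category_full_subcat is_category_func_cat is_category_set_cat)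

lemma is_isomorphism_Shv:
  assumes "P \<in> Ob (Shv_in K Z)" "Q \<in> Ob (Shv_in K Z)" "\<eta> \<in> Hom (Shv_in K Z) P Q"
    and "\<And>U. op U \<Longrightarrow> bij_betw (\<eta> U) (fob P U) (fob Q U)"
  shows "is_isomorphism (Shv_in K Z) P Q \<eta>"
proof -
  have "presheaf P" "presheaf Q" using assms(1,2) by (simp_all add: Shv_Ob)
  moreover have "\<eta> \<in> Hom (func_cat (op_cat (Opens Z)) set_cat) P Q"
    using assms(3) by (simp add: Shv_in_def Shv_def full_subcat_def)
  ultimately have "is_isomorphism (func_cat (op_cat (Opens Z)) set_cat) P Q \<eta>"
    by (rule set_valued_isoI) (use assms(4) in \<open>simp add: Opens_simps\<close>)
  thus ?thesis by (simp add: is_isomorphism_def Shv_in_def Shv_def full_subcat_def)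
qed

section \<open>The functor of cross-sections\<close>

lemma \<Gamma>_fob [simp]: "fob (fob (\<Gamma> Z) E) U = sections Z E U"
  by (simp add: \<Gamma>_def)

lemma restr_\<Gamma>:
  assumes "s \<in> sections Z E U"
  shows "restr (fob (\<Gamma> Z) E) U V s = restrict s V"
  using assms by (auto simp: restr_def \<Gamma>_def compose_def intro!: restrict_ext)

lemma presheaf_\<Gamma>:
  assumes W: "W \<in> LPS UNIV"
  shows "presheaf (fob (\<Gamma> Z) (W, p))"
  unfolding is_functor_def Opens_simps mem_Collect_eq
proof (intro conjI allI ballI impI)
  let ?P = "fob (\<Gamma> Z) (W, p)"
  have m: "fmor ?P U V i = (\<lambda>s\<in>sections Z (W, p) U. compose V s i)" for U V i by (simp add: \<Gamma>_def)
  fix U assume "U \<in> {U. op U}"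
  hence U: "op U" by simp
  show "fob ?P U \<in> Ob set_cat" by (simp add: set_cat_def)
  have "compose U s (\<lambda>x\<in>U. x) = s" if "s \<in> sections Z (W, p) U" for s
    by (rule extensionalityI[OF compose_extensional])
       (use that in \<open>auto simp: sections_iff[OF W U] compose_eq\<close>)
  thus "fmor ?P U U (\<lambda>x\<in>U. x) = Idn set_cat (fob ?P U)"
    unfolding m set_cat_def by (auto intro!: restrict_ext)
next
  let ?P = "fob (\<Gamma> Z) (W, p)"
  have m: "fmor ?P U V i = (\<lambda>s\<in>sections Z (W, p) U. compose V s i)" for U V i by (simp add: \<Gamma>_def)
  fix U V i assume "U \<in> {U. op U}" "V \<in> {U. op U}" and i: "i \<in> Hom (op_cat (Opens Z)) U V"
  hence U: "op U" "op V" "V \<subseteq> U" "i = (\<lambda>x\<in>V. x)" by (auto simp: Opens_simps)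
  have r: "compose V s i = restrict s V" for s
    unfolding U(4) compose_def by (rule restrict_ext) simp
  show "fmor ?P U V i \<in> Hom set_cat (fob ?P U) (fob ?P V)"
    unfolding m set_cat_def r using section_restrict[OF W U(1) _ U(2,3)] by auto
next
  let ?P = "fob (\<Gamma> Z) (W, p)"
  have m: "fmor ?P U V i = (\<lambda>s\<in>sections Z (W, p) U. compose V s i)" for U V i by (simp add: \<Gamma>_def)
  fix U V N i j assume "U \<in> {U. op U}" "V \<in> {U. op U}" "N \<in> {U. op U}"
    and "i \<in> Hom (op_cat (Opens Z)) U V" "j \<in> Hom (op_cat (Opens Z)) V N"
  hence U: "op U" "op V" "V \<subseteq> U" "i = (\<lambda>x\<in>V. x)" and N: "op N" "N \<subseteq> V" "j = (\<lambda>x\<in>N. x)"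
    by (auto simp: Opens_simps)
  have r: "compose V s i = restrict s V" for s
    unfolding U(4) compose_def by (rule restrict_ext) simp
  have cc: "compose N s (compose N i j) = compose N (restrict s V) j" for s
    unfolding U(4) N(3) compose_def using N(2) by (intro restrict_ext) auto
  have "(\<lambda>s\<in>sections Z (W, p) U. compose N s (compose N i j)) =
     compose (sections Z (W, p) U) (\<lambda>s\<in>sections Z (W, p) V. compose N s j)
       (\<lambda>s\<in>sections Z (W, p) U. compose V s i)"
    unfolding compose_def[of "sections Z (W, p) U"] r cc
    by (rule restrict_ext) (use section_restrict[OF W U(1) _ U(2,3)] in simp)
  thus "fmor ?P U N (compose N i j) =
     Cmp set_cat (fob ?P U) (fob ?P V) (fob ?P N) (fmor ?P V N j) (fmor ?P U V i)"
    unfolding m by (simp add: set_cat_def)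
qed

text \<open>
  A function glued from sections agrees near each point with one of them, and the conditions on a
  section are local.
\<close>

lemma sheaf_\<Gamma>:
  assumes W: "W \<in> LPS UNIV"
  shows "sheaf_condition Z (fob (\<Gamma> Z) (W, p))"
  unfolding sheaf_condition_def
proof (intro allI impI)
  let ?P = "fob (\<Gamma> Z) (W, p)"
  fix \<V> s assume "(\<forall>V\<in>\<V>. op V) \<and> (\<forall>V\<in>\<V>. s V \<in> fob ?P V) \<and>
        (\<forall>V\<in>\<V>. \<forall>V'\<in>\<V>. restr ?P V (V \<inter> V') (s V) = restr ?P V' (V \<inter> V') (s V'))"
  hence V: "\<And>V. V \<in> \<V> \<Longrightarrow> op V" and s: "\<And>V. V \<in> \<V> \<Longrightarrow> s V \<in> sections Z (W, p) V"
    and eq: "\<And>V V'. V \<in> \<V> \<Longrightarrow> V' \<in> \<V> \<Longrightarrow> restrict (s V) (V \<inter> V') = restrict (s V') (V \<inter> V')"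
    by (auto simp: restr_\<Gamma>)
  have agree: "s V x = s V' x" if "V \<in> \<V>" "V' \<in> \<V>" "x \<in> V" "x \<in> V'" for V V' x
    using fun_cong[OF eq[OF that(1,2)], of x] that by simp
  let ?U = "\<Union>\<V>"
  have U: "op ?U" using V by blast
  define t where "t = (\<lambda>x\<in>?U. s (SOME V. V \<in> \<V> \<and> x \<in> V) x)"
  have t: "t x = s V x" if "V \<in> \<V>" "x \<in> V" for V x
  proof -
    have V': "(SOME V. V \<in> \<V> \<and> x \<in> V) \<in> \<V> \<and> x \<in> (SOME V. V \<in> \<V> \<and> x \<in> V)"
      by (rule someI[of _ V]) (use that in blast)
    have "x \<in> ?U" using that by blast
    hence "t x = s (SOME V. V \<in> \<V> \<and> x \<in> V) x" unfolding t_def by (rule restrict_apply')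
    also have "\<dots> = s V x" using agree[OF conjunct1[OF V'] that(1) conjunct2[OF V'] that(2)] .
    finally show ?thesis .
  qed
  have t_ext: "t \<in> extensional ?U" unfolding t_def by simp
  have "dimap_at Z W t x \<and> p (t x) = x" if x: "x \<in> ?U" for x
  proof -
    obtain N where N: "N \<in> \<V>" "x \<in> N" using x by blast
    have sN: "dimap_at Z W (s N) x" "p (s N x) = x"
      using s[OF N(1)] N(2) unfolding sections_iff[OF W V[OF N(1)]] by auto
    have "dimap_at Z W t x" by (rule dimap_at_cong[OF sN(1) V[OF N(1)] N(2)]) (simp add: t[OF N(1)])
    thus ?thesis using sN(2) t[OF N] by simp
  qed
  hence t_sec: "t \<in> sections Z (W, p) ?U" unfolding sections_iff[OF W U] using t_ext by blast
  show "\<exists>!t. t \<in> fob ?P ?U \<and> (\<forall>V\<in>\<V>. restr ?P ?U V t = s V)"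
  proof (rule ex1I[of _ t])
    have "restrict t V = s V" if "V \<in> \<V>" for V
      by (rule extensionalityI[of _ V])
         (use t[OF that] s[OF that] in \<open>auto simp: sections_iff[OF W V[OF that]]\<close>)
    thus "t \<in> fob ?P ?U \<and> (\<forall>V\<in>\<V>. restr ?P ?U V t = s V)" using t_sec by (simp add: restr_\<Gamma>)
    fix r assume r: "r \<in> fob ?P ?U \<and> (\<forall>V\<in>\<V>. restr ?P ?U V r = s V)"
    hence r': "r \<in> sections Z (W, p) ?U" "\<And>V. V \<in> \<V> \<Longrightarrow> restrict r V = s V" by (auto simp: restr_\<Gamma>)
    show "r = t"
    proof (rule extensionalityI[OF _ t_ext])
      show "r \<in> extensional ?U" using r'(1) unfolding sections_iff[OF W U] by blast
      fix x assume "x \<in> ?U"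
      then obtain V where V: "V \<in> \<V>" "x \<in> V" by blast
      show "r x = t x" using fun_cong[OF r'(2)[OF V(1)], of x] t[OF V] V(2) by simp
    qed
  qed
qed

lemma \<Gamma>_fmor:
  "fmor (\<Gamma> Z) E E' \<theta> = (\<lambda>U\<in>{U. op U}. \<lambda>s\<in>sections Z E U. compose U \<theta> s)"
  by (simp add: \<Gamma>_def)

lemma \<Gamma>_Hom:
  assumes e: "etale Z W p" and e': "etale Z W' p'" and \<theta>: "bundle_map W p W' p' \<theta>"
  shows "fmor (\<Gamma> Z) (W, p) (W', p') \<theta> \<in> Hom (Shv_in K Z) (fob (\<Gamma> Z) (W, p)) (fob (\<Gamma> Z) (W', p'))"
  unfolding Shv_Hom nat_trans_iff \<Gamma>_fob
proof (intro conjI allI impI)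
  note W = etaleD(1)[OF e]
  note c = bundle_map_section[OF e e' \<theta>]
  show "fmor (\<Gamma> Z) (W, p) (W', p') \<theta> \<in> extensional {U. op U}" unfolding \<Gamma>_fmor by simp
  show "fmor (\<Gamma> Z) (W, p) (W', p') \<theta> U \<in> sections Z (W, p) U \<rightarrow>\<^sub>E sections Z (W', p') U" if "op U" for U
    unfolding \<Gamma>_fmor using c that by auto
  fix U V s assume U: "op U" and V: "op V" "V \<subseteq> U" and s: "s \<in> sections Z (W, p) U"
  have "compose V \<theta> (restrict s V) = restrict (compose U \<theta> s) V"
    unfolding compose_def using V(2) by (intro restrict_ext) auto
  thus "fmor (\<Gamma> Z) (W, p) (W', p') \<theta> V (restr (fob (\<Gamma> Z) (W, p)) U V s) =
      restr (fob (\<Gamma> Z) (W', p')) U V (fmor (\<Gamma> Z) (W, p) (W', p') \<theta> U s)"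
    using U V s c[OF U s] section_restrict[OF W U s V] by (simp add: \<Gamma>_fmor restr_\<Gamma>)
qed


lemma \<Gamma>_Idn:
  assumes e: "etale Z W p"
  shows "fmor (\<Gamma> Z) (W, p) (W, p) (\<lambda>w\<in>topspace (fst W). w) = Idn (Shv_in K Z) (fob (\<Gamma> Z) (W, p))"
  unfolding \<Gamma>_fmor Shv_Idn \<Gamma>_fob
proof (intro restrict_ext)
  fix U s assume "U \<in> {U. op U}" and s: "s \<in> sections Z (W, p) U"
  hence U: "op U" by simp
  show "compose U (\<lambda>w\<in>topspace (fst W). w) s = s"
  proof (rule extensionalityI[OF compose_extensional])
    show "s \<in> extensional U" using s unfolding sections_iff[OF etaleD(1)[OF e] U] by blast
  qed (use section_topspace[OF etaleD(1)[OF e] U s] in \<open>simp add: compose_eq\<close>)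
qed

lemma \<Gamma>_Cmp:
  assumes e: "etale Z W p" "etale Z W' p'" "etale Z W'' p''"
    and f: "bundle_map W p W' p' f" and g: "bundle_map W' p' W'' p'' g"
  shows "fmor (\<Gamma> Z) (W, p) (W'', p'') (compose (topspace (fst W)) g f) =
     Cmp (Shv_in K Z) (fob (\<Gamma> Z) (W, p)) Q R (fmor (\<Gamma> Z) (W', p') (W'', p'') g) (fmor (\<Gamma> Z) (W, p) (W', p') f)"
  unfolding \<Gamma>_fmor Shv_Cmp \<Gamma>_fob
proof (rule restrict_ext)
  fix U assume "U \<in> {U. op U}"
  hence U: "op U" by simp
  have "compose U (compose (topspace (fst W)) g f) s = compose U g (compose U f s)"
    if s: "s \<in> sections Z (W, p) U" for s
    unfolding compose_def using section_topspace[OF etaleD(1)[OF e(1)] U s] by (intro restrict_ext) simp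
  thus "(\<lambda>s\<in>sections Z (W, p) U. compose U (compose (topspace (fst W)) g f) s) =
     compose (sections Z (W, p) U) ((\<lambda>U\<in>{U. op U}. \<lambda>s\<in>sections Z (W', p') U. compose U g s) U)
        ((\<lambda>U\<in>{U. op U}. \<lambda>s\<in>sections Z (W, p) U. compose U f s) U)"
    unfolding compose_def[of "sections Z (W, p) U"]
    using bundle_map_section[OF e(1,2) f U] U by (intro restrict_ext) simp
qed

section \<open>The unit\<close>

text \<open>
  The germ at \<open>p w\<close> of a section through \<open>w\<close>, independent of the choice of that section by
  \<open>germ_at_section\<close>.
\<close>

definition germ_at :: "'w lps \<Rightarrow> ('w \<Rightarrow> 'a) \<Rightarrow> 'w \<Rightarrow> ('a, 'a \<Rightarrow> 'w) germ" where
  "germ_at W p w = (let q = (SOME q. op (fst q) \<and> snd q \<in> sections Z (W, p) (fst q) \<and>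
       p w \<in> fst q \<and> snd q (p w) = w)
     in germ Z (fob (\<Gamma> Z) (W, p)) (p w) (fst q) (snd q))"

text \<open>
  Two sections through the same point agree near it, so they have the same germ there.
\<close>

lemma germ_at_section:
  assumes e: "etale Z W p" and U: "op U" and s: "s \<in> sections Z (W, p) U" and x: "x \<in> U"
  shows "germ_at W p (s x) = germ Z (fob (\<Gamma> Z) (W, p)) x U s"
proof -
  note W = etaleD(1)[OF e]
  have ps: "p (s x) = x" using s x unfolding sections_iff[OF W U] by blast
  define q where "q = (SOME q. op (fst q) \<and> snd q \<in> sections Z (W, p) (fst q) \<and>
       p (s x) \<in> fst q \<and> snd q (p (s x)) = s x)"
  have "op (fst q) \<and> snd q \<in> sections Z (W, p) (fst q) \<and> p (s x) \<in> fst q \<and> snd q (p (s x)) = s x"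
    unfolding q_def by (rule someI[of _ "(U, s)"]) (use U s x ps in simp)
  hence q: "op (fst q)" "snd q \<in> sections Z (W, p) (fst q)" "x \<in> fst q" "snd q x = s x"
    unfolding ps by auto
  obtain N where N: "op N" "x \<in> N" "N \<subseteq> fst q \<inter> U" "\<forall>y\<in>N. snd q y = s y"
    using sections_agree_near[OF e q(1,2) U s q(3) x q(4)] .
  have "germ Z (fob (\<Gamma> Z) (W, p)) x (fst q) (snd q) = germ Z (fob (\<Gamma> Z) (W, p)) x U s"
  proof (rule germ_eqI[OF presheaf_\<Gamma>[OF W] q(1) _ U _ N(1,2)])
    show "restr (fob (\<Gamma> Z) (W, p)) (fst q) N (snd q) = restr (fob (\<Gamma> Z) (W, p)) U N s"
      unfolding restr_\<Gamma>[OF q(2)] restr_\<Gamma>[OF s] by (rule restrict_ext) (use N(4) in blast)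
  qed (use q(2) s N(3) in auto)
  moreover have "germ_at W p (s x) = germ Z (fob (\<Gamma> Z) (W, p)) (p (s x)) (fst q) (snd q)"
    unfolding germ_at_def Let_def q_def ..
  ultimately show ?thesis unfolding ps by simp
qed

lemma section_germs_eqD:
  assumes W: "W \<in> LPS UNIV" and U: "s \<in> sections Z (W, p) U"
    and V: "op V" "t \<in> sections Z (W, p) V" "x \<in> V"
    and eq: "germ Z (fob (\<Gamma> Z) (W, p)) x U s = germ Z (fob (\<Gamma> Z) (W, p)) x V t"
  shows "s x = t x"
proof -
  obtain N where N: "op N" "x \<in> N" "N \<subseteq> U" "N \<subseteq> V"
    "restr (fob (\<Gamma> Z) (W, p)) U N s = restr (fob (\<Gamma> Z) (W, p)) V N t"
    using germ_eqD[OF presheaf_\<Gamma>[OF W] V(1) _ V(3) eq] V(2) by auto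
  have "restrict s N = restrict t N" using N(5) unfolding restr_\<Gamma>[OF U] restr_\<Gamma>[OF V(2)] .
  from fun_cong[OF this, of x] show ?thesis using N(2) by simp
qed

text \<open>
  The map sends the section \<open>s\<close> to the section \<open>x \<mapsto> germ\<^sub>x s\<close>, so it is a bundle map. It is
  surjective since every germ is a germ of some \<open>s\<close> and hence the image of \<open>s x\<close>, and injective since
  \<open>s x\<close> can be read off from the germ of \<open>s\<close> at \<open>x\<close>.
\<close>

lemma unit_bundle_iso:
  assumes e: "etale Z W p" and m: "germ_model (fob (\<Gamma> Z) (W, p)) T c d"
  shows "bundle_map W p T (label_proj T d) (\<lambda>w\<in>topspace (fst W). c (germ_at W p w))" (is "bundle_map _ _ _ _ ?\<theta>")
    and "bij_betw (\<lambda>w\<in>topspace (fst W). c (germ_at W p w)) (topspace (fst W)) (topspace (fst T))"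
proof -
  note W = etaleD(1)[OF e]
  let ?P = "fob (\<Gamma> Z) (W, p)"
  note P = presheaf_\<Gamma>[OF W, of p]
  note M = model_facts[OF P m]
  have \<theta>: "?\<theta> (s x) = c (germ Z ?P x U s)" if "op U" "s \<in> sections Z (W, p) U" "x \<in> U" for U s x
    using section_topspace[OF W that] germ_at_section[OF e that] by simp
  have comp: "compose U ?\<theta> s = label_section ?P c U s" if "op U" "s \<in> sections Z (W, p) U" for U s
    unfolding label_section_def compose_def by (rule restrict_ext) (rule \<theta>[OF that])
  show 1: "bundle_map W p T (label_proj T d) ?\<theta>"
    unfolding bundle_map_def
  proof
    fix w assume w: "w \<in> topspace (fst W)"
    obtain U s where U: "op U" and s: "s \<in> sections Z (W, p) U" "p w \<in> U" "s (p w) = w"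
      using section_through[OF e w] .
    have ws: "w \<in> s ` U" using s(2,3) by (metis imageI)
    have "compose U ?\<theta> s \<in> sections Z (T, label_proj T d) U"
      unfolding comp[OF U s(1)] by (rule label_section[OF P m U]) (use s(1) in simp)
    from bundle_map_by_sections[OF e etale_model[OF P m] w U s(1) ws this]
    show "dimap_at W T ?\<theta> w \<and> label_proj T d (?\<theta> w) = p w" by blast
  qed
  show "bij_betw ?\<theta> (topspace (fst W)) (topspace (fst T))"
    unfolding bij_betw_def
  proof
    show "inj_on ?\<theta> (topspace (fst W))"
    proof (rule inj_onI)
      fix v w assume v: "v \<in> topspace (fst W)" and w: "w \<in> topspace (fst W)" and eq: "?\<theta> v = ?\<theta> w"
      obtain U s where U: "op U" and s: "s \<in> sections Z (W, p) U" "p v \<in> U" "s (p v) = v"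
        using section_through[OF e v] .
      obtain V t where V: "op V" and t: "t \<in> sections Z (W, p) V" "p w \<in> V" "t (p w) = w"
        using section_through[OF e w] .
      have pvw: "p v = p w" using bundle_mapD(2)[OF 1 v] bundle_mapD(2)[OF 1 w] eq by simp
      have "c (germ Z ?P (p v) U s) = c (germ Z ?P (p w) V t)"
        using eq unfolding \<theta>[OF U s(1,2), unfolded s(3)] \<theta>[OF V t(1,2), unfolded t(3)] .
      hence eq': "c (germ Z ?P (p v) U s) = c (germ Z ?P (p v) V t)" unfolding pvw .
      have pv: "p v \<in> V" using t(2) unfolding pvw .
      have "germ Z ?P (p v) U s = germ Z ?P (p v) V t"
        by (rule label_section_eqD[OF P m U _ s(2) V _ pv eq']) (use s(1) t(1) in simp_all)
      from section_germs_eqD[OF W s(1) V t(1) pv this]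
      have "s (p v) = t (p w)" unfolding pvw .
      thus "v = w" unfolding s(3) t(3) .
    qed
    show "?\<theta> ` topspace (fst W) = topspace (fst T)"
    proof
      show "?\<theta> ` topspace (fst W) \<subseteq> topspace (fst T)" using bundle_mapD(3)[OF 1] by blast
      show "topspace (fst T) \<subseteq> ?\<theta> ` topspace (fst W)"
      proof
        fix g assume "g \<in> topspace (fst T)"
        then obtain x U s where U: "op U" "s \<in> fob ?P U" "x \<in> U" "g = c (germ Z ?P x U s)"
          by (rule model_germ[OF P m])
        hence s: "s \<in> sections Z (W, p) U" by simp
        have "g = ?\<theta> (s x)" using \<theta>[OF U(1) s U(3)] U(4) by simp
        thus "g \<in> ?\<theta> ` topspace (fst W)" using section_topspace[OF W U(1) s U(3)] by blast
      qed
    qed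
  qed
qed

text \<open>
  This is why \<open>\<Gamma>\<close> takes values in \<open>Shv_in K\<close>: the total space of the bundle, which lies in
  \<open>K\<close>, is itself a copy of the space of germs.
\<close>

lemma germ_top_\<Gamma>:
  assumes e: "etale Z W p"
  shows "germ_top Z (fob (\<Gamma> Z) (W, p)) homeomorphic_space fst W"
proof -
  note P = presheaf_\<Gamma>[OF etaleD(1)[OF e], of p]
  note m = germ_model_lps[OF P]
  have "fst W homeomorphic_space fst (germ_lps Z (fob (\<Gamma> Z) (W, p)))"
    using bundle_map_homeomorphism[OF e etale_model[OF P m] unit_bundle_iso[OF e m]] .
  thus ?thesis unfolding germ_lps(2)[OF P] by (rule iffD1[OF homeomorphic_space_sym])
qed

lemma \<Gamma>_Ob:
  assumes "(W, p) \<in> Ob (Etale K Z)"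
  shows "fob (\<Gamma> Z) (W, p) \<in> Ob (Shv_in K Z)"
proof -
  have e: "etale Z W p" and "W \<in> LPS K" using assms unfolding Etale_Ob by (rule conjunct2, rule conjunct1)
  hence K: "fst W \<in> K" unfolding LPS_def by auto
  have "\<exists>M\<in>K. germ_top Z (fob (\<Gamma> Z) (W, p)) homeomorphic_space M"
    by (rule bexI[where x = "fst W"], rule germ_top_\<Gamma>[OF e], rule K)
  with presheaf_\<Gamma>[OF etaleD(1)[OF e]] sheaf_\<Gamma>[OF etaleD(1)[OF e]]
  show ?thesis unfolding Shv_Ob by (intro conjI)
qed

lemma is_functor_\<Gamma>: "is_functor (Etale K Z) (Shv_in K Z) (\<Gamma> Z)"
  unfolding is_functor_def
proof (intro conjI ballI)
  fix E assume E: "E \<in> Ob (Etale K Z)"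
  obtain W p where [simp]: "E = (W, p)" by (cases E)
  have e: "etale Z W p" using E by (simp add: Etale_Ob)
  show "fob (\<Gamma> Z) E \<in> Ob (Shv_in K Z)" using \<Gamma>_Ob[of W p] E by simp
  show "fmor (\<Gamma> Z) E E (Idn (Etale K Z) E) = Idn (Shv_in K Z) (fob (\<Gamma> Z) E)"
    using \<Gamma>_Idn[OF e] by (simp add: Etale_Idn)
next
  fix E E' f assume E: "E \<in> Ob (Etale K Z)" "E' \<in> Ob (Etale K Z)" and f: "f \<in> Hom (Etale K Z) E E'"
  obtain W p where [simp]: "E = (W, p)" by (cases E)
  obtain W' p' where [simp]: "E' = (W', p')" by (cases E')
  have e: "etale Z W p" "etale Z W' p'" using E by (simp_all add: Etale_Ob)
  show "fmor (\<Gamma> Z) E E' f \<in> Hom (Shv_in K Z) (fob (\<Gamma> Z) E) (fob (\<Gamma> Z) E')"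
    using \<Gamma>_Hom[OF e, of f K] f by (simp add: Etale_Hom[OF e])
next
  fix E E' E'' f g assume E: "E \<in> Ob (Etale K Z)" "E' \<in> Ob (Etale K Z)" "E'' \<in> Ob (Etale K Z)"
    and f: "f \<in> Hom (Etale K Z) E E'" and g: "g \<in> Hom (Etale K Z) E' E''"
  obtain W p where [simp]: "E = (W, p)" by (cases E)
  obtain W' p' where [simp]: "E' = (W', p')" by (cases E')
  obtain W'' p'' where [simp]: "E'' = (W'', p'')" by (cases E'')
  have e: "etale Z W p" "etale Z W' p'" "etale Z W'' p''" using E by (simp_all add: Etale_Ob)
  show "fmor (\<Gamma> Z) E E'' (Cmp (Etale K Z) E E' E'' g f) =
     Cmp (Shv_in K Z) (fob (\<Gamma> Z) E) (fob (\<Gamma> Z) E') (fob (\<Gamma> Z) E'') (fmor (\<Gamma> Z) E' E'' g) (fmor (\<Gamma> Z) E E' f)"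
    using \<Gamma>_Cmp[OF e, of f g] f g by (simp add: Etale_Hom[OF e(1,2)] Etale_Hom[OF e(2,3)] Etale_Cmp)
qed

section \<open>The functor of germs\<close>

abbreviation spc :: "'w topology set \<Rightarrow> ('a, 's) presheaf \<Rightarrow> 'w topology" where
  "spc K P \<equiv> fst (relabelling K Z P)"

abbreviation lab :: "'w topology set \<Rightarrow> ('a, 's) presheaf \<Rightarrow> ('a, 's) germ \<Rightarrow> 'w" where
  "lab K P \<equiv> snd (relabelling K Z P)"

abbreviation total :: "'w topology set \<Rightarrow> ('a, 's) presheaf \<Rightarrow> 'w lps" where
  "total K P \<equiv> transport_lps (spc K P) (lab K P) (germ_lps Z P)"

abbreviation proj :: "'w topology set \<Rightarrow> ('a, 's) presheaf \<Rightarrow> 'w \<Rightarrow> 'a" where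
  "proj K P \<equiv> label_proj (total K P) (unlabel K Z P)"

lemma homeomorphic_maps_inv_into:
  assumes "homeomorphic_map X Y f"
  shows "homeomorphic_maps X Y f (inv_into (topspace X) f)"
proof -
  obtain g where g: "homeomorphic_maps X Y f g" using assms homeomorphic_map_maps by blast
  note h = homeo_facts[OF g]
  have "inj_on f (topspace X)" using h(1) by (metis inj_onI)
  hence "inv_into (topspace X) f y = g y" if "y \<in> topspace Y" for y
    using inv_into_f_f[of f "topspace X" "g y"] h(2,4)[OF that] by simp
  thus ?thesis using homeomorphic_maps_eq[OF g, of f] by simp
qed

lemma relabelling:
  assumes "\<exists>M\<in>K. germ_top Z P homeomorphic_space M"
  shows "spc K P \<in> K" "homeomorphic_maps (germ_top Z P) (spc K P) (lab K P) (unlabel K Z P)"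
proof -
  obtain M where M: "M \<in> K" "germ_top Z P homeomorphic_space M" using assms by blast
  then obtain c where c: "homeomorphic_map (germ_top Z P) M c"
    using homeomorphic_space by blast
  have "case relabelling K Z P of (M, c) \<Rightarrow> M \<in> K \<and> homeomorphic_map (germ_top Z P) M c"
    unfolding relabelling_def by (rule someI[of _ "(M, c)"]) (use M c in simp)
  hence *: "spc K P \<in> K" "homeomorphic_map (germ_top Z P) (spc K P) (lab K P)"
    by (auto simp: case_prod_unfold)
  show "spc K P \<in> K" by fact
  show "homeomorphic_maps (germ_top Z P) (spc K P) (lab K P) (unlabel K Z P)"
    unfolding unlabel_def using homeomorphic_maps_inv_into[OF *(2)] .
qed

lemma fst_total [simp]: "fst (total K P) = spc K P"
  by (simp add: transport_lps_def)

lemma \<Lambda>_fob: "fob (\<Lambda> K Z) P = (total K P, proj K P)"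
  by (simp add: \<Lambda>_def germ_bundle_def case_prod_unfold label_proj_def Let_def)

lemma \<Lambda>_fmor:
  "fmor (\<Lambda> K Z) P Q \<eta> = (\<lambda>w\<in>topspace (spc K P). lab K Q (germ_map Z Q \<eta> (unlabel K Z P w)))"
  by (simp add: \<Lambda>_def)

lemma total_model:
  assumes "P \<in> Ob (Shv_in K Z)"
  shows "presheaf P" "germ_model P (total K P) (lab K P) (unlabel K Z P)"
    "(total K P, proj K P) \<in> Ob (Etale K Z)" "etale Z (total K P) (proj K P)"
proof -
  have ex: "\<exists>M\<in>K. germ_top Z P homeomorphic_space M" using assms unfolding Shv_Ob by blast
  show P: "presheaf P" using assms unfolding Shv_Ob by blast
  show m: "germ_model P (total K P) (lab K P) (unlabel K Z P)"
    by (rule germ_model_transport[OF P relabelling(2)[OF ex]])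
  show e: "etale Z (total K P) (proj K P)" by (rule etale_model[OF P m])
  have "total K P \<in> LPS K"
    using transport_in_LPS[OF germ_lps(1)[OF P], of "spc K P" "lab K P"] relabelling[OF ex] germ_lps(2)[OF P] by simp
  thus "(total K P, proj K P) \<in> Ob (Etale K Z)" unfolding Etale_Ob using e by blast
qed

text \<open>
  A natural transformation commutes with restriction, so all representatives of a germ yield the
  same germ and the union collapses to one term.
\<close>

lemma germ_map_germ:
  assumes P: "presheaf P" and Q: "presheaf Q" and \<eta>: "is_nat_trans (op_cat (Opens Z)) set_cat P Q \<eta>"
    and U: "op U" and s: "s \<in> fob P U" and x: "x \<in> U"
  shows "germ_map Z Q \<eta> (germ Z P x U s) = germ Z Q x U (\<eta> U s)"
proof -
  have in_Q: "\<eta> V t \<in> fob Q V" if "op V" "t \<in> fob P V" for V t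
    using \<eta> that unfolding nat_trans_iff by blast
  have nat: "\<eta> N (restr P V N t) = restr Q V N (\<eta> V t)" if "op V" "op N" "N \<subseteq> V" "t \<in> fob P V" for V N t
    using \<eta> that unfolding nat_trans_iff by blast
  have rep: "germ Z Q x V (\<eta> V t) = germ Z Q x U (\<eta> U s)"
    if Vt: "(V, t) \<in> snd (germ Z P x U s)" for V t
  proof -
    obtain N where V: "op V" "x \<in> V" "t \<in> fob P V"
      and N: "op N" "x \<in> N" "N \<subseteq> U \<inter> V" "restr P U N s = restr P V N t"
      using Vt unfolding mem_germ by blast
    have NU: "N \<subseteq> U" "N \<subseteq> V" using N(3) by auto
    show ?thesis
      by (rule germ_eqI[OF Q V(1) in_Q[OF V(1,3)] U in_Q[OF U s] N(1,2) NU(2,1)])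
         (simp add: nat[OF V(1) N(1) NU(2) V(3), symmetric] nat[OF U N(1) NU(1) s, symmetric] N(4))
  qed
  have mem: "(U, s) \<in> snd (germ Z P x U s)"
    unfolding mem_germ using U s x by (intro conjI exI[of _ U]) auto
  have "(\<Union>(V, t)\<in>snd (germ Z P x U s). snd (germ Z Q x V (\<eta> V t))) = snd (germ Z Q x U (\<eta> U s))"
  proof (rule SUP_eq_const)
    show "snd (germ Z P x U s) \<noteq> {}" using mem by blast
    show "(case q of (V, t) \<Rightarrow> snd (germ Z Q x V (\<eta> V t))) = snd (germ Z Q x U (\<eta> U s))"
      if "q \<in> snd (germ Z P x U s)" for q using that by (cases q) (simp add: rep)
  qed
  moreover have "germ_map Z Q \<eta> (germ Z P x U s) =
      (x, \<Union>(V, t)\<in>snd (germ Z P x U s). snd (germ Z Q x V (\<eta> V t)))"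
    by (simp add: germ_map_def case_prod_unfold)
  moreover have "(x, snd (germ Z Q x U (\<eta> U s))) = germ Z Q x U (\<eta> U s)"
    by (rule prod_eqI) simp_all
  ultimately show ?thesis by simp
qed

lemma \<Lambda>_fmor_germ:
  assumes P: "P \<in> Ob (Shv_in K Z)" and Q: "Q \<in> Ob (Shv_in K Z)" and \<eta>: "\<eta> \<in> Hom (Shv_in K Z) P Q"
    and U: "op U" and s: "s \<in> fob P U"
  shows "x \<in> U \<Longrightarrow> fmor (\<Lambda> K Z) P Q \<eta> (lab K P (germ Z P x U s)) = lab K Q (germ Z Q x U (\<eta> U s))"
    and "compose U (fmor (\<Lambda> K Z) P Q \<eta>) (label_section P (lab K P) U s) = label_section Q (lab K Q) U (\<eta> U s)"
proof -
  note mP = model_facts[OF total_model(1,2)[OF P]]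
  have nat: "is_nat_trans (op_cat (Opens Z)) set_cat P Q \<eta>" using \<eta> unfolding Shv_Hom by blast
  show *: "fmor (\<Lambda> K Z) P Q \<eta> (lab K P (germ Z P x U s)) = lab K Q (germ Z Q x U (\<eta> U s))" if x: "x \<in> U" for x
    using mP(2,4)[OF germ_in_top[OF U s x]]
      germ_map_germ[OF total_model(1)[OF P] total_model(1)[OF Q] nat U s x]
    by (simp add: \<Lambda>_fmor)
  show "compose U (fmor (\<Lambda> K Z) P Q \<eta>) (label_section P (lab K P) U s) = label_section Q (lab K Q) U (\<eta> U s)"
    unfolding label_section_def compose_def by (rule restrict_ext) (use * in simp)
qed

lemma \<Lambda>_bundle_map:
  assumes P: "P \<in> Ob (Shv_in K Z)" and Q: "Q \<in> Ob (Shv_in K Z)" and \<eta>: "\<eta> \<in> Hom (Shv_in K Z) P Q"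
  shows "bundle_map (total K P) (proj K P) (total K Q) (proj K Q) (fmor (\<Lambda> K Z) P Q \<eta>)"
  unfolding bundle_map_def
proof
  note mP = total_model(1,2)[OF P] and mQ = total_model(1,2)[OF Q]
  fix w assume w: "w \<in> topspace (fst (total K P))"
  obtain x U s where U: "op U" and s: "s \<in> fob P U" and x: "x \<in> U" and wg: "w = lab K P (germ Z P x U s)"
    using model_germ[OF mP w] .
  have sec: "label_section P (lab K P) U s \<in> sections Z (total K P, proj K P) U"
    by (rule label_section[OF mP U s])
  have ws: "w \<in> label_section P (lab K P) U s ` U"
    unfolding wg by (rule image_eqI[OF _ x]) (simp add: label_section_def x)
  have "\<eta> U s \<in> fob Q U" using \<eta> U s unfolding Shv_Hom nat_trans_iff by blast
  from label_section[OF mQ U this]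
  have "compose U (fmor (\<Lambda> K Z) P Q \<eta>) (label_section P (lab K P) U s) \<in> sections Z (total K Q, proj K Q) U"
    unfolding \<Lambda>_fmor_germ(2)[OF P Q \<eta> U s] .
  from bundle_map_by_sections[OF total_model(4)[OF P] total_model(4)[OF Q] w U sec ws this]
  show "dimap_at (total K P) (total K Q) (fmor (\<Lambda> K Z) P Q \<eta>) w \<and>
    proj K Q (fmor (\<Lambda> K Z) P Q \<eta> w) = proj K P w" by blast
qed

lemma is_functor_\<Lambda>: "is_functor (Shv_in K Z) (Etale K Z) (\<Lambda> K Z)"
  unfolding is_functor_def
proof (intro conjI ballI)
  fix P assume P: "P \<in> Ob (Shv_in K Z)"
  show "fob (\<Lambda> K Z) P \<in> Ob (Etale K Z)" unfolding \<Lambda>_fob by (rule total_model(3)[OF P])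
  have idn: "Idn (Shv_in K Z) P \<in> Hom (Shv_in K Z) P P" by (rule cat_idn[OF is_category_Shv P])
  show "fmor (\<Lambda> K Z) P P (Idn (Shv_in K Z) P) = Idn (Etale K Z) (fob (\<Lambda> K Z) P)"
    unfolding \<Lambda>_fob Etale_Idn
  proof (rule extensionalityI[of _ "topspace (fst (total K P))"])
    show "fmor (\<Lambda> K Z) P P (Idn (Shv_in K Z) P) \<in> extensional (topspace (fst (total K P)))"
      by (simp add: \<Lambda>_fmor)
    fix w assume w: "w \<in> topspace (fst (total K P))"
    obtain x U s where U: "op U" and s: "s \<in> fob P U" and x: "x \<in> U" and wg: "w = lab K P (germ Z P x U s)"
      using model_germ[OF total_model(1,2)[OF P] w] .
    have "Idn (Shv_in K Z) P U s = s" using U s by (simp add: Shv_Idn)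
    thus "fmor (\<Lambda> K Z) P P (Idn (Shv_in K Z) P) w = (\<lambda>w\<in>topspace (fst (total K P)). w) w"
      using \<Lambda>_fmor_germ(1)[OF P P idn U s x] w wg by simp
  qed simp
next
  fix P Q \<eta> assume P: "P \<in> Ob (Shv_in K Z)" "Q \<in> Ob (Shv_in K Z)" "\<eta> \<in> Hom (Shv_in K Z) P Q"
  show "fmor (\<Lambda> K Z) P Q \<eta> \<in> Hom (Etale K Z) (fob (\<Lambda> K Z) P) (fob (\<Lambda> K Z) Q)"
    unfolding \<Lambda>_fob Etale_Hom[OF total_model(4)[OF P(1)] total_model(4)[OF P(2)]]
    using \<Lambda>_bundle_map[OF P] by (simp add: \<Lambda>_fmor)
next
  fix P Q R \<eta> \<theta> assume P: "P \<in> Ob (Shv_in K Z)" and Q: "Q \<in> Ob (Shv_in K Z)" and R: "R \<in> Ob (Shv_in K Z)"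
    and \<eta>: "\<eta> \<in> Hom (Shv_in K Z) P Q" and \<theta>: "\<theta> \<in> Hom (Shv_in K Z) Q R"
  let ?c = "Cmp (Shv_in K Z) P Q R \<theta> \<eta>"
  have c: "?c \<in> Hom (Shv_in K Z) P R" by (rule cat_comp[OF is_category_Shv P Q R \<eta> \<theta>])
  show "fmor (\<Lambda> K Z) P R ?c = Cmp (Etale K Z) (fob (\<Lambda> K Z) P) (fob (\<Lambda> K Z) Q) (fob (\<Lambda> K Z) R)
      (fmor (\<Lambda> K Z) Q R \<theta>) (fmor (\<Lambda> K Z) P Q \<eta>)"
    unfolding \<Lambda>_fob Etale_Cmp
  proof (rule extensionalityI[of _ "topspace (fst (total K P))"])
    show "fmor (\<Lambda> K Z) P R ?c \<in> extensional (topspace (fst (total K P)))" by (simp add: \<Lambda>_fmor)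
    fix w assume w: "w \<in> topspace (fst (total K P))"
    obtain x U s where U: "op U" and s: "s \<in> fob P U" and x: "x \<in> U" and wg: "w = lab K P (germ Z P x U s)"
      using model_germ[OF total_model(1,2)[OF P] w] .
    have \<eta>s: "\<eta> U s \<in> fob Q U" using \<eta> U s unfolding Shv_Hom nat_trans_iff by blast
    have "?c U s = \<theta> U (\<eta> U s)" using U s by (simp add: Shv_Cmp compose_eq)
    thus "fmor (\<Lambda> K Z) P R ?c w =
        compose (topspace (fst (total K P))) (fmor (\<Lambda> K Z) Q R \<theta>) (fmor (\<Lambda> K Z) P Q \<eta>) w"
      using \<Lambda>_fmor_germ(1)[OF P R c U s x] \<Lambda>_fmor_germ(1)[OF P Q \<eta> U s x] 
        \<Lambda>_fmor_germ(1)[OF Q R \<theta> U \<eta>s x] w unfolding wg by (simp add: compose_eq)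
  qed (rule compose_extensional)
qed

section \<open>The equivalence\<close>

text \<open>
  Naturality is checked along a section \<open>s\<close> through the given point: both composites send
  \<open>s x\<close> to the germ of \<open>\<theta> s\<close> at \<open>x\<close>, for a bundle map \<open>\<theta>\<close>.
\<close>

lemma unit_nat_iso:
  "is_nat_iso (Etale K Z) (Etale K Z) id_func (comp_func (\<Lambda> K Z) (\<Gamma> Z))
     (\<lambda>E. \<lambda>w\<in>topspace (fst (fst E)). lab K (fob (\<Gamma> Z) E) (germ_at (fst E) (snd E) w))"
  (is "is_nat_iso _ _ _ _ ?\<eta>")
proof -
  have iso: "is_isomorphism (Etale K Z) (fob id_func E) (fob (comp_func (\<Lambda> K Z) (\<Gamma> Z)) E) (?\<eta> E)"
    if E: "E \<in> Ob (Etale K Z)" for E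
  proof -
    obtain W p where [simp]: "E = (W, p)" by (cases E)
    have e: "etale Z W p" using E by (simp add: Etale_Ob)
    have P: "fob (\<Gamma> Z) (W, p) \<in> Ob (Shv_in K Z)" using E by (simp add: \<Gamma>_Ob)
    note u = unit_bundle_iso[OF e total_model(2)[OF P]]
    have "is_isomorphism (Etale K Z) (W, p) (total K (fob (\<Gamma> Z) (W, p)), proj K (fob (\<Gamma> Z) (W, p))) (?\<eta> (W, p))"
      by (rule is_isomorphism_Etale[OF _ total_model(3)[OF P]]) (use u E in simp_all)
    thus ?thesis by (simp add: id_func_def comp_func_def \<Lambda>_fob)
  qed
  have "Cmp (Etale K Z) (fob id_func E) (fob id_func E') (fob (comp_func (\<Lambda> K Z) (\<Gamma> Z)) E')
          (?\<eta> E') (fmor id_func E E' f) =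
        Cmp (Etale K Z) (fob id_func E) (fob (comp_func (\<Lambda> K Z) (\<Gamma> Z)) E) (fob (comp_func (\<Lambda> K Z) (\<Gamma> Z)) E')
          (fmor (comp_func (\<Lambda> K Z) (\<Gamma> Z)) E E' f) (?\<eta> E)"
    if E: "E \<in> Ob (Etale K Z)" "E' \<in> Ob (Etale K Z)" and f: "f \<in> Hom (Etale K Z) E E'" for E E' f
  proof -
    obtain W p where [simp]: "E = (W, p)" by (cases E)
    obtain W' p' where [simp]: "E' = (W', p')" by (cases E')
    have e: "etale Z W p" and e': "etale Z W' p'" using E by (simp_all add: Etale_Ob)
    have f': "bundle_map W p W' p' f" using f by (simp add: Etale_Hom[OF e e'])
    let ?P = "fob (\<Gamma> Z) (W, p)" and ?Q = "fob (\<Gamma> Z) (W', p')"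
    have P: "?P \<in> Ob (Shv_in K Z)" and Q: "?Q \<in> Ob (Shv_in K Z)" using E by (simp_all add: \<Gamma>_Ob)
    note \<Gamma>f = \<Gamma>_Hom[OF e e' f', of K]
    have "compose (topspace (fst W)) (?\<eta> (W', p')) f =
       compose (topspace (fst W)) (fmor (\<Lambda> K Z) ?P ?Q (fmor (\<Gamma> Z) (W, p) (W', p') f)) (?\<eta> (W, p))"
      unfolding compose_def
    proof (rule restrict_ext)
      fix w assume w: "w \<in> topspace (fst W)"
      obtain U s where U: "op U" and s: "s \<in> sections Z (W, p) U" "p w \<in> U" "s (p w) = w"
        using section_through[OF e w] .
      have fs: "compose U f s \<in> sections Z (W', p') U" by (rule bundle_map_section[OF e e' f' U s(1)])
      have "f w = compose U f s (p w)" using s by (simp add: compose_eq)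
      hence "?\<eta> (W', p') (f w) = lab K ?Q (germ Z ?Q (p w) U (compose U f s))"
        using bundle_mapD(3)[OF f' w] germ_at_section[OF e' U fs s(2)] by simp
      moreover have "?\<eta> (W, p) w = lab K ?P (germ Z ?P (p w) U s)"
        using germ_at_section[OF e U s(1,2)] w s(3) by simp
      moreover have "fmor (\<Lambda> K Z) ?P ?Q (fmor (\<Gamma> Z) (W, p) (W', p') f) (lab K ?P (germ Z ?P (p w) U s)) =
          lab K ?Q (germ Z ?Q (p w) U (compose U f s))"
        using \<Lambda>_fmor_germ(1)[OF P Q \<Gamma>f U _ s(2), of s] U s(1) by (simp add: \<Gamma>_fmor)
      ultimately show "?\<eta> (W', p') (f w) =
        fmor (\<Lambda> K Z) ?P ?Q (fmor (\<Gamma> Z) (W, p) (W', p') f) (?\<eta> (W, p) w)" by simp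
    qed
    thus ?thesis by (simp add: id_func_def comp_func_def Etale_Cmp)
  qed
  thus ?thesis unfolding is_nat_iso_def is_nat_trans_def using iso unfolding is_isomorphism_def by blast
qed

text \<open>
  The counit of the equivalence is the inverse of this transformation, which sends \<open>s \<in> P(U)\<close> to the
  section \<open>x \<mapsto> germ\<^sub>x s\<close>.
\<close>

lemma counit_nat_iso:
  "is_nat_iso (Shv_in K Z) (Shv_in K Z) id_func (comp_func (\<Gamma> Z) (\<Lambda> K Z))
     (\<lambda>P. \<lambda>U\<in>{U. op U}. \<lambda>s\<in>fob P U. label_section P (lab K P) U s)"
  (is "is_nat_iso _ _ _ _ ?j")
proof -
  have Ob: "fob (\<Gamma> Z) (fob (\<Lambda> K Z) P) \<in> Ob (Shv_in K Z)" if P: "P \<in> Ob (Shv_in K Z)" for P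
    unfolding \<Lambda>_fob by (rule \<Gamma>_Ob[OF total_model(3)[OF P]])
  have sec: "label_section P (lab K P) U s \<in> sections Z (fob (\<Lambda> K Z) P) U"
    if "P \<in> Ob (Shv_in K Z)" "op U" "s \<in> fob P U" for P U s
    unfolding \<Lambda>_fob by (rule label_section[OF total_model(1,2)[OF that(1)] that(2,3)])
  have hom: "?j P \<in> Hom (Shv_in K Z) P (fob (\<Gamma> Z) (fob (\<Lambda> K Z) P))" if P: "P \<in> Ob (Shv_in K Z)" for P
    unfolding Shv_Hom nat_trans_iff \<Gamma>_fob
  proof (intro conjI allI impI)
    show "?j P \<in> extensional {U. op U}" by simp
    show "?j P U \<in> fob P U \<rightarrow>\<^sub>E sections Z (fob (\<Lambda> K Z) P) U" if U: "op U" for U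
      using sec[OF P U] U by simp
    fix U V s assume U: "op U" and V: "op V" "V \<subseteq> U" and s: "s \<in> fob P U"
    note psh = total_model(1)[OF P]
    have "label_section P (lab K P) V (restr P U V s) = restrict (label_section P (lab K P) U s) V"
      unfolding label_section_def
      using germ_restr[OF psh U s V] V(2) by (intro restrict_ext) auto
    thus "?j P V (restr P U V s) = restr (fob (\<Gamma> Z) (fob (\<Lambda> K Z) P)) U V (?j P U s)"
      using U V s restr_mem[OF psh U V s] by (simp add: restr_\<Gamma>[OF sec[OF P U s]])
  qed
  have "bij_betw (?j P U) (fob P U) (sections Z (fob (\<Lambda> K Z) P) U)" if P: "P \<in> Ob (Shv_in K Z)" and U: "op U" for P U
  proof -
    have sh: "sheaf_condition Z P" using P unfolding Shv_Ob by blast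
    from label_section_bij[OF total_model(1,2)[OF P] sh U]
    have "bij_betw (label_section P (lab K P) U) (fob P U) (sections Z (fob (\<Lambda> K Z) P) U)"
      unfolding \<Lambda>_fob .
    thus ?thesis by (rule bij_betw_cong[THEN iffD1, rotated]) (use U in simp)
  qed
  hence iso: "is_isomorphism (Shv_in K Z) P (fob (\<Gamma> Z) (fob (\<Lambda> K Z) P)) (?j P)" if P: "P \<in> Ob (Shv_in K Z)" for P
    using is_isomorphism_Shv[OF P Ob[OF P] hom[OF P]] P by simp
  have "Cmp (Shv_in K Z) P Q (fob (\<Gamma> Z) (fob (\<Lambda> K Z) Q)) (?j Q) \<eta> =
      Cmp (Shv_in K Z) P (fob (\<Gamma> Z) (fob (\<Lambda> K Z) P)) (fob (\<Gamma> Z) (fob (\<Lambda> K Z) Q))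
        (fmor (\<Gamma> Z) (fob (\<Lambda> K Z) P) (fob (\<Lambda> K Z) Q) (fmor (\<Lambda> K Z) P Q \<eta>)) (?j P)"
    if P: "P \<in> Ob (Shv_in K Z)" and Q: "Q \<in> Ob (Shv_in K Z)" and \<eta>: "\<eta> \<in> Hom (Shv_in K Z) P Q" for P Q \<eta>
    unfolding Shv_Cmp
  proof (rule restrict_ext)
    fix U assume "U \<in> {U. op U}"
    hence U: "op U" by simp
    show "compose (fob P U) (?j Q U) (\<eta> U) = compose (fob P U)
       (fmor (\<Gamma> Z) (fob (\<Lambda> K Z) P) (fob (\<Lambda> K Z) Q) (fmor (\<Lambda> K Z) P Q \<eta>) U) (?j P U)"
      unfolding compose_def[of "fob P U"]
    proof (rule restrict_ext)
      fix s assume s: "s \<in> fob P U"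
      have "\<eta> U s \<in> fob Q U" using \<eta> U s unfolding Shv_Hom nat_trans_iff by blast
      thus "?j Q U (\<eta> U s) = fmor (\<Gamma> Z) (fob (\<Lambda> K Z) P) (fob (\<Lambda> K Z) Q) (fmor (\<Lambda> K Z) P Q \<eta>) U (?j P U s)"
        using U s sec[OF P U s] \<Lambda>_fmor_germ(2)[OF P Q \<eta> U s] by (simp add: \<Gamma>_fmor)
    qed
  qed
  hence "is_nat_trans (Shv_in K Z) (Shv_in K Z) id_func (comp_func (\<Gamma> Z) (\<Lambda> K Z)) ?j"
    unfolding is_nat_trans_def id_func_def comp_func_def using hom by simp
  thus ?thesis unfolding is_nat_iso_def using iso by (simp add: id_func_def comp_func_def)
qed

theorem Etale_equivalent_Shv_in:
  "is_cat_equivalence (Etale K Z) (Shv_in K Z) (\<Gamma> Z) (\<Lambda> K Z)"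
proof -
  have "\<exists>\<epsilon>. is_nat_iso (Shv_in K Z) (Shv_in K Z) (comp_func (\<Gamma> Z) (\<Lambda> K Z)) id_func \<epsilon>"
    by (rule nat_iso_inverse[OF is_category_Shv is_functor_id
          is_functor_comp[OF is_functor_\<Lambda> is_functor_\<Gamma>] counit_nat_iso])
  thus ?thesis unfolding is_cat_equivalence_def
    using is_category_Etale is_category_Shv is_functor_\<Gamma> is_functor_\<Lambda> unit_nat_iso by blast
qed

text \<open>
  The topology is carried over to the image of the injection.
\<close>

lemma homeomorphic_copy:
  fixes X :: "'x topology" and c :: "'x \<Rightarrow> 'y"
  assumes "inj_on c (topspace X)"
  shows "\<exists>M :: 'y topology. X homeomorphic_space M"
proof -
  let ?d = "inv_into (topspace X) c" and ?B = "c ` topspace X"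
  let ?M = "pullback_topology ?B ?d X"
  have dc: "?d (c x) = x" if "x \<in> topspace X" for x using assms that by simp
  have top: "topspace ?M = ?B" unfolding topspace_pullback_topology using dc by auto
  have "continuous_map X ?M c"
    unfolding continuous_map_def top openin_pullback_topology
  proof (intro conjI allI impI)
    fix S assume "\<exists>U. openin X U \<and> S = ?d -` U \<inter> ?B"
    then obtain U where U: "openin X U" "S = ?d -` U \<inter> ?B" by blast
    have "c x \<in> S \<longleftrightarrow> x \<in> U" if "x \<in> topspace X" for x
      using dc[OF that] that unfolding U(2) by simp
    hence "{x \<in> topspace X. c x \<in> S} = U" using openin_subset[OF U(1)] by blast
    thus "openin X {x \<in> topspace X. c x \<in> S}" using U(1) by simp
  qed auto
  moreover have "continuous_map ?M X ?d"
    unfolding continuous_map_def top openin_pullback_topology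
  proof (intro conjI allI impI)
    show "?d \<in> ?B \<rightarrow> topspace X" using dc by auto
    fix U assume U: "openin X U"
    show "\<exists>V. openin X V \<and> {y \<in> ?B. ?d y \<in> U} = ?d -` V \<inter> ?B" using U by (intro exI[of _ U]) auto
  qed
  ultimately have "homeomorphic_maps X ?M c ?d"
    unfolding homeomorphic_maps_def top using dc by auto
  thus ?thesis unfolding homeomorphic_space_def by blast
qed

text \<open>
  Over a universe, each germ can be named by an element of the type of points: there are enough names
  for the base point together with a representative.
\<close>

lemma Shv_in_UNIV:
  assumes "universe TYPE('a) TYPE('w)"
  shows "Shv_in (UNIV :: 'w topology set) Z = (Shv Z :: (('a, 'a \<Rightarrow> 'w) presheaf, _) cat)"
proof -
  obtain i :: "'a set \<times> ('a \<Rightarrow> 'w) \<Rightarrow> 'w" where i: "inj i" using assms unfolding universe_def by blast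
  have "\<exists>M :: 'w topology. germ_top Z P homeomorphic_space M" for P :: "('a, 'a \<Rightarrow> 'w) presheaf"
  proof -
    define r where "r g = (SOME q. op (fst q) \<and> snd q \<in> fob P (fst q) \<and> fst g \<in> fst q \<and>
       g = germ Z P (fst g) (fst q) (snd q))" for g
    \<comment> \<open>\<open>i\<close> accepts a subset of the base and a function: the subset records the base point, the
    constant function the name that \<open>i\<close> gives to the chosen representative\<close>
    define c where "c g = i ({fst g}, \<lambda>_. i (r g))" for g
    have r: "g = germ Z P (fst g) (fst (r g)) (snd (r g))" if g: "g \<in> topspace (germ_top Z P)" for g
    proof -
      obtain x U s where "op U" "s \<in> fob P U" "x \<in> U" "g = germ Z P x U s"
        using g unfolding topspace_germ_top by blast
      hence "\<exists>q. op (fst q) \<and> snd q \<in> fob P (fst q) \<and> fst g \<in> fst q \<and> g = germ Z P (fst g) (fst q) (snd q)"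
        by (intro exI[of _ "(U, s)"]) simp
      from someI_ex[OF this] show ?thesis unfolding r_def by blast
    qed
    have "inj_on c (topspace (germ_top Z P))"
    proof (rule inj_onI)
      fix g h assume g: "g \<in> topspace (germ_top Z P)" and h: "h \<in> topspace (germ_top Z P)" and eq: "c g = c h"
      have "({fst g}, \<lambda>_::'a. i (r g)) = ({fst h}, \<lambda>_. i (r h))" using eq i unfolding c_def by (simp add: inj_eq)
      hence "fst g = fst h" "i (r g) = i (r h)" by (auto dest: fun_cong)
      hence "fst g = fst h" "r g = r h" using i by (simp_all add: inj_eq)
      thus "g = h" using r[OF g] r[OF h] by simp
    qed
    thus ?thesis by (rule homeomorphic_copy)
  qed
  thus ?thesis unfolding Shv_in_def Shv_def full_subcat_def by simp
qed

end

theorem theorem1p3: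
  fixes Z :: "(nat \<Rightarrow> real) lps"
  assumes "Z \<in> LPS Spaces"
    and "universe TYPE(nat \<Rightarrow> real) TYPE('u)"
  shows "is_cat_equivalence (Etale (UNIV :: 'u topology set) Z) (Shv Z) (\<Gamma> Z) (\<Lambda> UNIV Z) \<and>
         is_cat_equivalence (Etale Spaces Z) (Shv_in Spaces Z) (\<Gamma> Z) (\<Lambda> Spaces Z)"
proof -
  interpret base_lps Z by unfold_locales (rule LPS_mono[OF assms(1)])
  show ?thesis
    using Etale_equivalent_Shv_in[of "UNIV :: 'u topology set"] Etale_equivalent_Shv_in[of Spaces]
    unfolding Shv_in_UNIV[OF assms(2)] by blast
qed

end
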